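(* Let $X=\{X_t\}_{t\ge 0}$ be a non-trivial critical CB process with branching mechanism $\psi$ and L\'evy measure $\Lambda$, where $\psi'(0+)=0$ and $\int_{\theta_0}^{+\infty}\frac{d\xi}{\psi(\xi)}<+\infty$ for some $\theta_0>0$. Suppose that the measure $x^2\Lambda(dx)$ is regularly varying at $+\infty$. If there exist $x>0$ and positive constants $Q_t$ with $Q_t\to 0$ as $t\uparrow+\infty$ such that the distribution functions $y\mapsto P_x\left(Q_tX_t\le y\,\middle|\,\tau>t\right)$ converge weakly, as $t\to+\infty$, to a non-degenerate probability distribution function $H(y)$ on $[0,+\infty)$, then there exist $\alpha\in(0,1]$ and a function $L$ slowly varying at $+\infty$ such that $\psi(\lambda)=\lambda^{1+\alpha}L(1/\lambda)$ for all $\lambda>0$. In this case, $Q_t/\bar F(t)\to c$ as $t\to+\infty$ for some constant $c\in(0,+\infty)$, and the Laplace transform of $H$ is given, for $\theta>0$, by $$h(\theta)=\int_{[0,+\infty)}e^{-\theta y}\,dH(y)=1-(1+c^{-\alpha}\theta^{-\alpha})^{-1/\alpha}.$$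
   Context: A (conservative) continuous-state branching process (CB process) is a $[0,+\infty)$-valued strong Markov process $X=\{X_t:t\ge 0\}$ with probabilities $\{P_x:x>0\}$ ($X$ starts at $x$ under $P_x$), with right-continuous paths having left limits, satisfying the branching property $E_{x+y}(e^{-\lambda X_t})=E_x(e^{-\lambda X_t})E_y(e^{-\lambda X_t})$ for all $\lambda,t\ge 0$, $x,y>0$. It is characterized by its branching mechanism $$\psi(\lambda)=a\lambda+b\lambda^2+\int_{(0,+\infty)}(e^{-\lambda x}-1+\lambda x)\,\Lambda(dx),\quad \lambda\ge 0,$$ with $a\in\mathbb R$, $b\ge 0$, and $\Lambda$ (the L\'evy measure of $\psi$) a non-negative measure on $(0,+\infty)$ with $\int_{(0,+\infty)}(x^2\wedge x)\Lambda(dx)<+\infty$, in the sense that $E_x(e^{-\lambda X_t})=e^{-x u_t(\lambda)}$, where $u_t(\lambda)$ is the unique positive solution of $\frac{\partial}{\partial t}u_t(\lambda)=-\psi(u_t(\lambda))$, $u_0(\lambda)=\lambda$. The process is called critical if $\psi'(0+)=0$, and non-trivial if $\psi\not\equiv 0$. $\tau:=\inf\{t\ge 0:X_t=0\}$ is the extinction time (so $\{\tau>t\}=\{X_t>0\}$ almost surely), and $\bar F(t):=P_1(\tau>t)$. A probability distribution function is non-degenerate if it is not that of a point mass. A positive measurable function $L$ on $(0,+\infty)$ is slowly varying at $+\infty$ if $\lim_{x\to+\infty}L(\lambda x)/L(x)=1$ for all $\lambda>0$. A function $f$ on $(0,+\infty)$, positive for large arguments, is regularly varying at $+\infty$ with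 index $p\in\mathbb R$ if $\lim_{x\to+\infty}f(\lambda x)/f(x)=\lambda^p$ for all $\lambda>0$. A positive measure $\mu$ on $(0,+\infty)$ is regularly varying at $+\infty$ if $x\mapsto\mu((0,x])$ is regularly varying at $+\infty$ with some index; thus $x^2\Lambda(dx)$ is regularly varying at $+\infty$ when $z\mapsto\int_{(0,z]}x^2\Lambda(dx)$ is. *)

theory Defs
  imports "HOL-Probability.Probability"
begin

definition slowly_varying :: "(real \<Rightarrow> real) \<Rightarrow> bool" where
  "slowly_varying L \<longleftrightarrow>
     L \<in> borel_measurable (restrict_space borel {0<..}) \<and> (\<forall>x>0. L x > 0) \<and>
     (\<forall>k>0. ((\<lambda>x. L (k * x) / L x) \<longlongrightarrow> 1) at_top)"

definition regularly_varying :: "(real \<Rightarrow> real) \<Rightarrow> real \<Rightarrow> bool" where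
  "regularly_varying f p \<longleftrightarrow>
     (\<forall>\<^sub>F x in at_top. f x > 0) \<and>
     (\<forall>k>0. ((\<lambda>x. f (k * x) / f x) \<longlongrightarrow> k powr p) at_top)"

definition regularly_varying_measure :: "real measure \<Rightarrow> bool" where
  "regularly_varying_measure \<mu> \<longleftrightarrow> (\<exists>p. regularly_varying (\<lambda>x. measure \<mu> {0<..x}) p)"

text \<open>The Levy measure lives on the space \<open>(0,\<infinity>)\<close>, so integrals against it range over
  \<open>(0,\<infinity>)\<close> only.  Nothing is required of \<open>\<psi>\<close> at negative arguments.\<close>

definition branching_mechanism :: "(real \<Rightarrow> real) \<Rightarrow> real measure \<Rightarrow> bool" where
  "branching_mechanism \<psi> \<Lambda> \<longleftrightarrow>
     sets \<Lambda> = sets (restrict_space borel {0<..}) \<and>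
     integrable \<Lambda> (\<lambda>x. min (x\<^sup>2) x) \<and>
     (\<exists>a b. b \<ge> 0 \<and>
        (\<forall>\<theta>\<ge>0. \<psi> \<theta> = a * \<theta> + b * \<theta>\<^sup>2 + (\<integral>x. (exp (- \<theta> * x) - 1 + \<theta> * x) \<partial>\<Lambda>)))"

text \<open>A branching mechanism is locally Lipschitz on \<open>(0,\<infinity>)\<close>, so positive solutions of the initial
  value problem are unique and \<open>u\<close> is determined for nonnegative times and positive initial values.\<close>

definition branching_flow :: "(real \<Rightarrow> real) \<Rightarrow> (real \<Rightarrow> real \<Rightarrow> real) \<Rightarrow> bool" where
  "branching_flow \<psi> u \<longleftrightarrow>
     (\<forall>\<theta>>0. u 0 \<theta> = \<theta> \<and>
        (\<forall>t\<ge>0. u t \<theta> > 0 \<and>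
           ((\<lambda>s. u s \<theta>) has_real_derivative - \<psi> (u t \<theta>)) (at t within {0..})))"

definition cadlag :: "(real \<Rightarrow> real) \<Rightarrow> bool" where
  "cadlag f \<longleftrightarrow> (\<forall>t\<ge>0. (f \<longlongrightarrow> f t) (at_right t)) \<and> (\<forall>t>0. \<exists>l. (f \<longlongrightarrow> l) (at_left t))"

text \<open>Time is extended by \<open>\<infinity>\<close> so that stopping times may be infinite.\<close>

definition natural_filtration :: "'a set \<Rightarrow> (real \<Rightarrow> 'a \<Rightarrow> real) \<Rightarrow> ennreal \<Rightarrow> 'a measure" where
  "natural_filtration \<Omega> X t =
     sigma \<Omega> {X s -` A \<inter> \<Omega> | s A. 0 \<le> s \<and> ennreal s \<le> t \<and> A \<in> sets borel}"

lemma filtration_natural_filtration: "filtration \<Omega> (natural_filtration \<Omega> X)"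
proof
  show "space (natural_filtration \<Omega> X t) = \<Omega>" for t
    unfolding natural_filtration_def by (rule space_measure_of) auto
  show "sets (natural_filtration \<Omega> X s) \<subseteq> sets (natural_filtration \<Omega> X t)" if "s \<le> t" for s t
  proof -
    have *: "{X r -` A \<inter> \<Omega> | r A. 0 \<le> r \<and> ennreal r \<le> q \<and> A \<in> sets borel} \<subseteq> Pow \<Omega>" for q
      by auto
    show ?thesis
      unfolding natural_filtration_def sets_measure_of[OF *]
      by (rule sigma_sets_mono') (use that in \<open>blast intro: order_trans\<close>)
  qed
qed

text \<open>\<open>K t y\<close> is the law at time \<open>t\<close> of the process started at \<open>y \<ge> 0\<close>.  It is needed besides
  \<open>P\<close>, whose starting points are positive, because a stopped process may sit at \<open>0\<close>.\<close>

definition strong_markov ::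
    "'a measure \<Rightarrow> (real \<Rightarrow> 'a measure) \<Rightarrow> (real \<Rightarrow> 'a \<Rightarrow> real) \<Rightarrow> (real \<Rightarrow> real \<Rightarrow> real measure) \<Rightarrow> bool"
  where
  "strong_markov M P X K \<longleftrightarrow>
     (\<forall>t\<ge>0. K t \<in> restrict_space borel {0..} \<rightarrow>\<^sub>M prob_algebra (restrict_space borel {0..})) \<and>
     (\<forall>x>0. \<forall>T. stopping_time (natural_filtration (space M) X) T \<longrightarrow>
        (\<forall>B \<in> sets (filtration.pre_sigma (space M) (natural_filtration (space M) X) T).
         \<forall>t\<ge>0. \<forall>A \<in> sets (restrict_space borel {0..}).
           emeasure (P x) {\<omega> \<in> B. T \<omega> < \<infinity> \<and> X (enn2real (T \<omega>) + t) \<omega> \<in> A} =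
           (\<integral>\<^sup>+\<omega>. indicator {\<omega> \<in> B. T \<omega> < \<infinity>} \<omega> * emeasure (K t (X (enn2real (T \<omega>)) \<omega>)) A \<partial>P x)))"

locale cb_process =
  fixes M :: "'a measure" and P :: "real \<Rightarrow> 'a measure"
    and X :: "real \<Rightarrow> 'a \<Rightarrow> real" and \<psi> :: "real \<Rightarrow> real"
  assumes prob_space_P: "\<And>x. x > 0 \<Longrightarrow> prob_space (P x)"
    and sets_P: "\<And>x. x > 0 \<Longrightarrow> sets (P x) = sets M"
    and measurable_X: "\<And>t. t \<ge> 0 \<Longrightarrow> X t \<in> borel_measurable M"
    and nonneg_X: "\<And>t \<omega>. t \<ge> 0 \<Longrightarrow> \<omega> \<in> space M \<Longrightarrow> X t \<omega> \<ge> 0"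
    and cadlag_X: "\<And>\<omega>. \<omega> \<in> space M \<Longrightarrow> cadlag (\<lambda>t. X t \<omega>)"
    and start: "\<And>x. x > 0 \<Longrightarrow> AE \<omega> in P x. X 0 \<omega> = x"
    and strong_markov: "\<exists>K. strong_markov M P X K"
    and branching: "\<And>x y t \<theta>. x > 0 \<Longrightarrow> y > 0 \<Longrightarrow> t \<ge> 0 \<Longrightarrow> \<theta> \<ge> 0 \<Longrightarrow>
      (\<integral>\<omega>. exp (- \<theta> * X t \<omega>) \<partial>P (x + y)) =
      (\<integral>\<omega>. exp (- \<theta> * X t \<omega>) \<partial>P x) * (\<integral>\<omega>. exp (- \<theta> * X t \<omega>) \<partial>P y)"
    and laplace: "\<exists>u. branching_flow \<psi> u \<and>
      (\<forall>x>0. \<forall>t\<ge>0. \<forall>\<theta>>0. (\<integral>\<omega>. exp (- \<theta> * X t \<omega>) \<partial>P x) = exp (- x * u t \<theta>))"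

definition extinction_time :: "(real \<Rightarrow> 'a \<Rightarrow> real) \<Rightarrow> 'a \<Rightarrow> ennreal" where
  "extinction_time X \<omega> = Inf (ennreal ` {t. t \<ge> 0 \<and> X t \<omega> = 0})"

text \<open>The event \<open>\<tau> > t\<close> need not be measurable, but it differs from \<open>X t > 0\<close> by a null set, so
  its probability is taken in the completed measure.\<close>

definition survival_prob :: "(real \<Rightarrow> 'a measure) \<Rightarrow> (real \<Rightarrow> 'a \<Rightarrow> real) \<Rightarrow> real \<Rightarrow> real" where
  "survival_prob P X t = \<P>(\<omega> in completion (P 1). extinction_time X \<omega> > ennreal t)"

end

theory Submission
  imports Defs "HOL-Real_Asymp.Real_Asymp"
begin

text \<open>
  Let \<open>\<psi>\<^sub>k\<close> be the \<open>k\<close>-th derivative of \<open>\<psi>\<close>. Up to a constant, \<open>\<psi>\<^sub>2\<close> is the Laplace transform of \<open>x\<^sup>2 \<Lambda>(dx)\<close>. An Abelian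
  argument therefore turns regular variation of that measure with index \<open>p\<close> into
  \<open>\<lambda> \<psi>\<^sub>3(\<lambda>) / \<psi>\<^sub>2(\<lambda>) \<longlongrightarrow> -p\<close> as \<open>\<lambda> \<longlongrightarrow> 0\<close>, and two applications of l'Hopital's rule give
  \<open>\<lambda> \<psi>\<^sub>1(\<lambda>) / \<psi>(\<lambda>) \<longlongrightarrow> 1 + \<alpha>\<close> with \<open>\<alpha> = 1 - p \<in> [0, 1]\<close>.

  Put \<open>\<phi>(y) = \<integral>\<^bsub>y\<^esub>\<^bsup>\<infinity>\<^esup> d\<xi> / \<psi>(\<xi>)\<close> and let \<open>v\<close> be the inverse function of \<open>\<phi>\<close>. The flow satisfies
  \<open>\<phi>(u\<^sub>t(\<theta>)) = t + \<phi>(\<theta>)\<close>, and \<open>P\<^sub>x(X\<^sub>t > 0) = 1 - exp(-x v(t))\<close>, so weak convergence means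
  \<open>u\<^sub>t(\<theta> Q\<^sub>t) / v(t) \<longlongrightarrow> g(\<theta>) = 1 - h(\<theta>)\<close>. If \<open>\<alpha> > 0\<close>, then \<open>\<phi>\<close> is regularly varying at \<open>0\<close> with index
  \<open>-\<alpha>\<close>, and comparing \<open>\<phi>(\<theta> Q\<^sub>t)\<close> with \<open>\<phi>(v(t)) = t\<close> shows that \<open>g(\<theta>) powr -\<alpha> - 1\<close> is a multiple of
  \<open>\<theta> powr -\<alpha>\<close>. If \<open>\<alpha> = 0\<close>, then \<open>\<psi>(\<lambda>) / \<lambda>\<close> is slowly varying and the same comparison makes \<open>ln g\<close> an
  increasing affine function of \<open>ln \<theta>\<close>, which is impossible since \<open>g < 1\<close>.
\<close>

section \<open>Regular variation of the branching mechanism\<close>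

text \<open>Regular variation is used throughout as a limit of the elasticity
  \<open>y * f' y / f y\<close>. In logarithmic coordinates this is the limit of a derivative, so
  the mean value theorem controls \<open>f (u t) / f (v t)\<close> for moving arguments with
  \<open>u t / v t\<close> convergent, which is exactly how the flow enters. The elasticity is
  accessible because the Levy parts of the second and third derivatives of \<psi> are Laplace-type
  integrals of the same function \<open>V\<close>: their quotient comes from dominated convergence,
  and l'Hopital's rule then only passes from derivatives to primitives, never in the delicate
  opposite direction. The probabilistic obstacle is the state 0. The laws \<open>P x\<close> start
  at positive points only, so it is not part of the model that 0 is a trap. This has to be extracted
  from the semigroup property of \<open>u\<close> and the regularity of paths before survival up to
  time \<open>t\<close> can be exchanged for \<open>X t > 0\<close>.\<close>

lemma has_real_derivative_integral:
  fixes k k' :: "real \<Rightarrow> 'a \<Rightarrow> real"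
  assumes z: "l < z" "z < r"
    and int: "\<And>y. l < y \<Longrightarrow> y < r \<Longrightarrow> integrable M (k y)"
    and deriv: "\<And>y \<omega>. l < y \<Longrightarrow> y < r \<Longrightarrow> \<omega> \<in> space M \<Longrightarrow>
      ((\<lambda>y. k y \<omega>) has_real_derivative k' y \<omega>) (at y)"
    and meas: "k' z \<in> borel_measurable M"
    and bound: "\<And>y \<omega>. l < y \<Longrightarrow> y < r \<Longrightarrow> \<omega> \<in> space M \<Longrightarrow> \<bar>k' y \<omega>\<bar> \<le> g \<omega>"
    and g: "integrable M g"
  shows "((\<lambda>y. \<integral>\<omega>. k y \<omega> \<partial>M) has_real_derivative (\<integral>\<omega>. k' z \<omega> \<partial>M)) (at z)"
  unfolding DERIV_def tendsto_at_iff_sequentially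
proof safe
  fix X :: "nat \<Rightarrow> real" assume X: "\<forall>i. X i \<in> UNIV - {0}" "X \<longlonglongrightarrow> 0"
  \<comment> \<open>The filler value \<open>k' z \<omega>\<close> makes the domination by
    \<open>g\<close> hold for every \<open>i\<close>; the genuine difference quotient is controlled
    only once \<open>z + X i\<close> lies between \<open>l\<close> and \<open>r\<close>.\<close>
  define s where "s i \<omega> = (if l < z + X i \<and> z + X i < r then (k (z + X i) \<omega> - k z \<omega>) / X i else k' z \<omega>)"
    for i \<omega>
  have lim: "(\<lambda>i. z + X i) \<longlonglongrightarrow> z" using tendsto_add[OF tendsto_const X(2)] by simp
  have ev: "\<forall>\<^sub>F i in sequentially. l < z + X i \<and> z + X i < r"
    using order_tendstoD[OF lim] z by (auto intro: eventually_conj)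
  have quotient: "(\<lambda>i. (k (z + X i) \<omega> - k z \<omega>) / X i) \<longlonglongrightarrow> k' z \<omega>" if "\<omega> \<in> space M" for \<omega>
    using deriv[OF z that] X unfolding DERIV_def tendsto_at_iff_sequentially o_def by blast
  have bnd: "\<bar>s i \<omega>\<bar> \<le> g \<omega>" if "\<omega> \<in> space M" for i \<omega>
  proof (cases "l < z + X i \<and> z + X i < r")
    case True
    have "\<bar>k (z + X i) \<omega> - k z \<omega>\<bar> \<le> g \<omega> * \<bar>X i\<bar>"
    proof -
      have "norm (k (z + X i) \<omega> - k z \<omega>) \<le> g \<omega> * norm (z + X i - z)"
        using z True bound[OF _ _ that]
        by (intro field_differentiable_bound[of "{l<..<r}" "\<lambda>y. k y \<omega>" "\<lambda>y. k' y \<omega>"])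
          (auto intro: DERIV_subset[OF deriv] that)
      then show ?thesis by simp
    qed
    moreover have "X i \<noteq> 0" using X(1) by auto
    ultimately show ?thesis using True by (simp add: s_def divide_le_eq abs_divide)
  next
    case False
    then show ?thesis using bound[OF z that] by (auto simp: s_def)
  qed
  have "(\<lambda>i. \<integral>\<omega>. s i \<omega> \<partial>M) \<longlonglongrightarrow> (\<integral>\<omega>. k' z \<omega> \<partial>M)"
  proof (rule integral_dominated_convergence[where w=g])
    show "k' z \<in> borel_measurable M" by (rule meas)
    show "s i \<in> borel_measurable M" for i
      using borel_measurable_integrable[OF int, of "z + X i"] borel_measurable_integrable[OF int, OF z] meas
      unfolding s_def by (cases "l < z + X i \<and> z + X i < r") auto
    show "AE \<omega> in M. (\<lambda>i. s i \<omega>) \<longlonglongrightarrow> k' z \<omega>"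
    proof (rule AE_I2)
      fix \<omega> assume "\<omega> \<in> space M"
      then show "(\<lambda>i. s i \<omega>) \<longlonglongrightarrow> k' z \<omega>"
        by (intro Lim_transform_eventually[OF quotient])
          (use ev in \<open>auto simp: s_def elim: eventually_mono\<close>)
    qed
  qed (use bnd g in auto)
  moreover have "\<forall>\<^sub>F i in sequentially. (\<integral>\<omega>. s i \<omega> \<partial>M) =
      ((\<integral>\<omega>. k (z + X i) \<omega> \<partial>M) - (\<integral>\<omega>. k z \<omega> \<partial>M)) / X i"
    using ev by eventually_elim (use int z in \<open>simp add: s_def Bochner_Integration.integral_diff\<close>)
  ultimately show "((\<lambda>h. ((\<integral>\<omega>. k (z + h) \<omega> \<partial>M) - (\<integral>\<omega>. k z \<omega> \<partial>M)) / h) \<circ> X)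
      \<longlonglongrightarrow> (\<integral>\<omega>. k' z \<omega> \<partial>M)"
    unfolding o_def by (rule Lim_transform_eventually)
qed

lemma eventually_at_right_0I: "(\<And>y::real. y > 0 \<Longrightarrow> P y) \<Longrightarrow> \<forall>\<^sub>F y in at_right 0. P y"
  by (rule eventually_mono[OF eventually_at_right_less])

section \<open>Doubling bounds and Abelian asymptotics of monotone functions\<close>

lemma monotone_regularly_varying_index:
  assumes "mono V" "regularly_varying V p"
  shows "0 \<le> p"
proof -
  have "((\<lambda>z. V (2 * z) / V z) \<longlongrightarrow> 2 powr p) at_top" and pos: "\<forall>\<^sub>F z in at_top. V z > 0"
    using assms by (auto simp: regularly_varying_def)
  moreover have "\<forall>\<^sub>F z in at_top. 1 \<le> V (2 * z) / V z"
    using pos eventually_gt_at_top[of 0]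
  proof eventually_elim
    case (elim z)
    then show ?case using monoD[OF assms(1), of z "2 * z"] by simp
  qed
  ultimately have "1 \<le> 2 powr p"
    by (intro tendsto_lowerbound[OF _ _ trivial_limit_at_top_linorder]) auto
  then show ?thesis using powr_le_cancel_iff[of 2 0 p] by simp
qed

text \<open>A Potter-type bound, uniform in \<open>z\<close>, that supplies the dominating function
  of the Abelian argument. One doubling costs at most \<open>2 powr (p + 1)\<close>, the extra 1 in
  the exponent absorbing the error in the limit \<open>2 powr p\<close>. A factor
  \<open>w > 1\<close> is reached by about \<open>log 2 w\<close> doublings, and rounding that
  number up accounts for the 2 in \<open>2 * w\<close>. The summand 1 covers
  \<open>w \<le> 1\<close> by monotonicity.\<close>

lemma monotone_regularly_varying_bound:
  assumes mono: "mono V" and rv: "regularly_varying V p"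
  shows "\<exists>z\<^sub>0>0. \<forall>z\<ge>z\<^sub>0. V z > 0 \<and> (\<forall>w>0. V (w * z) \<le> (1 + (2 * w) powr (p + 1)) * V z)"
proof -
  have "((\<lambda>z. V (2 * z) / V z) \<longlongrightarrow> 2 powr p) at_top" and pos: "\<forall>\<^sub>F z in at_top. V z > 0"
    using rv by (auto simp: regularly_varying_def)
  then have "\<forall>\<^sub>F z in at_top. V (2 * z) / V z < 2 powr (p + 1)"
    by (intro order_tendstoD) (auto simp: powr_less_mono)
  then have "\<forall>\<^sub>F z in at_top. z > 0 \<and> V z > 0 \<and> V (2 * z) / V z < 2 powr (p + 1)"
    using pos eventually_gt_at_top[of 0] by eventually_elim auto
  then obtain z\<^sub>0 where z\<^sub>0: "\<And>z. z \<ge> z\<^sub>0 \<Longrightarrow> z > 0 \<and> V z > 0 \<and> V (2 * z) / V z < 2 powr (p + 1)"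
    unfolding eventually_at_top_linorder by auto
  then have double: "V (2 * z) \<le> 2 powr (p + 1) * V z" if "z \<ge> z\<^sub>0" for z
    using z\<^sub>0[OF that] by (auto simp: pos_divide_less_eq intro: less_imp_le)
  have iter: "V (2 ^ n * z) \<le> (2 ^ n) powr (p + 1) * V z" if "z \<ge> z\<^sub>0" for z n
  proof (induction n)
    case (Suc n)
    have "z > 0" using z\<^sub>0 that by auto
    then have "z \<le> 2 ^ n * z" by simp
    then have "V (2 * (2 ^ n * z)) \<le> 2 powr (p + 1) * V (2 ^ n * z)" using that by (intro double) simp
    also have "\<dots> \<le> 2 powr (p + 1) * ((2 ^ n) powr (p + 1) * V z)"
      using Suc by (intro mult_left_mono) auto
    finally show ?case by (simp add: powr_mult mult.assoc)
  qed simp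
  have "V (w * z) \<le> (1 + (2 * w) powr (p + 1)) * V z" if z: "z \<ge> z\<^sub>0" and w: "w > 0" for w z
  proof (cases "w \<le> 1")
    case True
    then have "V (w * z) \<le> V z" using z z\<^sub>0[OF z] by (intro monoD[OF mono]) simp
    also have "\<dots> \<le> (1 + (2 * w) powr (p + 1)) * V z" using z\<^sub>0[OF z] by simp
    finally show ?thesis .
  next
    case False
    define n where "n = nat \<lceil>log 2 w\<rceil>"
    have log: "log 2 w > 0" using False by simp
    have n: "log 2 w \<le> real n" "real n \<le> log 2 w + 1"
      using log unfolding n_def by linarith+
    have "2 powr log 2 w \<le> 2 powr real n" using n by (intro powr_mono) auto
    then have n1: "w \<le> 2 ^ n" using w by (simp add: powr_realpow)
    have "2 powr real n \<le> 2 powr (log 2 w + 1)" using n by (intro powr_mono) auto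
    then have n2: "2 ^ n \<le> 2 * w" using w by (simp add: powr_realpow powr_add)
    have "V (w * z) \<le> V (2 ^ n * z)" using n1 z\<^sub>0[OF z] by (intro monoD[OF mono] mult_right_mono) auto
    also have "\<dots> \<le> (2 ^ n) powr (p + 1) * V z" by (rule iter[OF z])
    also have "\<dots> \<le> (1 + (2 * w) powr (p + 1)) * V z"
    proof (intro mult_right_mono)
      have "(2 ^ n) powr (p + 1) \<le> (2 * w) powr (p + 1)"
        using n2 monotone_regularly_varying_index[OF mono rv] by (intro powr_mono2) auto
      then show "(2 ^ n) powr (p + 1) \<le> 1 + (2 * w) powr (p + 1)" by simp
    qed (use z\<^sub>0[OF z] in auto)
    finally show ?thesis .
  qed
  then show ?thesis using z\<^sub>0 by (intro exI[of _ "max 1 z\<^sub>0"]) auto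
qed

lemma has_bochner_integral_Gamma:
  fixes s :: real
  assumes "s > 0"
  shows "has_bochner_integral lborel (\<lambda>t::real. indicator {0<..} t * (t powr (s - 1) * exp (- t))) (Gamma s)"
proof (rule has_bochner_integral_nn_integral)
  have "ennreal (Gamma s) = (\<integral>\<^sup>+t. ennreal (indicator {0..} t * t powr (s - 1) / exp t) \<partial>lborel)"
    by (rule Gamma_conv_nn_integral_real[OF assms])
  also have "\<dots> = (\<integral>\<^sup>+t. ennreal (indicator {0<..} t * (t powr (s - 1) * exp (- t))) \<partial>lborel)"
    by (intro nn_integral_cong) (auto simp: exp_minus field_simps split: split_indicator)
  finally show "(\<integral>\<^sup>+t. ennreal (indicator {0<..} t * (t powr (s - 1) * exp (- t))) \<partial>lborel) = ennreal (Gamma s)" ..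
qed (use assms in auto)

text \<open>Pointwise \<open>V (w * z) / V z\<close> tends to \<open>w powr p\<close>, so the limit
  is the Gamma integral of \<open>w powr (p + j) * exp (- w)\<close>. The cases \<open>j = 0\<close>
  and \<open>j = 1\<close> serve the second and third derivatives of \<psi>.\<close>

lemma abelian_Gamma_integral:
  assumes mono: "mono V" and rv: "regularly_varying V p" and V_neg: "\<And>z. z \<le> 0 \<Longrightarrow> V z = 0"
  shows "((\<lambda>z. (\<integral>w. w ^ j * exp (- w) * V (w * z) \<partial>lborel) / V z) \<longlongrightarrow> Gamma (p + 1 + j)) at_top"
proof -
  have p: "0 \<le> p" by (rule monotone_regularly_varying_index[OF mono rv])
  have [measurable]: "V \<in> borel_measurable borel" by (rule borel_measurable_mono[OF mono])
  obtain z\<^sub>0 where z\<^sub>0: "z\<^sub>0 > 0" and z\<^sub>0': "\<And>z. z \<ge> z\<^sub>0 \<Longrightarrow> V z > 0"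
    "\<And>z w. z \<ge> z\<^sub>0 \<Longrightarrow> w > 0 \<Longrightarrow> V (w * z) \<le> (1 + (2 * w) powr (p + 1)) * V z"
    using monotone_regularly_varying_bound[OF mono rv] by auto
  have nonneg: "0 \<le> V z" for z
    using monoD[OF mono, of "min 0 z" z] V_neg[of "min 0 z"] by simp
  \<comment> \<open>On the positive half-line this is
    \<open>w ^ j * exp (- w) * (1 + (2 * w) powr (p + 1))\<close>, split into two Gamma integrands
    so that integrability is immediate.\<close>
  define g where "g w = indicator {0<..} w * (w powr (real (j + 1) - 1) * exp (- w)) +
    2 powr (p + 1) * (indicator {0<..} w * (w powr (p + 2 + j - 1) * exp (- w)))" for w :: real
  define lim where "lim w = indicator {0<..} w * (w powr (p + 1 + j - 1) * exp (- w))" for w :: real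
  have "((\<lambda>z. \<integral>w. w ^ j * exp (- w) * V (w * z) / V z \<partial>lborel) \<longlongrightarrow> (\<integral>w. lim w \<partial>lborel)) at_top"
  proof (rule integral_dominated_convergence_at_top[where w=g])
    show "\<forall>\<^sub>F z in at_top. AE w in lborel. norm (w ^ j * exp (- w) * V (w * z) / V z) \<le> g w"
      using eventually_ge_at_top[of z\<^sub>0]
    proof eventually_elim
      case (elim z)
      show ?case
      proof (rule AE_I2)
        fix w :: real
        show "norm (w ^ j * exp (- w) * V (w * z) / V z) \<le> g w"
        proof (cases "w > 0")
          case True
          have "V (w * z) / V z \<le> 1 + (2 * w) powr (p + 1)"
            using z\<^sub>0'(2)[OF elim True] z\<^sub>0'(1)[OF elim] by (simp add: divide_le_eq)
          then have "w ^ j * exp (- w) * (V (w * z) / V z) \<le> w ^ j * exp (- w) * (1 + (2 * w) powr (p + 1))"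
            using True by (intro mult_left_mono) auto
          also have "\<dots> = g w" using True
            by (simp add: g_def algebra_simps powr_mult powr_add flip: powr_realpow)
          finally show ?thesis using True nonneg[of "w * z"] z\<^sub>0'(1)[OF elim] by (simp add: abs_mult)
        next
          case False
          then show ?thesis using elim z\<^sub>0 V_neg[of "w * z"] by (simp add: g_def mult_nonpos_nonneg)
        qed
      qed
    qed
    show "AE w in lborel. ((\<lambda>z. w ^ j * exp (- w) * V (w * z) / V z) \<longlongrightarrow> lim w) at_top"
    proof (rule AE_I2)
      fix w :: real
      show "((\<lambda>z. w ^ j * exp (- w) * V (w * z) / V z) \<longlongrightarrow> lim w) at_top"
      proof (cases "w > 0")
        case True
        then have "((\<lambda>z. w ^ j * exp (- w) * (V (w * z) / V z)) \<longlongrightarrow> w ^ j * exp (- w) * w powr p) at_top"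
          using rv by (intro tendsto_intros) (auto simp: regularly_varying_def)
        then show ?thesis using True by (simp add: lim_def powr_add algebra_simps flip: powr_realpow)
      next
        case False
        have "\<forall>\<^sub>F z in at_top. w ^ j * exp (- w) * V (w * z) / V z = 0"
          using eventually_gt_at_top[of 0] by eventually_elim (use False V_neg in \<open>simp add: mult_nonpos_nonneg\<close>)
        then have "((\<lambda>z. w ^ j * exp (- w) * V (w * z) / V z) \<longlongrightarrow> 0) at_top"
          by (simp add: tendsto_eventually)
        then show ?thesis using False by (simp add: lim_def)
      qed
    qed
    show "integrable lborel g" unfolding g_def
      using p by (intro Bochner_Integration.integrable_add integrable_mult_right
          has_bochner_integral_Gamma[THEN integrable.intros]) auto
  qed (auto simp: lim_def)
  also have "(\<integral>w. lim w \<partial>lborel) = Gamma (p + 1 + j)"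
    unfolding lim_def using p by (intro has_bochner_integral_integral_eq has_bochner_integral_Gamma) auto
  finally show ?thesis by simp
qed

section \<open>Kernel estimates and derivatives of the Levy integrals\<close>

lemma exp_decay_bounds:
  fixes x :: real assumes "x > 0" "l > 0"
  shows "x * exp (- l * x) \<le> 1 / l" "x\<^sup>2 * exp (- l * x) \<le> 2 / l\<^sup>2"
proof -
  have "l * x \<le> exp (l * x)" using exp_ge_add_one_self[of "l * x"] by linarith
  then show "x * exp (- l * x) \<le> 1 / l" using assms by (simp add: exp_minus field_simps)
  have "(l * x)\<^sup>2 / 2 \<le> exp (l * x)" using exp_lower_Taylor_quadratic[of "l * x"] assms
    by (smt (verit) mult_pos_pos)
  then show "x\<^sup>2 * exp (- l * x) \<le> 2 / l\<^sup>2" using assms by (simp add: exp_minus field_simps)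
qed

text \<open>Integrability against the Levy measure is given for \<open>min (x\<^sup>2) x\<close>, so
  every kernel is compared with it: quadratically near 0 and linearly at infinity.\<close>

lemma levy_kernel_bounds:
  fixes x :: real assumes "x > 0" "y > 0"
  shows "0 \<le> exp (- y * x) - 1 + y * x" "exp (- y * x) - 1 + y * x \<le> (y + y\<^sup>2) * min (x\<^sup>2) x"
    "0 \<le> x * (1 - exp (- y * x))" "x * (1 - exp (- y * x)) \<le> (1 + y) * min (x\<^sup>2) x"
proof -
  show "0 \<le> exp (- y * x) - 1 + y * x" using exp_ge_add_one_self[of "- y * x"] by simp
  have 1: "exp (- y * x) \<le> 1" using assms by simp
  have 2: "1 - exp (- y * x) \<le> y * x" using exp_ge_add_one_self[of "- y * x"] by simp
  have 3: "exp (- y * x) - 1 + y * x \<le> (y * x)\<^sup>2"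
  proof -
    define t where "t = y * x"
    have t: "t \<ge> 0" using assms by (simp add: t_def)
    \<comment> \<open>To obtain \<open>exp (- t) \<le> 1 - t + t\<^sup>2\<close>, the right side is
      multiplied by the quadratic Taylor minorant of \<open>exp t\<close>; the linear terms cancel
      and the product is at least 1.\<close>
    have "(1 - t + t\<^sup>2) * (1 + t + t\<^sup>2 / 2) = 1 + (t^2 + t^3 + t^4) / 2"
      by (simp add: field_simps power2_eq_square power3_eq_cube power4_eq_xxxx)
    then have "1 \<le> (1 - t + t\<^sup>2) * (1 + t + t\<^sup>2 / 2)"
      using t by simp
    also have "\<dots> \<le> (1 - t + t\<^sup>2) * exp t"
      using t exp_lower_Taylor_quadratic[OF t] sum_squares_ge_zero[of "t - 1/2" 0]
      by (intro mult_left_mono) (auto simp: power2_eq_square algebra_simps)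
    finally have "exp (- t) - 1 + t \<le> t\<^sup>2" by (simp add: exp_minus field_simps)
    then show ?thesis by (simp add: t_def)
  qed
  have a: "0 \<le> y * x\<^sup>2" "0 \<le> y\<^sup>2 * x" using assms by auto
  show "exp (- y * x) - 1 + y * x \<le> (y + y\<^sup>2) * min (x\<^sup>2) x"
    using 1[THEN order_trans, of "1 + x * y\<^sup>2"] 3 a unfolding min_def by (simp add: algebra_simps power_mult_distrib)
  show "0 \<le> x * (1 - exp (- y * x))" using 1 assms by auto
  have "x * (1 - exp (- y * x)) \<le> x * 1" using assms by (intro mult_left_mono) auto
  moreover have "x * (1 - exp (- y * x)) \<le> x * (y * x)" using assms 2 by (intro mult_left_mono) auto
  ultimately show "x * (1 - exp (- y * x)) \<le> (1 + y) * min (x\<^sup>2) x"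
    using assms by (auto simp: min_def algebra_simps power2_eq_square intro: add_increasing add_increasing2)
qed

text \<open>The hypothesis on the Levy measure controls only \<open>x\<close> at infinity, so for
  higher powers the exponential must supply the decay, at a price that blows up as \<open>y\<close>
  tends to 0.\<close>

lemma square_kernel_bound:
  fixes x :: real assumes "x > 0" "y > 0"
  shows "x\<^sup>2 * exp (- y * x) \<le> (1 + 1 / y) * min (x\<^sup>2) x"
proof -
  have "x\<^sup>2 * exp (- y * x) \<le> x\<^sup>2 * 1" using assms by (intro mult_left_mono) auto
  moreover have "x * (x * exp (- y * x)) \<le> x * (1 / y)"
    using assms exp_decay_bounds[OF assms] by (intro mult_left_mono) auto
  moreover have "0 \<le> x\<^sup>2 / y" "0 \<le> x" using assms by auto
  ultimately show ?thesis by (auto simp: min_def algebra_simps power2_eq_square)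
qed

lemma cube_kernel_bound:
  fixes x :: real assumes "x > 0" "y > 0"
  shows "x^3 * exp (- y * x) \<le> (1 / y + 2 / y\<^sup>2) * min (x\<^sup>2) x"
proof -
  have "x\<^sup>2 * (x * exp (- y * x)) \<le> x\<^sup>2 * (1 / y)"
    using assms exp_decay_bounds[OF assms] by (intro mult_left_mono) auto
  moreover have "x * (x\<^sup>2 * exp (- y * x)) \<le> x * (2 / y\<^sup>2)"
    using assms exp_decay_bounds[OF assms] by (intro mult_left_mono) auto
  moreover have "0 \<le> x\<^sup>2 * (2 / y\<^sup>2)" "0 \<le> x * (1 / y)" using assms by auto
  ultimately have "x^3 * exp (- y * x) \<le> (1 / y + 2 / y\<^sup>2) * x\<^sup>2"
    "x^3 * exp (- y * x) \<le> (1 / y + 2 / y\<^sup>2) * x"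
    by (simp_all only: algebra_simps power2_eq_square power3_eq_cube)
  then show ?thesis by (simp add: min_def)
qed

locale levy_measure =
  fixes \<Lambda> :: "real measure"
  assumes sets_levy: "sets \<Lambda> = sets (restrict_space borel {0<..})"
    and integrable_levy: "integrable \<Lambda> (\<lambda>x. min (x\<^sup>2) x)"
begin

lemma space_levy: "space \<Lambda> = {0<..}"
  using sets_eq_imp_space_eq[OF sets_levy] by (simp add: space_restrict_space)

lemma measurable_levy: "f \<in> borel_measurable borel \<Longrightarrow> f \<in> borel_measurable \<Lambda>"
  by (simp add: measurable_cong_sets[OF sets_levy refl] measurable_restrict_space1)

lemma integrable_bounded_levy:
  assumes "f \<in> borel_measurable borel" "\<And>x. x > 0 \<Longrightarrow> 0 \<le> f x" "\<And>x. x > 0 \<Longrightarrow> f x \<le> C * min (x\<^sup>2) x"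
  shows "integrable \<Lambda> f"
proof (rule Bochner_Integration.integrable_bound[OF integrable_mult_right[OF integrable_levy, of C]])
  show "AE x in \<Lambda>. norm (f x) \<le> norm (C * min (x\<^sup>2) x)"
    using assms(2,3) by (auto simp: space_levy intro!: AE_I2 order_trans[OF _ abs_ge_self])
qed (use assms in \<open>simp add: measurable_levy\<close>)

text \<open>The Levy parts of \<psi> and of its first three derivatives, the third with reversed
  sign so that all four kernels are non-negative for \<open>y > 0\<close>.\<close>

definition "J0 y = (\<integral>x. (exp (- y * x) - 1 + y * x) \<partial>\<Lambda>)"
definition "J1 y = (\<integral>x. x * (1 - exp (- y * x)) \<partial>\<Lambda>)"
definition "J2 y = (\<integral>x. x\<^sup>2 * exp (- y * x) \<partial>\<Lambda>)"
definition "J3 y = (\<integral>x. x^3 * exp (- y * x) \<partial>\<Lambda>)"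

lemma integrable_kernels:
  assumes "y > 0"
  shows "integrable \<Lambda> (\<lambda>x. exp (- y * x) - 1 + y * x)" "integrable \<Lambda> (\<lambda>x. x * (1 - exp (- y * x)))"
    "integrable \<Lambda> (\<lambda>x. x\<^sup>2 * exp (- y * x))" "integrable \<Lambda> (\<lambda>x. x^3 * exp (- y * x))"
proof -
  show "integrable \<Lambda> (\<lambda>x. exp (- y * x) - 1 + y * x)"
    using levy_kernel_bounds(1,2)[OF _ assms]
    by (intro integrable_bounded_levy[where C="y + y\<^sup>2"]) measurable
  show "integrable \<Lambda> (\<lambda>x. x * (1 - exp (- y * x)))"
    using levy_kernel_bounds(3,4)[OF _ assms]
    by (intro integrable_bounded_levy[where C="1 + y"]) measurable
  show "integrable \<Lambda> (\<lambda>x. x\<^sup>2 * exp (- y * x))"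
    using square_kernel_bound[OF _ assms]
    by (intro integrable_bounded_levy[where C="1 + 1 / y"]) auto
  show "integrable \<Lambda> (\<lambda>x. x^3 * exp (- y * x))"
    using cube_kernel_bound[OF _ assms]
    by (intro integrable_bounded_levy[where C="1 / y + 2 / y\<^sup>2"]) auto
qed

lemma deriv_J:
  assumes "y > 0"
  shows "(J0 has_real_derivative J1 y) (at y)" "(J1 has_real_derivative J2 y) (at y)"
    "(J2 has_real_derivative - J3 y) (at y)"
proof -
  \<comment> \<open>Domination is needed on a whole neighbourhood of \<open>y\<close>. The bound for
    the kernel of \<open>J1\<close> grows with the parameter and is taken at \<open>y + 1\<close>;
    those for \<open>J2\<close> and \<open>J3\<close> decrease and are taken at
    \<open>y / 2\<close>.\<close>
  have y: "y / 2 < y" "y < y + 1" using assms by auto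
  have m: "0 \<le> min (x\<^sup>2) x" if "x > 0" for x :: real using that by auto
  note int = integrable_mult_right integrable_levy
  show "(J0 has_real_derivative J1 y) (at y)"
    unfolding J0_def[abs_def] J1_def
  proof (rule has_real_derivative_integral[where g="\<lambda>x. (1 + (y + 1)) * min (x\<^sup>2) x", OF y])
    fix z x assume z: "y / 2 < z" "z < y + 1" and x: "x \<in> space \<Lambda>"
    show "((\<lambda>y. exp (- y * x) - 1 + y * x) has_real_derivative x * (1 - exp (- z * x))) (at z)"
      by (auto intro!: derivative_eq_intros simp: algebra_simps)
    have "x * (1 - exp (- z * x)) \<le> (1 + z) * min (x\<^sup>2) x"
      using x z assms by (intro levy_kernel_bounds) (auto simp: space_levy)
    also have "\<dots> \<le> (1 + (y + 1)) * min (x\<^sup>2) x"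
      using x z by (intro mult_right_mono) (auto simp: space_levy)
    finally show "\<bar>x * (1 - exp (- z * x))\<bar> \<le> (1 + (y + 1)) * min (x\<^sup>2) x"
      using x z assms levy_kernel_bounds(3)[of x z] by (simp add: space_levy)
  next
    show "integrable \<Lambda> (\<lambda>x. exp (- z * x) - 1 + z * x)" if "y / 2 < z" for z
      using assms that by (intro integrable_kernels) auto
  qed (use assms in \<open>auto intro!: int measurable_levy\<close>)
  show "(J1 has_real_derivative J2 y) (at y)"
    unfolding J1_def[abs_def] J2_def
  proof (rule has_real_derivative_integral[where g="\<lambda>x. (1 + 1 / (y/2)) * min (x\<^sup>2) x", OF y])
    fix z x assume z: "y / 2 < z" "z < y + 1" and x: "x \<in> space \<Lambda>"
    show "((\<lambda>y. x * (1 - exp (- y * x))) has_real_derivative x\<^sup>2 * exp (- z * x)) (at z)"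
      by (auto intro!: derivative_eq_intros simp: power2_eq_square)
    have "x\<^sup>2 * exp (- z * x) \<le> (1 + 1 / z) * min (x\<^sup>2) x"
      using x z assms by (intro square_kernel_bound) (auto simp: space_levy)
    also have "\<dots> \<le> (1 + 1 / (y/2)) * min (x\<^sup>2) x"
      using x z assms by (intro mult_right_mono add_mono divide_left_mono) (auto simp: space_levy)
    finally show "\<bar>x\<^sup>2 * exp (- z * x)\<bar> \<le> (1 + 1 / (y/2)) * min (x\<^sup>2) x"
      using x by (simp add: space_levy abs_mult)
  qed (use assms in \<open>auto intro!: int measurable_levy integrable_kernels[simplified]\<close>)
  have "(J2 has_real_derivative (\<integral>x. - (x^3 * exp (- y * x)) \<partial>\<Lambda>)) (at y)"
    unfolding J2_def[abs_def]
  proof (rule has_real_derivative_integral[where g="\<lambda>x. (1 / (y/2) + 2 / (y/2)\<^sup>2) * min (x\<^sup>2) x", OF y])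
    fix z x assume z: "y / 2 < z" "z < y + 1" and x: "x \<in> space \<Lambda>"
    show "((\<lambda>y. x\<^sup>2 * exp (- y * x)) has_real_derivative - (x ^ 3 * exp (- z * x))) (at z)"
      by (auto intro!: derivative_eq_intros simp: power3_eq_cube power2_eq_square)
    have "x ^ 3 * exp (- z * x) \<le> (1 / z + 2 / z\<^sup>2) * min (x\<^sup>2) x"
      using x z assms by (intro cube_kernel_bound) (auto simp: space_levy)
    also have "\<dots> \<le> (1 / (y/2) + 2 / (y/2)\<^sup>2) * min (x\<^sup>2) x"
      using x z assms by (intro mult_right_mono add_mono divide_left_mono power_mono) (auto simp: space_levy)
    finally show "\<bar>- (x ^ 3 * exp (- z * x))\<bar> \<le> (1 / (y/2) + 2 / (y/2)\<^sup>2) * min (x\<^sup>2) x"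
      using x by (simp add: space_levy abs_mult)
  qed (use assms in \<open>auto intro!: int measurable_levy integrable_kernels[simplified]\<close>)
  then show "(J2 has_real_derivative - J3 y) (at y)" by (simp add: J3_def)
qed

section \<open>From the truncated second moment to the second and third derivatives\<close>

definition "V z = measure (density \<Lambda> (\<lambda>x. ennreal (x\<^sup>2))) {0<..z}"

text \<open>\<open>measure\<close> returns 0 on sets of infinite measure, so \<open>V\<close> is
  informative only because this mass is finite: on \<open>(0, z]\<close> the function x^2 is at most
  \<open>(1 + \<bar>z\<bar>) * min (x\<^sup>2) x\<close>.\<close>

lemma emeasure_square_density: "emeasure (density \<Lambda> (\<lambda>x. ennreal (x\<^sup>2))) {0<..z} = ennreal (V z)"
proof -
  have meas: "{0<..z} \<in> sets \<Lambda>"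
    by (auto simp: sets_levy sets_restrict_space image_iff intro!: bexI[of _ "{0<..z}"])
  have "integrable \<Lambda> (\<lambda>x. x\<^sup>2 * indicator {0<..z} x)"
  proof (rule integrable_bounded_levy[where C="1 + \<bar>z\<bar>"])
    fix x :: real assume x: "x > 0"
    show "x\<^sup>2 * indicator {0<..z} x \<le> (1 + \<bar>z\<bar>) * min (x\<^sup>2) x"
    proof (cases "x \<le> z")
      case True
      then have "x\<^sup>2 \<le> z * x" using x by (simp add: power2_eq_square)
      then show ?thesis using x True by (auto simp: min_def algebra_simps)
    qed (use x in auto)
  qed auto
  then have "(\<integral>\<^sup>+x. ennreal (x\<^sup>2 * indicator {0<..z} x) \<partial>\<Lambda>) < \<infinity>"
    by (simp add: integrable_iff_bounded abs_mult)
  also have "(\<integral>\<^sup>+x. ennreal (x\<^sup>2 * indicator {0<..z} x) \<partial>\<Lambda>) =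
      emeasure (density \<Lambda> (\<lambda>x. ennreal (x\<^sup>2))) {0<..z}"
    by (subst emeasure_density) (auto simp: meas measurable_levy intro!: nn_integral_cong split: split_indicator)
  finally show ?thesis by (simp add: V_def emeasure_eq_ennreal_measure)
qed

lemma V_nonneg: "0 \<le> V z" by (simp add: V_def)

lemma V_neg: "z \<le> 0 \<Longrightarrow> V z = 0" by (simp add: V_def)

lemma V_mono: "z \<le> z' \<Longrightarrow> V z \<le> V z'"
proof -
  assume "z \<le> z'"
  have "{0<..z'} \<in> sets \<Lambda>"
    by (auto simp: sets_levy sets_restrict_space image_iff intro!: bexI[of _ "{0<..z'}"])
  then have "ennreal (V z) \<le> ennreal (V z')" unfolding emeasure_square_density[symmetric]
    using \<open>z \<le> z'\<close> by (intro emeasure_mono) auto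
  then show ?thesis by (simp add: V_nonneg)
qed

lemma borel_measurable_V [measurable]: "V \<in> borel_measurable borel"
  by (rule borel_measurable_mono) (simp add: mono_def V_mono)

text \<open>Integration by parts in the form of Fubini's theorem. \<open>K\<close> is the tail
  integral of \<open>k\<close>, and \<open>y * x \<le> w\<close> means \<open>x \<le> w / y\<close>,
  so exchanging the order turns an integral against x^2 \<Lambda>(dx) into a Lebesgue integral of
  its distribution function.\<close>

lemma nn_integral_layers:
  fixes k :: "real \<Rightarrow> real"
  assumes y: "y > 0" and k [measurable]: "k \<in> borel_measurable borel"
    and K: "\<And>m. m > 0 \<Longrightarrow> (\<integral>\<^sup>+w. ennreal (k w) * indicator {m..} w \<partial>lborel) = ennreal (K m)"
    and K_nonneg: "\<And>m. m > 0 \<Longrightarrow> K m \<ge> 0"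
  shows "(\<integral>\<^sup>+x. ennreal (x\<^sup>2 * K (y * x)) \<partial>\<Lambda>) = (\<integral>\<^sup>+w. ennreal (k w) * ennreal (V (w / y)) \<partial>lborel)"
proof -
  define \<nu> where "\<nu> = density \<Lambda> (\<lambda>x. ennreal (x\<^sup>2))"
  have sets_nu: "sets \<nu> = sets (restrict_space borel {0<..})" by (simp add: \<nu>_def sets_levy)
  have space_nu: "space \<nu> = {0<..}" by (simp add: \<nu>_def space_levy)
  have [measurable]: "f \<in> borel_measurable borel \<Longrightarrow> f \<in> borel_measurable \<nu>" for f :: "real \<Rightarrow> ennreal"
    by (simp add: measurable_cong_sets[OF sets_nu refl] measurable_restrict_space1)
  have id_nu: "(\<lambda>x. x) \<in> borel_measurable \<nu>"
    by (simp add: measurable_cong_sets[OF sets_nu refl] measurable_restrict_space1)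
  have em: "emeasure \<nu> {0<..z} = ennreal (V z)" for z
    by (simp add: \<nu>_def emeasure_square_density)
  interpret nu: sigma_finite_measure \<nu>
  proof
    have "{0<..z} \<in> sets \<nu>" for z
      by (auto simp: sets_nu sets_restrict_space image_iff intro!: bexI[of _ "{0<..z}"])
    moreover have "(\<Union>n. {0<..real n}) = {0<..}"
      using real_arch_simple by fastforce
    ultimately show "\<exists>A. countable A \<and> A \<subseteq> sets \<nu> \<and> \<Union>A = space \<nu> \<and> (\<forall>a\<in>A. emeasure \<nu> a \<noteq> \<infinity>)"
      by (intro exI[of _ "range (\<lambda>n. {0<..real n})"]) (auto simp: space_nu em)
  qed
  interpret pair_sigma_finite lborel \<nu> ..
  have "(\<integral>\<^sup>+x. ennreal (x\<^sup>2 * K (y * x)) \<partial>\<Lambda>) =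
      (\<integral>\<^sup>+x. ennreal (x\<^sup>2) * (\<integral>\<^sup>+w. ennreal (k w) * indicator {y * x..} w \<partial>lborel) \<partial>\<Lambda>)"
    using y by (intro nn_integral_cong) (simp add: space_levy K K_nonneg ennreal_mult)
  also have "\<dots> = (\<integral>\<^sup>+x. (\<integral>\<^sup>+w. ennreal (k w) * indicator {y * x..} w \<partial>lborel) \<partial>\<nu>)"
  proof -
    have "(\<lambda>x. \<integral>\<^sup>+w. ennreal (k w) * indicator {w. y * x \<le> w} w \<partial>lborel) \<in> borel_measurable borel"
      by measurable
    then show ?thesis unfolding \<nu>_def
      by (subst nn_integral_density) (auto simp: measurable_levy measurable_cong_sets[OF sets_levy refl]
          measurable_restrict_space1 atLeast_def)
  qed
  also have "\<dots> = (\<integral>\<^sup>+w. (\<integral>\<^sup>+x. ennreal (k w) * indicator {y * x..} w \<partial>\<nu>) \<partial>lborel)"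
  proof (rule Fubini')
    have [measurable]: "snd \<in> borel_measurable (lborel \<Otimes>\<^sub>M \<nu>)"
      by (rule measurable_compose[OF measurable_snd id_nu])
    have [measurable]: "fst \<in> borel_measurable (lborel \<Otimes>\<^sub>M \<nu>)"
      using measurable_fst[of lborel \<nu>] by simp
    have "(\<lambda>p. ennreal (k (fst p)) * indicator {p. y * snd p \<le> fst p} p) \<in> borel_measurable (lborel \<Otimes>\<^sub>M \<nu>)"
      by measurable
    also have "(\<lambda>p. ennreal (k (fst p)) * indicator {p. y * snd p \<le> fst p} p) =
      (\<lambda>(w, x). ennreal (k w) * indicator {y * x..} w)"
      by (auto split: split_indicator)
    finally show "(\<lambda>(w, x). ennreal (k w) * indicator {y * x..} w) \<in> borel_measurable (lborel \<Otimes>\<^sub>M \<nu>)" .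
  qed
  also have "\<dots> = (\<integral>\<^sup>+w. ennreal (k w) * ennreal (V (w / y)) \<partial>lborel)"
  proof (rule nn_integral_cong)
    fix w :: real
    have "(\<integral>\<^sup>+x. ennreal (k w) * indicator {y * x..} w \<partial>\<nu>) =
        (\<integral>\<^sup>+x. ennreal (k w) * indicator {0<..w / y} x \<partial>\<nu>)"
      using y by (intro nn_integral_cong) (auto simp: space_nu field_simps split: split_indicator)
    also have "\<dots> = ennreal (k w) * emeasure \<nu> {0<..w / y}"
      by (intro nn_integral_cmult_indicator)
        (auto simp: sets_nu sets_restrict_space image_iff intro!: bexI[of _ "{0<..w / y}"])
    finally show "(\<integral>\<^sup>+x. ennreal (k w) * indicator {y * x..} w \<partial>\<nu>) = ennreal (k w) * ennreal (V (w / y))"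
      by (simp add: em)
  qed
  finally show ?thesis .
qed

lemma J2_layers:
  assumes z: "z > 0"
  shows "J2 (1 / z) = (\<integral>w. exp (- w) * V (w * z) \<partial>lborel)"
proof -
  have *: "((\<lambda>w::real. - exp (- w)) \<longlongrightarrow> 0) at_top" by real_asymp
  have "(\<integral>\<^sup>+w. ennreal (exp (- w)) * indicator {m..} w \<partial>lborel) = ennreal (0 - (- exp (- m)))" for m :: real
    by (rule nn_integral_FTC_atLeast) (auto intro!: derivative_eq_intros *)
  from nn_integral_layers[OF _ _ this, of "1 / z"]
  have "(\<integral>\<^sup>+x. ennreal (x\<^sup>2 * exp (- (1 / z) * x)) \<partial>\<Lambda>) = (\<integral>\<^sup>+w. ennreal (exp (- w)) * ennreal (V (w * z)) \<partial>lborel)"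
    using z by simp
  then show ?thesis unfolding J2_def
    by (subst (1 2) integral_eq_nn_integral) (auto simp: V_nonneg measurable_levy ennreal_mult)
qed

text \<open>The tail integral of \<open>w * exp (- w)\<close> is \<open>(m + 1) * exp (- m)\<close>.
  With \<open>m = x / z\<close> its two summands produce the terms in \<open>J3\<close> and
  \<open>J2\<close>.\<close>

lemma J3_layers:
  assumes z: "z > 0"
  shows "J2 (1 / z) + J3 (1 / z) / z = (\<integral>w. w * exp (- w) * V (w * z) \<partial>lborel)"
proof -
  have *: "((\<lambda>w::real. - (w * exp (- w)) - exp (- w)) \<longlongrightarrow> 0) at_top" by real_asymp
  have "(\<integral>\<^sup>+w. ennreal (w * exp (- w)) * indicator {m..} w \<partial>lborel) = ennreal (0 - (- (m + 1) * exp (- m)))"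
    if "m > 0" for m :: real
    by (rule nn_integral_FTC_atLeast) (use that in \<open>auto intro!: derivative_eq_intros * simp: algebra_simps\<close>)
  from nn_integral_layers[OF _ _ this, of "1 / z"]
  have "(\<integral>\<^sup>+x. ennreal (x\<^sup>2 * ((1 / z * x + 1) * exp (- (1 / z) * x))) \<partial>\<Lambda>) =
      (\<integral>\<^sup>+w. ennreal (w * exp (- w)) * ennreal (V (w * z)) \<partial>lborel)"
    using z by (simp add: algebra_simps)
  \<comment> \<open>For \<open>w \<le> 0\<close> both sides vanish: \<open>ennreal\<close> truncates
    the negative weight, and \<open>V (w * z)\<close> is 0.\<close>
  also have "\<dots> = (\<integral>\<^sup>+w. ennreal (w * exp (- w) * V (w * z)) \<partial>lborel)"
    using z V_neg[of "_ * z"] V_nonneg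
    by (intro nn_integral_cong) (auto simp: mult_nonpos_nonneg ennreal_mult'')
  finally have eq: "(\<integral>\<^sup>+x. ennreal (x\<^sup>2 * ((1 / z * x + 1) * exp (- (1 / z) * x))) \<partial>\<Lambda>) = \<dots>" .
  have "(\<integral>x. x\<^sup>2 * ((1 / z * x + 1) * exp (- (1 / z) * x)) \<partial>\<Lambda>) = (\<integral>w. w * exp (- w) * V (w * z) \<partial>lborel)"
  proof (subst (1 2) integral_eq_nn_integral)
    show "AE w in lborel. 0 \<le> w * exp (- w) * V (w * z)"
    proof (rule AE_I2)
      fix w show "0 \<le> w * exp (- w) * V (w * z)"
        using z V_neg[of "w * z"] V_nonneg[of "w * z"] by (cases "w > 0") (auto simp: mult_nonpos_nonneg)
    qed
  qed (use eq z in \<open>auto simp: measurable_levy space_levy\<close>)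
  moreover have "(\<integral>x. x\<^sup>2 * ((1 / z * x + 1) * exp (- (1 / z) * x)) \<partial>\<Lambda>) =
      (\<integral>x. x\<^sup>2 * exp (- (1 / z) * x) + (1 / z) * (x^3 * exp (- (1 / z) * x)) \<partial>\<Lambda>)"
    by (intro Bochner_Integration.integral_cong) (auto simp: algebra_simps power2_eq_square power3_eq_cube)
  moreover have "\<dots> = J2 (1 / z) + (1 / z) * J3 (1 / z)"
    using integrable_kernels(3,4)[of "1 / z"] z unfolding J2_def J3_def
    by (subst Bochner_Integration.integral_add) auto
  ultimately show ?thesis by simp
qed

text \<open>The second limit is the difference of the cases \<open>j = 1\<close> and
  \<open>j = 0\<close>, by \<open>Gamma (p + 2) - Gamma (p + 1) = p * Gamma (p + 1)\<close>.\<close>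

lemma J_limits:
  assumes rv: "regularly_varying V p"
  shows "((\<lambda>z. J2 (1 / z) / V z) \<longlongrightarrow> Gamma (p + 1)) at_top"
    "((\<lambda>z. J3 (1 / z) / z / V z) \<longlongrightarrow> p * Gamma (p + 1)) at_top"
proof -
  have mono: "mono V" by (simp add: mono_def V_mono)
  have p: "p \<ge> 0" by (rule monotone_regularly_varying_index[OF mono rv])
  note lim = abelian_Gamma_integral[OF mono rv V_neg]
  have eq2: "\<forall>\<^sub>F z in at_top. (\<integral>w. w ^ 0 * exp (- w) * V (w * z) \<partial>lborel) / V z = J2 (1 / z) / V z"
    using eventually_gt_at_top[of 0] by eventually_elim (simp add: J2_layers)
  show 2: "((\<lambda>z. J2 (1 / z) / V z) \<longlongrightarrow> Gamma (p + 1)) at_top"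
    using Lim_transform_eventually[OF lim[of 0] eq2] by simp
  have eq3: "\<forall>\<^sub>F z in at_top. (\<integral>w. w ^ 1 * exp (- w) * V (w * z) \<partial>lborel) / V z - J2 (1 / z) / V z
      = J3 (1 / z) / z / V z"
    using eventually_gt_at_top[of 0] by eventually_elim (simp add: J3_layers[symmetric] add_divide_distrib)
  have "Gamma (p + 1 + 1) = (p + 1) * Gamma (p + 1)" using p by (intro Gamma_plus1) auto
  then show "((\<lambda>z. J3 (1 / z) / z / V z) \<longlongrightarrow> p * Gamma (p + 1)) at_top"
    using Lim_transform_eventually[OF tendsto_diff[OF lim[of 1] 2] eq3] by (simp add: algebra_simps)
qed

text \<open>If \<open>p > 0\<close> then \<open>V\<close> is unbounded and the diffusion coefficient \<open>b\<close> is asymptotically negligible;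
  if \<open>p = 0\<close> it may contribute to the limit of \<open>\<psi>''\<close>, but the numerator then vanishes.\<close>

lemma elasticity_second_derivative:
  assumes rv: "regularly_varying V p" and b: "b \<ge> 0"
  shows "((\<lambda>y. y * J3 y / (2 * b + J2 y)) \<longlongrightarrow> p) (at_right 0)"
    and "\<forall>\<^sub>F y in at_right 0. 2 * b + J2 y > 0"
proof -
  have p: "p \<ge> 0" using monotone_regularly_varying_index[OF _ rv] by (simp add: mono_def V_mono)
  have pos: "\<forall>\<^sub>F z in at_top. V z > 0" using rv by (simp add: regularly_varying_def)
  then obtain z\<^sub>0 where z\<^sub>0: "\<And>z. z \<ge> z\<^sub>0 \<Longrightarrow> V z > 0" unfolding eventually_at_top_linorder by auto
  \<comment> \<open>\<open>1 / V\<close> is eventually non-increasing and bounded below, so it has a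
    limit: the weight with which \<open>2 * b\<close> survives division by \<open>V\<close>.\<close>
  define l where "l = Inf ((\<lambda>z. 1 / V z) ` {z\<^sub>0..})"
  have l: "((\<lambda>z. 1 / V z) \<longlongrightarrow> l) at_top"
  proof (rule decreasing_tendsto)
    have bdd: "bdd_below ((\<lambda>z. 1 / V z) ` {z\<^sub>0..})" by (rule bdd_belowI[of _ 0]) (auto simp: V_nonneg)
    show "\<forall>\<^sub>F z in at_top. l \<le> 1 / V z"
      using eventually_ge_at_top[of z\<^sub>0] by eventually_elim (auto simp: l_def intro!: cInf_lower bdd)
    fix x assume "l < x"
    then obtain z where z: "z \<ge> z\<^sub>0" "1 / V z < x" unfolding l_def
      using cInf_lessD[of "(\<lambda>z. 1 / V z) ` {z\<^sub>0..}" x] by auto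
    show "\<forall>\<^sub>F z in at_top. 1 / V z < x"
      using eventually_ge_at_top[of z]
    proof eventually_elim
      case (elim z')
      then have "1 / V z' \<le> 1 / V z" using z z\<^sub>0[of z] V_mono[of z z'] by (intro divide_left_mono) auto
      then show ?case using z by simp
    qed
  qed
  have l_nonneg: "l \<ge> 0"
    by (rule tendsto_lowerbound[OF l]) (auto simp: V_nonneg)
  \<comment> \<open>\<open>1 / V z\<close> and \<open>1 / V (2 * z)\<close> share the limit
    \<open>l\<close>, while their quotient tends to \<open>2 powr p\<close>; hence
    \<open>2 powr p * l = l\<close>. The vanishing product lets the limit of the quotient simplify
    to \<open>p\<close> in both cases.\<close>
  have pl: "p * l = 0"
  proof (cases "p = 0")
    case False
    have "((\<lambda>z. (V (2 * z) / V z) * (1 / V (2 * z))) \<longlongrightarrow> 2 powr p * l) at_top"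
      using rv filterlim_compose[OF l, of "\<lambda>z. 2 * z" at_top]
      by (intro tendsto_mult) (auto simp: regularly_varying_def filterlim_tendsto_pos_mult_at_top[OF tendsto_const _ filterlim_ident])
    moreover have "\<forall>\<^sub>F z in at_top. (V (2 * z) / V z) * (1 / V (2 * z)) = 1 / V z"
      using eventually_ge_at_top[of z\<^sub>0] eventually_gt_at_top[of 0]
    proof eventually_elim
      case (elim z)
      then show ?case using z\<^sub>0[of "2 * z"] by simp
    qed
    ultimately have "((\<lambda>z. 1 / V z) \<longlongrightarrow> 2 powr p * l) at_top" by (rule Lim_transform_eventually)
    then have "2 powr p * l = l" using l by (intro tendsto_unique[OF trivial_limit_at_top_linorder])
    then show ?thesis using False by (simp add: powr_eq_one_iff_gen)
  qed simp
  have G: "Gamma (p + 1) > 0" using p by (intro Gamma_real_pos) auto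
  have den: "((\<lambda>z. 2 * b * (1 / V z) + J2 (1 / z) / V z) \<longlongrightarrow> 2 * b * l + Gamma (p + 1)) at_top"
    by (intro tendsto_intros l J_limits rv)
  have D: "2 * b * l + Gamma (p + 1) > 0" using G b l_nonneg by (simp add: add_nonneg_pos)
  have "((\<lambda>z. (J3 (1 / z) / z / V z) / (2 * b * (1 / V z) + J2 (1 / z) / V z))
      \<longlongrightarrow> p * Gamma (p + 1) / (2 * b * l + Gamma (p + 1))) at_top"
    using D by (intro tendsto_divide J_limits rv den) auto
  also have "p * Gamma (p + 1) / (2 * b * l + Gamma (p + 1)) = p"
    using D pl by (simp add: divide_eq_eq algebra_simps)
  finally have lim: "((\<lambda>z. (J3 (1 / z) / z / V z) / (2 * b * (1 / V z) + J2 (1 / z) / V z)) \<longlongrightarrow> p) at_top" .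
  have "\<forall>\<^sub>F z in at_top. (J3 (1 / z) / z / V z) / (2 * b * (1 / V z) + J2 (1 / z) / V z) =
      1 / z * J3 (1 / z) / (2 * b + J2 (1 / z))"
    using pos by eventually_elim (simp add: add_divide_distrib[symmetric])
  from Lim_transform_eventually[OF lim this]
  show "((\<lambda>y. y * J3 y / (2 * b + J2 y)) \<longlongrightarrow> p) (at_right 0)"
    by (simp add: filterlim_at_right_to_top inverse_eq_divide)
  have "\<forall>\<^sub>F z in at_top. 2 * b * (1 / V z) + J2 (1 / z) / V z > 0"
    using order_tendstoD(1)[OF den D] .
  then have "\<forall>\<^sub>F z in at_top. 2 * b + J2 (1 / z) > 0"
    using pos by eventually_elim (simp add: add_divide_distrib[symmetric] zero_less_divide_iff)
  then show "\<forall>\<^sub>F y in at_right 0. 2 * b + J2 y > 0"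
    by (simp add: eventually_at_right_to_top inverse_eq_divide)
qed

end

text \<open>Each integration raises the elasticity by one: \<open>- p\<close> for the second
  derivative, \<open>1 - p\<close> for the first, \<open>2 - p\<close> for \<psi>. Criticality makes
  numerators and denominators vanish at 0, as l'Hopital's rule requires. The bound \<alpha> \<le> 1
  is \<open>p \<ge> 0\<close>, and \<alpha> \<ge> 0 holds because the first derivative is
  non-decreasing.\<close>

lemma critical_mechanism_elasticity:
  assumes mechanism: "branching_mechanism \<psi> \<Lambda>"
    and critical: "(deriv \<psi> \<longlongrightarrow> 0) (at_right 0)"
    and rv: "regularly_varying_measure (density \<Lambda> (\<lambda>x. ennreal (x\<^sup>2)))"
  shows "\<exists>\<alpha> \<psi>'. 0 \<le> \<alpha> \<and> \<alpha> \<le> 1 \<and>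
    (\<forall>y>0. (\<psi> has_real_derivative \<psi>' y) (at y)) \<and> (\<forall>y>0. 0 < \<psi> y \<and> \<psi> y \<le> y * \<psi>' y) \<and>
    (\<psi>' \<longlongrightarrow> 0) (at_right 0) \<and> ((\<lambda>y. y * \<psi>' y / \<psi> y) \<longlongrightarrow> 1 + \<alpha>) (at_right 0)"
proof -
  interpret levy_measure \<Lambda>
    using mechanism by (auto simp: levy_measure_def branching_mechanism_def)
  obtain a b where b: "b \<ge> 0" and psi: "\<And>y. y \<ge> 0 \<Longrightarrow> \<psi> y = a * y + b * y\<^sup>2 + J0 y"
    using mechanism unfolding branching_mechanism_def J0_def by blast
  obtain p where p: "regularly_varying V p"
    using rv unfolding regularly_varying_measure_def V_def[abs_def] by blast
  define \<psi>1 where "\<psi>1 y = a + 2 * b * y + J1 y" for y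
  define \<psi>2 where "\<psi>2 y = 2 * b + J2 y" for y
  have d0: "(\<psi> has_real_derivative \<psi>1 y) (at y)" if "y > 0" for y
  proof (rule has_field_derivative_transform_within_open[of _ _ _ "{0<..}"])
    show "((\<lambda>y. a * y + b * y\<^sup>2 + J0 y) has_real_derivative \<psi>1 y) (at y)"
      by (auto simp: \<psi>1_def intro!: derivative_eq_intros deriv_J that)
  qed (use that psi in auto)
  have d1: "(\<psi>1 has_real_derivative \<psi>2 y) (at y)" if "y > 0" for y
    unfolding \<psi>1_def[abs_def] \<psi>2_def by (auto intro!: derivative_eq_intros deriv_J that)
  have d2: "(\<psi>2 has_real_derivative - J3 y) (at y)" if "y > 0" for y
    unfolding \<psi>2_def[abs_def] by (auto intro!: derivative_eq_intros deriv_J that)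
  have psi2_nonneg: "\<psi>2 y \<ge> 0" for y
    using b unfolding \<psi>2_def J2_def by (auto intro!: add_nonneg_nonneg Bochner_Integration.integral_nonneg)
  have J3_nonneg: "J3 y \<ge> 0" for y
    unfolding J3_def by (auto intro!: integral_nonneg_AE simp: space_levy)
  have psi2_anti: "\<psi>2 z \<le> \<psi>2 y" if "0 < y" "y \<le> z" for y z
  proof (rule DERIV_nonpos_imp_nonincreasing[OF that(2)])
    show "\<exists>d. (\<psi>2 has_real_derivative d) (at x) \<and> d \<le> 0" if "y \<le> x" for x
      using that \<open>0 < y\<close> J3_nonneg[of x] by (intro exI[of _ "- J3 x"]) (simp add: d2)
  qed
  have psi1_mono: "\<psi>1 y \<le> \<psi>1 z" if "0 < y" "y \<le> z" for y z
  proof (rule DERIV_nonneg_imp_nondecreasing[OF that(2)])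
    show "\<exists>d. (\<psi>1 has_real_derivative d) (at x) \<and> d \<ge> 0" if "y \<le> x" for x
      using that \<open>0 < y\<close> psi2_nonneg[of x] by (intro exI[of _ "\<psi>2 x"]) (simp add: d1)
  qed
  have psi1_lim: "(\<psi>1 \<longlongrightarrow> 0) (at_right 0)"
    by (rule Lim_transform_eventually[OF critical])
      (auto simp: eventually_at_filter intro!: always_eventually DERIV_imp_deriv d0)
  have psi2_pos: "\<forall>\<^sub>F y in at_right 0. \<psi>2 y > 0"
    using elasticity_second_derivative(2)[OF p b] by (simp add: \<psi>2_def)
  have psi1_nonneg: "\<psi>1 y \<ge> 0" if "y > 0" for y
    by (rule tendsto_upperbound[OF psi1_lim])
      (use that psi1_mono in \<open>auto simp: eventually_at_right_field intro!: exI[of _ y]\<close>)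
  \<comment> \<open>Positivity of \<open>\<psi>2\<close> is known only near 0. Strict growth on
    \<open>[m / 2, m]\<close> inside that region is enough, since \<open>\<psi>1\<close> is
    non-negative and non-decreasing.\<close>
  have psi1_pos: "\<psi>1 y > 0" if "y > 0" for y
  proof -
    obtain d where d: "d > 0" "\<And>z. 0 < z \<Longrightarrow> z < d \<Longrightarrow> \<psi>2 z > 0"
      using psi2_pos by (auto simp: eventually_at_right_field)
    define m where "m = min (y / 2) (d / 2)"
    have m: "0 < m" "m < y" "m < d" using d(1) that by (auto simp: m_def)
    have "\<psi>1 (m / 2) < \<psi>1 m"
    proof (rule DERIV_pos_imp_increasing[of "m / 2" m \<psi>1])
      show "\<exists>d. (\<psi>1 has_real_derivative d) (at x) \<and> d > 0" if "m / 2 \<le> x" "x \<le> m" for x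
        using that m d(2)[of x] by (intro exI[of _ "\<psi>2 x"]) (simp add: d1)
    qed (use m in simp)
    then show ?thesis using psi1_nonneg[of "m / 2"] psi1_mono[of m y] m by simp
  qed
  have psi_lim: "(\<psi> \<longlongrightarrow> 0) (at_right 0)"
  proof -
    have J0_bound: "0 \<le> J0 y \<and> J0 y \<le> (y + y\<^sup>2) * (\<integral>x. min (x\<^sup>2) x \<partial>\<Lambda>)" if "y > 0" for y
    proof
      show "0 \<le> J0 y" unfolding J0_def
        by (rule Bochner_Integration.integral_nonneg) (use levy_kernel_bounds(1) that in \<open>auto simp: space_levy\<close>)
      have "J0 y \<le> (\<integral>x. (y + y\<^sup>2) * min (x\<^sup>2) x \<partial>\<Lambda>)" unfolding J0_def
        by (intro integral_mono integrable_kernels that integrable_mult_right integrable_levy levy_kernel_bounds)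
          (auto simp: space_levy)
      then show "J0 y \<le> (y + y\<^sup>2) * (\<integral>x. min (x\<^sup>2) x \<partial>\<Lambda>)" by simp
    qed
    have "(J0 \<longlongrightarrow> 0) (at_right 0)"
    proof (rule tendsto_sandwich[where f="\<lambda>_. 0"])
      have "((\<lambda>y. (y + y\<^sup>2) * (\<integral>x. min (x\<^sup>2) x \<partial>\<Lambda>)) \<longlongrightarrow> (0 + 0\<^sup>2) * (\<integral>x. min (x\<^sup>2) x \<partial>\<Lambda>)) (at_right 0)"
        by (intro tendsto_intros)
      then show "((\<lambda>y. (y + y\<^sup>2) * (\<integral>x. min (x\<^sup>2) x \<partial>\<Lambda>)) \<longlongrightarrow> 0) (at_right 0)" by simp
    qed (use J0_bound in \<open>auto simp: eventually_at_filter\<close>)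
    then have "((\<lambda>y. a * y + b * y\<^sup>2 + J0 y) \<longlongrightarrow> a * 0 + b * 0\<^sup>2 + 0) (at_right 0)"
      by (intro tendsto_intros)
    then have "((\<lambda>y. a * y + b * y\<^sup>2 + J0 y) \<longlongrightarrow> 0) (at_right 0)" by simp
    then show ?thesis
      by (rule Lim_transform_eventually) (auto simp: eventually_at_filter psi)
  qed
  have psi_mono: "\<psi> y < \<psi> z" if "0 < y" "y < z" for y z
  proof (rule DERIV_pos_imp_increasing[OF that(2)])
    show "\<exists>d. (\<psi> has_real_derivative d) (at x) \<and> d > 0" if "y \<le> x" for x
      using that \<open>0 < y\<close> psi1_pos[of x] by (intro exI[of _ "\<psi>1 x"]) (simp add: d0)
  qed
  have psi_nonneg: "\<psi> y \<ge> 0" if "y > 0" for y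
    by (rule tendsto_upperbound[OF psi_lim])
      (use that psi_mono in \<open>auto simp: eventually_at_right_field intro!: exI[of _ y] less_imp_le\<close>)
  have psi_pos: "\<psi> y > 0" if "y > 0" for y
    using psi_nonneg[of "y / 2"] psi_mono[of "y / 2" y] that by simp
  have convex: "\<psi> y \<le> y * \<psi>1 y" if y: "y > 0" for y
  proof -
    have "\<psi> y - \<psi> e \<le> (y - e) * \<psi>1 y" if e: "0 < e" "e < y" for e
    proof -
      obtain \<xi> where "e < \<xi>" "\<xi> < y" "\<psi> y - \<psi> e = (y - e) * \<psi>1 \<xi>"
        using MVT2[OF e(2), of \<psi> \<psi>1] d0 e by force
      then show ?thesis using psi1_mono[of \<xi> y] e by (simp add: mult_left_mono)
    qed
    then have "\<forall>\<^sub>F e in at_right 0. \<psi> y - \<psi> e \<le> (y - e) * \<psi>1 y"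
      using y by (auto simp: eventually_at_right_field)
    moreover have "((\<lambda>e. \<psi> y - \<psi> e) \<longlongrightarrow> \<psi> y - 0) (at_right 0)"
      "((\<lambda>e. (y - e) * \<psi>1 y) \<longlongrightarrow> (y - 0) * \<psi>1 y) (at_right 0)"
      by (intro tendsto_intros psi_lim)+
    ultimately have "\<psi> y - 0 \<le> (y - 0) * \<psi>1 y"
      by (intro tendsto_le[of "at_right 0" _ _ "\<lambda>e. \<psi> y - \<psi> e"]) auto
    then show ?thesis by simp
  qed
  \<comment> \<open>As \<open>\<psi>2\<close> is non-increasing, its mean over
    \<open>[y / 2, y]\<close> is at least \<open>\<psi>2 y\<close>. Hence
    \<open>y * \<psi>2 y \<le> 2 * (\<psi>1 y - \<psi>1 (y / 2))\<close>, which tends to 0.\<close>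
  have prod_lim: "((\<lambda>y. y * \<psi>2 y) \<longlongrightarrow> 0) (at_right 0)"
  proof (rule tendsto_sandwich[where f="\<lambda>_. 0"])
    have "\<psi>2 y * y \<le> 2 * \<psi>1 y" if y: "y > 0" for y
    proof -
      obtain \<xi> where \<xi>: "y / 2 < \<xi>" "\<xi> < y" "\<psi>1 y - \<psi>1 (y / 2) = (y - y / 2) * \<psi>2 \<xi>"
        using MVT2[of "y / 2" y \<psi>1 \<psi>2] d1 y by force
      have "\<psi>2 y * y = 2 * ((y / 2) * \<psi>2 y)" by simp
      also have "\<dots> \<le> 2 * ((y / 2) * \<psi>2 \<xi>)" using psi2_anti[of \<xi> y] \<xi> y by (intro mult_left_mono) auto
      also have "(y / 2) * \<psi>2 \<xi> = \<psi>1 y - \<psi>1 (y / 2)" using \<xi>(3) by simp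
      finally show ?thesis using psi1_nonneg[of "y / 2"] y by simp
    qed
    then show "\<forall>\<^sub>F y in at_right 0. y * \<psi>2 y \<le> 2 * \<psi>1 y" by (auto simp: eventually_at_filter mult.commute)
    show "((\<lambda>y. 2 * \<psi>1 y) \<longlongrightarrow> 0) (at_right 0)" using tendsto_mult_left[OF psi1_lim, of 2] by simp
  qed (use psi2_nonneg in \<open>auto simp: eventually_at_filter\<close>)
  have psi_prod_lim: "((\<lambda>y. y * \<psi>1 y) \<longlongrightarrow> 0) (at_right 0)"
    using tendsto_mult[OF tendsto_ident_at psi1_lim] by simp
  have lim1: "((\<lambda>y. y * \<psi>2 y / \<psi>1 y) \<longlongrightarrow> 1 - p) (at_right 0)"
  proof (rule lhopital_right_0[OF prod_lim psi1_lim, where g'=\<psi>2 and f'="\<lambda>y. \<psi>2 y - y * J3 y"])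
    have "((\<lambda>y. 1 - y * J3 y / (2 * b + J2 y)) \<longlongrightarrow> 1 - p) (at_right 0)"
      by (intro tendsto_intros elasticity_second_derivative p b)
    moreover have "\<forall>\<^sub>F y in at_right 0. 1 - y * J3 y / (2 * b + J2 y) = (\<psi>2 y - y * J3 y) / \<psi>2 y"
      using psi2_pos by eventually_elim (simp add: \<psi>2_def diff_divide_distrib)
    ultimately show "((\<lambda>y. (\<psi>2 y - y * J3 y) / \<psi>2 y) \<longlongrightarrow> 1 - p) (at_right 0)"
      by (rule Lim_transform_eventually)
    show "\<forall>\<^sub>F y in at_right 0. \<psi>2 y \<noteq> 0" using psi2_pos by eventually_elim simp
    show "\<forall>\<^sub>F y in at_right 0. ((\<lambda>y. y * \<psi>2 y) has_real_derivative \<psi>2 y - y * J3 y) (at y)"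
      by (auto intro!: eventually_at_right_0I derivative_eq_intros d2)
  qed (auto intro!: eventually_at_right_0I d1 simp: psi1_pos less_imp_neq[symmetric])
  have "((\<lambda>y. y * \<psi>1 y / \<psi> y) \<longlongrightarrow> 1 + (1 - p)) (at_right 0)"
  proof (rule lhopital_right_0[OF psi_prod_lim psi_lim, where g'=\<psi>1 and f'="\<lambda>y. \<psi>1 y + y * \<psi>2 y"])
    have "((\<lambda>y. 1 + y * \<psi>2 y / \<psi>1 y) \<longlongrightarrow> 1 + (1 - p)) (at_right 0)"
      by (intro tendsto_intros lim1)
    moreover have "\<forall>\<^sub>F y in at_right 0. 1 + y * \<psi>2 y / \<psi>1 y = (\<psi>1 y + y * \<psi>2 y) / \<psi>1 y"
      by (intro eventually_at_right_0I) (simp add: add_divide_distrib psi1_pos less_imp_neq[symmetric])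
    ultimately show "((\<lambda>y. (\<psi>1 y + y * \<psi>2 y) / \<psi>1 y) \<longlongrightarrow> 1 + (1 - p)) (at_right 0)"
      by (rule Lim_transform_eventually)
    show "\<forall>\<^sub>F y in at_right 0. ((\<lambda>y. y * \<psi>1 y) has_real_derivative \<psi>1 y + y * \<psi>2 y) (at y)"
      by (auto intro!: eventually_at_right_0I derivative_eq_intros d1)
  qed (auto intro!: eventually_at_right_0I d0 simp: psi1_pos psi_pos less_imp_neq[symmetric])
  moreover have "0 \<le> 1 - p"
    by (rule tendsto_lowerbound[OF lim1])
      (auto intro!: eventually_at_right_0I simp: psi2_nonneg less_imp_le psi1_pos)
  moreover have "0 \<le> p"
    using monotone_regularly_varying_index[OF _ p] by (simp add: mono_def V_mono)
  ultimately show ?thesis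
    by (intro exI[of _ "1 - p"] exI[of _ \<psi>1]) (use d0 psi_pos convex psi1_lim in auto)
qed

section \<open>The limit relation and its solution\<close>

text \<open>The mean value theorem for \<open>F (exp s)\<close>, whose derivative is the factor
  \<open>\<xi> * F' \<xi>\<close>. The end points may come in either order or coincide, hence the
  weak inequalities.\<close>

lemma log_mean_value:
  fixes F F' :: "real \<Rightarrow> real"
  assumes deriv: "\<And>y. y > 0 \<Longrightarrow> (F has_real_derivative F' y) (at y)" and "a > 0" "b > 0"
  obtains \<xi> where "min a b \<le> \<xi>" "\<xi> \<le> max a b" "F b - F a = (ln b - ln a) * (\<xi> * F' \<xi>)"
proof -
  have *: "\<exists>\<xi>. a \<le> \<xi> \<and> \<xi> \<le> b \<and> F b - F a = (ln b - ln a) * (\<xi> * F' \<xi>)" if "0 < a" "a < b" for a b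
  proof -
    have "((\<lambda>s. F (exp s)) has_real_derivative F' (exp s) * exp s) (at s)" for s
      by (rule DERIV_chain2[OF deriv DERIV_exp]) simp
    moreover have "ln a < ln b" using that by simp
    ultimately obtain s where s: "ln a < s" "s < ln b"
      "F (exp (ln b)) - F (exp (ln a)) = (ln b - ln a) * (F' (exp s) * exp s)"
      using MVT2[of "ln a" "ln b" "\<lambda>s. F (exp s)" "\<lambda>s. F' (exp s) * exp s"] by blast
    have "a < exp s" "exp s < b" using s that by (metis exp_less_cancel_iff exp_ln order_less_trans)+
    then show ?thesis using s that by (intro exI[of _ "exp s"]) (simp add: mult.commute)
  qed
  consider "a < b" | "b < a" | "a = b" by linarith
  then show ?thesis
  proof cases
    case 1 then show ?thesis using *[of a b] assms that by auto
  next
    case 2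
    then obtain \<xi> where "b \<le> \<xi>" "\<xi> \<le> a" "F a - F b = (ln a - ln b) * (\<xi> * F' \<xi>)" using *[of b a] assms by auto
    moreover from this have "F b - F a = (ln b - ln a) * (\<xi> * F' \<xi>)" by (simp add: algebra_simps)
    ultimately show ?thesis using 2 that by auto
  next
    case 3 then show ?thesis using that[of a] by simp
  qed
qed

lemma filterlim_between_at_right_0:
  fixes u v \<xi> :: "'a \<Rightarrow> real"
  assumes v: "filterlim v (at_right 0) F" and u: "((\<lambda>t. u t / v t) \<longlongrightarrow> \<gamma>) F" "\<gamma> > 0"
    and between: "\<forall>\<^sub>F t in F. min (v t) (u t) \<le> \<xi> t \<and> \<xi> t \<le> max (v t) (u t)"
  shows "filterlim \<xi> (at_right 0) F"
proof -
  have v_pos: "\<forall>\<^sub>F t in F. v t > 0" and v0: "(v \<longlongrightarrow> 0) F"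
    using v by (auto simp: filterlim_at elim: eventually_mono)
  have ratio: "\<forall>\<^sub>F t in F. u t / v t > 0" using order_tendstoD(1)[OF u] .
  have "((\<lambda>t. (u t / v t) * v t) \<longlongrightarrow> \<gamma> * 0) F" by (intro tendsto_mult u v0)
  moreover have "\<forall>\<^sub>F t in F. (u t / v t) * v t = u t" using v_pos by eventually_elim simp
  ultimately have u0: "(u \<longlongrightarrow> 0) F" by (simp add: Lim_transform_eventually)
  have "(\<xi> \<longlongrightarrow> 0) F"
  proof (rule tendsto_sandwich)
    show "((\<lambda>t. min (v t) (u t)) \<longlongrightarrow> 0) F" "((\<lambda>t. max (v t) (u t)) \<longlongrightarrow> 0) F"
      using tendsto_min[OF v0 u0] tendsto_max[OF v0 u0] by simp_all
  qed (use between in \<open>auto elim: eventually_mono\<close>)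
  moreover have "\<forall>\<^sub>F t in F. \<xi> t > 0" using between v_pos ratio
    by eventually_elim (auto simp: zero_less_divide_iff min_le_iff_disj)
  ultimately show ?thesis by (auto simp: filterlim_at elim: eventually_mono)
qed

text \<open>\<open>ln (f (u t)) - ln (f (v t))\<close> is \<open>ln (u t / v t)\<close> times the
  elasticity at an intermediate point, and that point is driven to 0 together with both arguments.
  The ratio \<open>u t / v t\<close> need only converge, as it does for the flow, instead of being
  fixed.\<close>

lemma regular_variation_of_elasticity:
  fixes f f' :: "real \<Rightarrow> real" and u v :: "'a \<Rightarrow> real"
  assumes deriv: "\<And>y. y > 0 \<Longrightarrow> (f has_real_derivative f' y) (at y)"
    and pos: "\<And>y. y > 0 \<Longrightarrow> f y > 0"
    and elasticity: "((\<lambda>y. y * f' y / f y) \<longlongrightarrow> \<beta>) (at_right 0)"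
    and v: "filterlim v (at_right 0) F" and u: "((\<lambda>t. u t / v t) \<longlongrightarrow> \<gamma>) F" "\<gamma> > 0"
  shows "((\<lambda>t. f (u t) / f (v t)) \<longlongrightarrow> \<gamma> powr \<beta>) F"
proof -
  have "\<exists>\<xi>. min a b \<le> \<xi> \<and> \<xi> \<le> max a b \<and> ln (f b) - ln (f a) = (ln b - ln a) * (\<xi> * (f' \<xi> / f \<xi>))"
    if "a > 0" "b > 0" for a b
  proof -
    have "((\<lambda>y. ln (f y)) has_real_derivative f' y / f y) (at y)" if "y > 0" for y
      using that pos by (auto intro!: derivative_eq_intros deriv)
    from log_mean_value[OF this that] show ?thesis by metis
  qed
  then obtain \<xi> where \<xi>: "min a b \<le> \<xi> a b \<and> \<xi> a b \<le> max a b \<and>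
      ln (f b) - ln (f a) = (ln b - ln a) * (\<xi> a b * (f' (\<xi> a b) / f (\<xi> a b)))" if "a > 0" "b > 0" for a b
    by metis
  have v_pos: "\<forall>\<^sub>F t in F. v t > 0" using v by (auto simp: filterlim_at elim: eventually_mono)
  have ratio: "\<forall>\<^sub>F t in F. u t / v t > 0" using order_tendstoD(1)[OF u] .
  have u_pos: "\<forall>\<^sub>F t in F. u t > 0" using v_pos ratio by eventually_elim (auto simp: zero_less_divide_iff)
  have "filterlim (\<lambda>t. \<xi> (v t) (u t)) (at_right 0) F"
  proof (rule filterlim_between_at_right_0[OF v u])
    show "\<forall>\<^sub>F t in F. min (v t) (u t) \<le> \<xi> (v t) (u t) \<and> \<xi> (v t) (u t) \<le> max (v t) (u t)"
      using v_pos u_pos by eventually_elim (use \<xi> in blast)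
  qed
  from filterlim_compose[OF elasticity this]
  have "((\<lambda>t. exp (ln (u t / v t) * (\<xi> (v t) (u t) * f' (\<xi> (v t) (u t)) / f (\<xi> (v t) (u t)))))
      \<longlongrightarrow> exp (ln \<gamma> * \<beta>)) F"
    using u by (intro tendsto_intros) auto
  moreover have "\<forall>\<^sub>F t in F. exp (ln (u t / v t) * (\<xi> (v t) (u t) * f' (\<xi> (v t) (u t)) / f (\<xi> (v t) (u t)))) =
      f (u t) / f (v t)"
    using v_pos u_pos
  proof eventually_elim
    case (elim t)
    have "ln (u t / v t) * (\<xi> (v t) (u t) * f' (\<xi> (v t) (u t)) / f (\<xi> (v t) (u t))) = ln (f (u t)) - ln (f (v t))"
      using \<xi>[OF elim] elim by (simp add: ln_div)
    also have "\<dots> = ln (f (u t) / f (v t))" using pos[OF elim(1)] pos[OF elim(2)] by (simp add: ln_div)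
    finally show ?case using pos[OF elim(1)] pos[OF elim(2)] by simp
  qed
  ultimately show ?thesis using u(2) by (simp add: powr_def mult.commute Lim_transform_eventually)
qed

section \<open>Grey's integral and its inverse\<close>

text \<open>What is kept of \<psi> once its integral representation has been exploited; the Levy
  measure does not reappear before the final theorem. \<open>grey\<close> is Grey's condition for
  extinction in finite time.\<close>

locale elastic_mechanism =
  fixes \<psi> \<psi>' :: "real \<Rightarrow> real" and \<alpha> :: real
  assumes alpha: "\<alpha> \<ge> 0"
    and deriv: "y > 0 \<Longrightarrow> (\<psi> has_real_derivative \<psi>' y) (at y)"
    and pos: "y > 0 \<Longrightarrow> 0 < \<psi> y"
    and convex: "y > 0 \<Longrightarrow> \<psi> y \<le> y * \<psi>' y"
    and deriv_lim: "(\<psi>' \<longlongrightarrow> 0) (at_right 0)"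
    and elasticity: "((\<lambda>y. y * \<psi>' y / \<psi> y) \<longlongrightarrow> 1 + \<alpha>) (at_right 0)"
    and grey: "\<exists>\<theta>\<^sub>0>0. set_integrable lborel {\<theta>\<^sub>0..} (\<lambda>\<xi>. 1 / \<psi> \<xi>)"
begin

definition "\<phi> y = integral {y..} (\<lambda>\<xi>. 1 / \<psi> \<xi>)"

lemma continuous_inverse_mechanism: "continuous_on {0<..} (\<lambda>\<xi>. 1 / \<psi> \<xi>)"
proof -
  have "continuous_on {0<..} \<psi>"
    by (rule DERIV_continuous_on[of _ _ \<psi>']) (simp add: has_field_derivative_at_within deriv)
  then show ?thesis by (intro continuous_intros) (simp_all add: pos less_imp_neq[OF pos, symmetric])
qed

lemma integrable_inverse_Icc: "0 < y \<Longrightarrow> (\<lambda>\<xi>. 1 / \<psi> \<xi>) integrable_on {y..z}"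
  by (intro integrable_continuous_interval continuous_on_subset[OF continuous_inverse_mechanism]) auto

lemma integrable_inverse_Ici:
  assumes "y > 0" shows "(\<lambda>\<xi>. 1 / \<psi> \<xi>) integrable_on {y..}"
proof -
  obtain \<theta> where \<theta>: "\<theta> > 0" "set_integrable lborel {\<theta>..} (\<lambda>\<xi>. 1 / \<psi> \<xi>)" using grey by auto
  then have *: "(\<lambda>\<xi>. 1 / \<psi> \<xi>) absolutely_integrable_on {\<theta>..}"
    by (simp add: absolutely_integrable_on_def set_integrable_def integrable_completion)
  have "(\<lambda>\<xi>. 1 / \<psi> \<xi>) absolutely_integrable_on {y..\<theta>}"
    using assms pos by (intro nonnegative_absolutely_integrable_1 integrable_inverse_Icc) (auto intro: less_imp_le)
  from set_integrable_Un[OF this *]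
  have "(\<lambda>\<xi>. 1 / \<psi> \<xi>) absolutely_integrable_on ({y..\<theta>} \<union> {\<theta>..})" by simp
  then have "(\<lambda>\<xi>. 1 / \<psi> \<xi>) absolutely_integrable_on {y..}"
    by (rule set_integrable_subset) auto
  then show ?thesis by (simp add: absolutely_integrable_on_def)
qed

lemma phi_split:
  assumes "0 < y" "y \<le> z" shows "\<phi> y = integral {y..z} (\<lambda>\<xi>. 1 / \<psi> \<xi>) + \<phi> z"
proof -
  have "{y..} = {y..z} \<union> {z..}" using assms by auto
  moreover have "{y..z} \<inter> {z..} = {z}" using assms by auto
  ultimately show ?thesis unfolding \<phi>_def using assms
    by (simp add: Henstock_Kurzweil_Integration.integral_Un integrable_inverse_Icc integrable_inverse_Ici)
qed

lemma deriv_phi: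
  assumes y: "y > 0" shows "(\<phi> has_real_derivative - 1 / \<psi> y) (at y)"
proof -
  have "((\<lambda>z. integral {y/2..z} (\<lambda>\<xi>. 1 / \<psi> \<xi>)) has_real_derivative 1 / \<psi> y) (at y within {y/2..y + 1})"
  proof (rule integral_has_real_derivative)
    show "continuous_on {y/2..y + 1} (\<lambda>\<xi>. 1 / \<psi> \<xi>)"
      by (rule continuous_on_subset[OF continuous_inverse_mechanism]) (use y in auto)
  qed (use y in auto)
  moreover have "at y within {y/2..y + 1} = at y" using y by (intro at_within_Icc_at) auto
  ultimately have "((\<lambda>z. integral {y/2..z} (\<lambda>\<xi>. 1 / \<psi> \<xi>)) has_real_derivative 1 / \<psi> y) (at y)" by metis
  then have "((\<lambda>z. \<phi> (y/2) - integral {y/2..z} (\<lambda>\<xi>. 1 / \<psi> \<xi>)) has_real_derivative - 1 / \<psi> y) (at y)"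
    by (auto intro!: derivative_eq_intros)
  then show ?thesis
  proof (rule has_field_derivative_transform_within_open[of _ _ _ "{y/2<..}"])
    show "\<phi> (y/2) - integral {y/2..z} (\<lambda>\<xi>. 1 / \<psi> \<xi>) = \<phi> z" if "z \<in> {y/2<..}" for z
      using phi_split[of "y/2" z] that y by simp
  qed (use y in auto)
qed

lemma phi_strict_antimono:
  assumes "0 < y" "y < z" shows "\<phi> z < \<phi> y"
proof (rule DERIV_neg_imp_decreasing[OF assms(2)])
  show "\<exists>d. (\<phi> has_real_derivative d) (at x) \<and> d < 0" if "y \<le> x" for x
    using that assms deriv_phi[of x] by (intro exI[of _ "- 1 / \<psi> x"]) (simp add: pos)
qed

lemma phi_less_iff: "0 < y \<Longrightarrow> 0 < z \<Longrightarrow> \<phi> z < \<phi> y \<longleftrightarrow> y < z"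
  using phi_strict_antimono[of y z] phi_strict_antimono[of z y] by (cases y z rule: linorder_cases) auto

lemma phi_inj: "0 < y \<Longrightarrow> 0 < z \<Longrightarrow> \<phi> z = \<phi> y \<Longrightarrow> y = z"
  using phi_less_iff[of y z] phi_less_iff[of z y] by linarith

lemma phi_at_top: "(\<phi> \<longlongrightarrow> 0) at_top"
proof -
  obtain \<theta> where \<theta>: "\<theta> > 0" "set_integrable lborel {\<theta>..} (\<lambda>\<xi>. 1 / \<psi> \<xi>)" using grey by auto
  have eq: "set_lebesgue_integral lborel {\<theta>..b} (\<lambda>\<xi>. 1 / \<psi> \<xi>) = integral {\<theta>..b} (\<lambda>\<xi>. 1 / \<psi> \<xi>)" for b
    by (intro set_borel_integral_eq_integral set_integrable_subset[OF \<theta>(2)]) auto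
  have eq': "set_lebesgue_integral lborel {\<theta>..} (\<lambda>\<xi>. 1 / \<psi> \<xi>) = \<phi> \<theta>"
    unfolding \<phi>_def by (rule set_borel_integral_eq_integral[OF \<theta>(2)])
  have "((\<lambda>b. integral {\<theta>..b} (\<lambda>\<xi>. 1 / \<psi> \<xi>)) \<longlongrightarrow> \<phi> \<theta>) at_top"
    using tendsto_set_lebesgue_integral_at_top[OF _ \<theta>(2)] by (simp add: eq eq')
  then have "((\<lambda>b. \<phi> \<theta> - integral {\<theta>..b} (\<lambda>\<xi>. 1 / \<psi> \<xi>)) \<longlongrightarrow> \<phi> \<theta> - \<phi> \<theta>) at_top"
    by (intro tendsto_intros)
  moreover have "\<forall>\<^sub>F b in at_top. \<phi> \<theta> - integral {\<theta>..b} (\<lambda>\<xi>. 1 / \<psi> \<xi>) = \<phi> b"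
    using eventually_ge_at_top[of \<theta>] by eventually_elim (simp add: phi_split[OF \<theta>(1)])
  ultimately show ?thesis by (simp add: Lim_transform_eventually)
qed

lemma phi_pos:
  assumes "y > 0" shows "\<phi> y > 0"
proof -
  have "\<forall>\<^sub>F z in at_top. \<phi> z \<le> \<phi> (y + 1)"
    using eventually_ge_at_top[of "y + 1"]
    by eventually_elim (use assms phi_less_iff in \<open>force simp: not_less[symmetric]\<close>)
  then have "0 \<le> \<phi> (y + 1)" by (intro tendsto_upperbound[OF phi_at_top]) auto
  then show ?thesis using phi_strict_antimono[of y "y + 1"] assms by simp
qed

text \<open>Criticality keeps \<open>\<psi>' y\<close> below 1 near 0, and
  \<open>\<psi> y \<le> y * \<psi>' y\<close> then gives \<open>\<psi> y \<le> y\<close>, so \<phi>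
  grows at least as fast as \<open>- ln y\<close>. This is what lets \<phi> attain every positive
  time.\<close>

lemma filterlim_phi_at_right_0: "filterlim \<phi> at_top (at_right 0)"
proof -
  have "\<forall>\<^sub>F y in at_right 0. \<psi>' y < 1" using order_tendstoD(2)[OF deriv_lim] by simp
  then obtain d where d: "d > 0" "\<And>y. 0 < y \<Longrightarrow> y < d \<Longrightarrow> \<psi>' y < 1" by (auto simp: eventually_at_right_field)
  have "\<phi> y \<ge> ln (d / 2) - ln y" if y: "0 < y" "y < d / 2" for y
  proof -
    obtain \<xi> where \<xi>: "min y (d/2) \<le> \<xi>" "\<xi> \<le> max y (d/2)"
      "\<phi> (d/2) - \<phi> y = (ln (d/2) - ln y) * (\<xi> * (- 1 / \<psi> \<xi>))"
      using log_mean_value[of \<phi> "\<lambda>y. - 1 / \<psi> y" y "d/2"] deriv_phi y d by auto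
    then have \<xi>': "0 < \<xi>" "\<xi> < d" using y d by auto
    then have "\<psi> \<xi> \<le> \<xi> * \<psi>' \<xi>" by (intro convex) auto
    also have "\<dots> \<le> \<xi> * 1" using \<xi>' d(2)[of \<xi>] by (intro mult_left_mono) auto
    finally have "1 \<le> \<xi> / \<psi> \<xi>" using pos[OF \<xi>'(1)] by simp
    moreover have "0 \<le> ln (d/2) - ln y" using y by simp
    ultimately have "(ln (d/2) - ln y) * 1 \<le> (ln (d/2) - ln y) * (\<xi> / \<psi> \<xi>)" by (intro mult_left_mono) auto
    also have "\<dots> = \<phi> y - \<phi> (d/2)" using \<xi>(3) by (simp add: algebra_simps)
    finally show ?thesis using phi_pos[of "d/2"] d by simp
  qed
  then have "\<forall>\<^sub>F y in at_right 0. ln (d / 2) - ln y \<le> \<phi> y"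
    using d by (auto simp: eventually_at_right_field intro!: exI[of _ "d/2"])
  moreover have "filterlim (\<lambda>y. ln (d / 2) - ln y) at_top (at_right 0)" by real_asymp
  ultimately show ?thesis by (rule filterlim_at_top_mono[rotated])
qed

lemma phi_surj:
  assumes "t > 0" shows "\<exists>y>0. \<phi> y = t"
proof -
  have "\<forall>\<^sub>F y in at_right 0. t < \<phi> y" using filterlim_phi_at_right_0 by (simp add: filterlim_at_top_dense)
  then obtain d where "d > 0" "\<And>y. 0 < y \<Longrightarrow> y < d \<Longrightarrow> t < \<phi> y" by (auto simp: eventually_at_right_field)
  then have y: "0 < d / 2" "t < \<phi> (d / 2)" by auto
  have "\<forall>\<^sub>F z in at_top. \<phi> z < t \<and> d / 2 < z"
    using order_tendstoD(2)[OF phi_at_top assms] eventually_gt_at_top[of "d / 2"] by eventually_elim auto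
  then obtain z where z: "\<phi> z < t" "d / 2 < z"
    using eventually_happens'[OF trivial_limit_at_top_linorder] by blast
  have "continuous_on {d / 2..z} \<phi>"
  proof (rule DERIV_continuous_on)
    show "(\<phi> has_real_derivative - 1 / \<psi> x) (at x within {d / 2..z})" if "x \<in> {d / 2..z}" for x
      by (rule has_field_derivative_at_within[OF deriv_phi]) (use that y in auto)
  qed
  then obtain x where "d / 2 \<le> x" "\<phi> x = t" using IVT2'[of \<phi> z t "d / 2"] y z by auto
  then show ?thesis using y by (intro exI[of _ x]) simp
qed

text \<open>\<open>v t\<close> turns out to be the limit of \<open>u t \<theta>\<close> as \<theta>
  tends to infinity, so that \<open>exp (- x * v t)\<close> is the probability of
  \<open>X t = 0\<close>. The choice is meaningful for \<open>t > 0\<close> only, since \<phi> takes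
  positive values on the positive half-line.\<close>

definition "v t = (SOME y. y > 0 \<and> \<phi> y = t)"

lemma
  assumes "t > 0" shows v_pos: "v t > 0" and phi_v: "\<phi> (v t) = t"
  using someI_ex[OF phi_surj[OF assms]] by (simp_all add: v_def)

lemma filterlim_v: "filterlim v (at_right 0) at_top"
proof -
  have "(v \<longlongrightarrow> 0) at_top"
  proof (rule tendstoI)
    fix e :: real assume e: "e > 0"
    show "\<forall>\<^sub>F t in at_top. dist (v t) 0 < e"
      using eventually_gt_at_top[of "\<phi> e"] eventually_gt_at_top[of 0]
    proof eventually_elim
      case (elim t)
      then have "\<phi> e < \<phi> (v t)" by (simp add: phi_v)
      then show ?case using phi_less_iff[OF v_pos e] elim v_pos[of t] by simp
    qed
  qed
  moreover have "\<forall>\<^sub>F t in at_top. v t > 0" using eventually_gt_at_top[of 0] by eventually_elim (rule v_pos)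
  ultimately show ?thesis by (auto simp: filterlim_at elim: eventually_mono)
qed

section \<open>Variation at zero of the mechanism and of Grey's integral\<close>

definition "R y = \<psi> y / y"

lemma R_pos: "y > 0 \<Longrightarrow> R y > 0" by (simp add: R_def pos)

lemma deriv_R: "y > 0 \<Longrightarrow> (R has_real_derivative (\<psi>' y * y - \<psi> y) / (y * y)) (at y)"
  unfolding R_def[abs_def] by (auto intro!: derivative_eq_intros deriv)

lemma R_mono:
  assumes "0 < y" "y \<le> z" shows "R y \<le> R z"
proof (rule DERIV_nonneg_imp_nondecreasing[OF assms(2)])
  show "\<exists>d. (R has_real_derivative d) (at x) \<and> 0 \<le> d" if "y \<le> x" for x
    using that assms convex[of x] deriv_R[of x]
    by (intro exI[of _ "(\<psi>' x * x - \<psi> x) / (x * x)"]) (simp add: mult.commute)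
qed

lemma R_elasticity: "((\<lambda>y. y * ((\<psi>' y * y - \<psi> y) / (y * y)) / R y) \<longlongrightarrow> \<alpha>) (at_right 0)"
proof -
  have "((\<lambda>y. y * \<psi>' y / \<psi> y - 1) \<longlongrightarrow> (1 + \<alpha>) - 1) (at_right 0)" by (intro tendsto_intros elasticity)
  moreover have "\<forall>\<^sub>F y in at_right 0. y * \<psi>' y / \<psi> y - 1 = y * ((\<psi>' y * y - \<psi> y) / (y * y)) / R y"

  proof (rule eventually_at_right_0I)
    fix y :: real assume "y > 0"
    then show "y * \<psi>' y / \<psi> y - 1 = y * ((\<psi>' y * y - \<psi> y) / (y * y)) / R y"
      using pos[of y] by (simp add: R_def field_simps)
  qed
  ultimately have "((\<lambda>y. y * ((\<psi>' y * y - \<psi> y) / (y * y)) / R y) \<longlongrightarrow> (1 + \<alpha>) - 1) (at_right 0)"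
    by (rule Lim_transform_eventually)
  then show ?thesis by simp
qed

text \<open>The comparison function \<open>y / \<psi> y\<close> has derivative
  \<open>- (y * \<psi>' y / \<psi> y - 1) / \<psi> y\<close>, so l'Hopital's rule sends its quotient
  with \<phi> to \<open>1 / \<alpha>\<close>. Positivity of \<alpha> keeps this derivative away from
  0 relative to \<open>1 / \<psi> y\<close>.\<close>

lemma phi_elasticity:
  assumes "\<alpha> > 0" shows "((\<lambda>y. y * (- 1 / \<psi> y) / \<phi> y) \<longlongrightarrow> - \<alpha>) (at_right 0)"
proof -
  \<comment> \<open>\<open>R y\<close> lies between 0 and \<open>\<psi>' y\<close>, so
    \<open>y / \<psi> y\<close> tends to infinity, which is the form of l'Hopital's rule used
    below.\<close>
  have R0: "((\<lambda>y. R y) \<longlongrightarrow> 0) (at_right 0)"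
    by (rule tendsto_sandwich[OF _ _ tendsto_const deriv_lim])
      (auto intro!: eventually_at_right_0I simp: R_def divide_le_eq convex mult.commute pos less_imp_le)
  then have "filterlim R (at_right 0) (at_right 0)"
    by (auto simp: filterlim_at R_pos less_imp_neq[symmetric] intro!: eventually_at_right_0I)
  then have "filterlim (\<lambda>y. inverse (R y)) at_top (at_right 0)"
    by (rule filterlim_compose[OF filterlim_inverse_at_top_right])
  then have lim: "filterlim (\<lambda>y. y / \<psi> y) at_top (at_right 0)" by (simp add: R_def)
  have "\<forall>\<^sub>F y in at_right 0. y * \<psi>' y / \<psi> y > 1"
    using order_tendstoD(1)[OF elasticity] assms by simp
  then have ne: "\<forall>\<^sub>F y in at_right 0. y > 0 \<and> \<psi> y > 0 \<and> y * \<psi>' y > \<psi> y"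
    using eventually_at_right_less[of 0] by eventually_elim (simp add: pos)
  have "((\<lambda>y. \<phi> y / (y / \<psi> y)) \<longlongrightarrow> 1 / \<alpha>) (at_right 0)"
  proof (rule lhopital_right_0_at_top[OF lim, where f'="\<lambda>y. - 1 / \<psi> y" and g'="\<lambda>y. (\<psi> y - y * \<psi>' y) / (\<psi> y * \<psi> y)"])
    show "\<forall>\<^sub>F y in at_right 0. (\<psi> y - y * \<psi>' y) / (\<psi> y * \<psi> y) \<noteq> 0"
      using ne by eventually_elim auto
    show "\<forall>\<^sub>F y in at_right 0. ((\<lambda>y. y / \<psi> y) has_real_derivative (\<psi> y - y * \<psi>' y) / (\<psi> y * \<psi> y)) (at y)"
      using ne by eventually_elim (auto intro!: derivative_eq_intros deriv)
    have "((\<lambda>y. 1 / (y * \<psi>' y / \<psi> y - 1)) \<longlongrightarrow> 1 / ((1 + \<alpha>) - 1)) (at_right 0)"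
      using assms by (intro tendsto_intros elasticity) auto
    moreover have "\<forall>\<^sub>F y in at_right 0. 1 / (y * \<psi>' y / \<psi> y - 1) = (- 1 / \<psi> y) / ((\<psi> y - y * \<psi>' y) / (\<psi> y * \<psi> y))"
      using ne
    proof eventually_elim
      case (elim y)
      have "y * \<psi>' y / \<psi> y - 1 = (y * \<psi>' y - \<psi> y) / \<psi> y" using elim by (simp add: diff_divide_distrib)
      moreover have "(\<psi> y - y * \<psi>' y) / (\<psi> y * \<psi> y) = - ((y * \<psi>' y - \<psi> y) / (\<psi> y * \<psi> y))"
        by (simp add: minus_divide_left)
      ultimately show ?case using elim by simp
    qed
    ultimately have "((\<lambda>y. (- 1 / \<psi> y) / ((\<psi> y - y * \<psi>' y) / (\<psi> y * \<psi> y))) \<longlongrightarrow> 1 / ((1 + \<alpha>) - 1)) (at_right 0)"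
      by (rule Lim_transform_eventually)
    then show "((\<lambda>y. (- 1 / \<psi> y) / ((\<psi> y - y * \<psi>' y) / (\<psi> y * \<psi> y))) \<longlongrightarrow> 1 / \<alpha>) (at_right 0)"
      by simp
    show "\<forall>\<^sub>F y in at_right 0. (\<phi> has_real_derivative - 1 / \<psi> y) (at y)"
      by (intro eventually_at_right_0I deriv_phi)
  qed
  then have "((\<lambda>y. - inverse (\<phi> y / (y / \<psi> y))) \<longlongrightarrow> - inverse (1 / \<alpha>)) (at_right 0)"
    using assms by (intro tendsto_minus tendsto_inverse) auto
  moreover have "(\<lambda>y. - inverse (\<phi> y / (y / \<psi> y))) = (\<lambda>y. y * (- 1 / \<psi> y) / \<phi> y)"
    by (auto simp: fun_eq_iff divide_inverse mult_ac)
  moreover have "- inverse (1 / \<alpha>) = - \<alpha>" by simp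
  ultimately show ?thesis by (simp only:)
qed

text \<open>Increments of \<phi> replace ratios, in the manner of de Haan's theory. The increment
  equals \<open>- ln (u t / w t) / R \<xi>\<close> with \<xi> between the arguments. Monotonicity of
  \<open>R\<close> places \<open>R \<xi> / R (w t)\<close> between 1 and
  \<open>R (u t) / R (w t)\<close>, and the latter tends to 1 because \<open>R\<close> has index
  \<alpha> = 0.\<close>

lemma phi_increment_slowly_varying:
  assumes "\<alpha> = 0" and w: "filterlim w (at_right 0) F" and u: "((\<lambda>t. u t / w t) \<longlongrightarrow> \<gamma>) F" "\<gamma> > 0"
  shows "((\<lambda>t. R (w t) * (\<phi> (u t) - \<phi> (w t))) \<longlongrightarrow> - ln \<gamma>) F"
proof -
  have "\<exists>\<xi>. min a b \<le> \<xi> \<and> \<xi> \<le> max a b \<and> \<phi> b - \<phi> a = (ln a - ln b) / R \<xi>"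
    if ab: "a > 0" "b > 0" for a b
  proof -
    obtain \<xi> where "min a b \<le> \<xi>" "\<xi> \<le> max a b" "\<phi> b - \<phi> a = (ln b - ln a) * (\<xi> * (- 1 / \<psi> \<xi>))"
      using log_mean_value[OF deriv_phi ab] .
    then show ?thesis by (intro exI[of _ \<xi>]) (simp add: R_def left_diff_distrib diff_divide_distrib)
  qed
  then obtain \<xi> where \<xi>: "min a b \<le> \<xi> a b \<and> \<xi> a b \<le> max a b \<and> \<phi> b - \<phi> a = (ln a - ln b) / R (\<xi> a b)"
    if "a > 0" "b > 0" for a b by metis
  have w_pos: "\<forall>\<^sub>F t in F. w t > 0" using w by (auto simp: filterlim_at elim: eventually_mono)
  have ratio: "\<forall>\<^sub>F t in F. u t / w t > 0" using order_tendstoD(1)[OF u] .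
  have u_pos: "\<forall>\<^sub>F t in F. u t > 0" using w_pos ratio by eventually_elim (auto simp: zero_less_divide_iff)
  have "((\<lambda>t. R (u t) / R (w t)) \<longlongrightarrow> \<gamma> powr \<alpha>) F"
    by (rule regular_variation_of_elasticity[OF deriv_R R_pos R_elasticity w u])
  then have R_ratio: "((\<lambda>t. R (u t) / R (w t)) \<longlongrightarrow> 1) F" using assms by simp
  have "((\<lambda>t. R (\<xi> (w t) (u t)) / R (w t) - 1) \<longlongrightarrow> 0) F"
  proof (rule Lim_null_comparison)
    show "\<forall>\<^sub>F t in F. norm (R (\<xi> (w t) (u t)) / R (w t) - 1) \<le> \<bar>R (u t) / R (w t) - 1\<bar>"
      using w_pos u_pos
    proof eventually_elim
      case (elim t)
      let ?x = "\<xi> (w t) (u t)"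
      have x: "min (w t) (u t) \<le> ?x" "?x \<le> max (w t) (u t)" using \<xi>[OF elim] by auto
      then have "?x > 0" using elim by auto
      have "\<bar>R ?x - R (w t)\<bar> \<le> \<bar>R (u t) - R (w t)\<bar>"
        using x elim \<open>?x > 0\<close> R_mono[of "u t" ?x] R_mono[of "w t" ?x] R_mono[of ?x "w t"] R_mono[of ?x "u t"]
        by (cases "u t \<le> w t") auto
      then have "\<bar>R ?x - R (w t)\<bar> / R (w t) \<le> \<bar>R (u t) - R (w t)\<bar> / R (w t)"
        using R_pos[OF elim(1)] by (intro divide_right_mono) auto
      moreover have "\<bar>a / R (w t) - 1\<bar> = \<bar>a - R (w t)\<bar> / R (w t)" for a
      proof -
        have "a / R (w t) - 1 = (a - R (w t)) / R (w t)"
          using R_pos[OF elim(1)] by (simp add: diff_divide_distrib)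
        then show ?thesis using R_pos[OF elim(1)] by (simp only: abs_divide abs_of_pos)
      qed
      ultimately show ?case by simp
    qed
    show "((\<lambda>t. \<bar>R (u t) / R (w t) - 1\<bar>) \<longlongrightarrow> 0) F"
      using R_ratio by (simp add: tendsto_rabs_zero_iff LIM_zero)
  qed
  then have "((\<lambda>t. R (\<xi> (w t) (u t)) / R (w t)) \<longlongrightarrow> 1) F" by (simp add: LIM_zero_iff)
  then have "((\<lambda>t. - ln (u t / w t) / (R (\<xi> (w t) (u t)) / R (w t))) \<longlongrightarrow> - ln \<gamma> / 1) F"
    using u by (intro tendsto_intros) auto
  moreover have "\<forall>\<^sub>F t in F. - ln (u t / w t) / (R (\<xi> (w t) (u t)) / R (w t)) = R (w t) * (\<phi> (u t) - \<phi> (w t))"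
    using w_pos u_pos by eventually_elim (simp add: \<xi> ln_div)
  ultimately have "((\<lambda>t. R (w t) * (\<phi> (u t) - \<phi> (w t))) \<longlongrightarrow> - ln \<gamma> / 1) F"
    by (rule Lim_transform_eventually)
  then show ?thesis by simp
qed

theorem limit_identification:
  fixes Q g :: "real \<Rightarrow> real" and U :: "real \<Rightarrow> real \<Rightarrow> real"
  assumes Q_pos: "\<forall>\<^sub>F t in at_top. Q t > 0" and Q_lim: "(Q \<longlongrightarrow> 0) at_top"
    and g_pos: "\<And>\<theta>. \<theta> > 0 \<Longrightarrow> 0 < g \<theta>" and g_less_1: "\<And>\<theta>. \<theta> > 0 \<Longrightarrow> g \<theta> < 1"
    and g_mono: "\<And>\<theta> \<theta>'. 0 < \<theta> \<Longrightarrow> \<theta> < \<theta>' \<Longrightarrow> g \<theta> < g \<theta>'"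
    and U: "\<And>\<theta>. \<theta> > 0 \<Longrightarrow> \<forall>\<^sub>F t in at_top. U t \<theta> > 0 \<and> \<phi> (U t \<theta>) = t + \<phi> (\<theta> * Q t)"
    and lim: "\<And>\<theta>. \<theta> > 0 \<Longrightarrow> ((\<lambda>t. U t \<theta> / v t) \<longlongrightarrow> g \<theta>) at_top"
  shows "\<alpha> > 0 \<and> (\<exists>c>0. ((\<lambda>t. Q t / v t) \<longlongrightarrow> c) at_top \<and>
    (\<forall>\<theta>>0. g \<theta> = (1 + c powr (- \<alpha>) * \<theta> powr (- \<alpha>)) powr (- 1 / \<alpha>)))"
proof -
  have Q: "filterlim Q (at_right 0) at_top"
    using Q_lim Q_pos by (auto simp: filterlim_at elim: eventually_mono)
  have Q_ratio: "((\<lambda>t. \<theta> * Q t / Q t) \<longlongrightarrow> \<theta>) at_top" for \<theta>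
    by (rule tendsto_eventually) (use Q_pos in eventually_elim, simp)
  show ?thesis
  proof (cases "\<alpha> = 0")
    case True
    \<comment> \<open>Since \<open>\<phi> (U t \<theta>) - \<phi> (v t) = \<phi> (\<theta> * Q
      t)\<close>, this is the limit of \<open>R (v t) * \<phi> (\<theta> * Q t)\<close>.\<close>
    define G where "G \<theta> = - ln (g \<theta>)" for \<theta>
    have G_pos: "G \<theta> > 0" if "\<theta> > 0" for \<theta> using g_pos[OF that] g_less_1[OF that] by (simp add: G_def)
    have G_lim: "((\<lambda>t. R (v t) * \<phi> (\<theta> * Q t)) \<longlongrightarrow> G \<theta>) at_top" if \<theta>: "\<theta> > 0" for \<theta>
    proof -
      have "((\<lambda>t. R (v t) * (\<phi> (U t \<theta>) - \<phi> (v t))) \<longlongrightarrow> G \<theta>) at_top"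
        unfolding G_def by (rule phi_increment_slowly_varying[OF True filterlim_v lim[OF \<theta>] g_pos[OF \<theta>]])
      moreover have "\<forall>\<^sub>F t in at_top. R (v t) * (\<phi> (U t \<theta>) - \<phi> (v t)) = R (v t) * \<phi> (\<theta> * Q t)"
        using U[OF \<theta>] eventually_gt_at_top[of 0] by eventually_elim (simp add: phi_v)
      ultimately show ?thesis by (rule Lim_transform_eventually)
    qed
    \<comment> \<open>The limit of \<open>R (v t) / R (Q t)\<close>, found by measuring the single
      increment of \<phi> from \<open>Q t\<close> to \<open>2 * Q t\<close> on both scales.\<close>
    define \<kappa> where "\<kappa> = (G 1 - G 2) / ln 2"
    have incr: "((\<lambda>t. R (Q t) * (\<phi> (\<theta> * Q t) - \<phi> (Q t))) \<longlongrightarrow> - ln \<theta>) at_top" if "\<theta> > 0" for \<theta>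
      by (rule phi_increment_slowly_varying[OF True Q Q_ratio that])
    have incr': "((\<lambda>t. R (v t) * (\<phi> (\<theta> * Q t) - \<phi> (Q t))) \<longlongrightarrow> G \<theta> - G 1) at_top" if "\<theta> > 0" for \<theta>
      using tendsto_diff[OF G_lim[OF that] G_lim[of 1]] by (simp add: right_diff_distrib)
    have ratio: "((\<lambda>t. R (v t) / R (Q t)) \<longlongrightarrow> \<kappa>) at_top"
    proof -
      have "((\<lambda>t. (R (v t) * (\<phi> (2 * Q t) - \<phi> (Q t))) / (R (Q t) * (\<phi> (2 * Q t) - \<phi> (Q t)))) \<longlongrightarrow> (G 2 - G 1) / (- ln 2)) at_top"
        by (intro tendsto_divide incr incr') auto
      moreover have "\<forall>\<^sub>F t in at_top. (R (v t) * (\<phi> (2 * Q t) - \<phi> (Q t))) / (R (Q t) * (\<phi> (2 * Q t) - \<phi> (Q t))) = R (v t) / R (Q t)"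
        using Q_pos
      proof eventually_elim
        case (elim t)
        then show ?case using phi_strict_antimono[of "Q t" "2 * Q t"] by simp
      qed
      ultimately have "((\<lambda>t. R (v t) / R (Q t)) \<longlongrightarrow> (G 2 - G 1) / (- ln 2)) at_top"
        by (rule Lim_transform_eventually)
      moreover have "(G 2 - G 1) / (- ln 2) = \<kappa>" by (simp add: \<kappa>_def minus_divide_left)
      ultimately show ?thesis by simp
    qed
    have \<kappa>: "\<kappa> > 0" using g_mono[of 1 2] g_pos[of 1] by (simp add: \<kappa>_def G_def)
    have G_eq: "G \<theta> - G 1 = \<kappa> * (- ln \<theta>)" if \<theta>: "\<theta> > 0" for \<theta>
    proof (rule tendsto_unique[OF trivial_limit_at_top_linorder incr'[OF \<theta>]])
      have "((\<lambda>t. (R (v t) / R (Q t)) * (R (Q t) * (\<phi> (\<theta> * Q t) - \<phi> (Q t)))) \<longlongrightarrow> \<kappa> * (- ln \<theta>)) at_top"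
        by (intro tendsto_mult ratio incr \<theta>)
      moreover have "\<forall>\<^sub>F t in at_top. (R (v t) / R (Q t)) * (R (Q t) * (\<phi> (\<theta> * Q t) - \<phi> (Q t))) =
          R (v t) * (\<phi> (\<theta> * Q t) - \<phi> (Q t))"
        using Q_pos
      proof eventually_elim
        case (elim t)
        then show ?case using R_pos[of "Q t"] by simp
      qed
      ultimately show "((\<lambda>t. R (v t) * (\<phi> (\<theta> * Q t) - \<phi> (Q t))) \<longlongrightarrow> \<kappa> * (- ln \<theta>)) at_top"
        by (rule Lim_transform_eventually)
    qed
    \<comment> \<open>The zero of the affine function of \<open>ln \<theta>\<close>; there
      \<open>g\<close> would equal 1.\<close>
    have "G (exp (G 1 / \<kappa>)) = 0" using G_eq[of "exp (G 1 / \<kappa>)"] \<kappa> by simp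
    then show ?thesis using G_pos[of "exp (G 1 / \<kappa>)"] by simp
  next
    case False
    with alpha have \<alpha>: "\<alpha> > 0" by simp
    have phi_ratio: "((\<lambda>t. \<phi> (u t) / \<phi> (w t)) \<longlongrightarrow> \<gamma> powr (- \<alpha>)) at_top"
      if "filterlim w (at_right 0) at_top" "((\<lambda>t. u t / w t) \<longlongrightarrow> \<gamma>) at_top" "\<gamma> > 0" for u w :: "real \<Rightarrow> real" and \<gamma>
      by (rule regular_variation_of_elasticity[OF deriv_phi phi_pos phi_elasticity[OF \<alpha>] that])
    \<comment> \<open>Dividing \<open>\<phi> (U t \<theta>) = \<phi> (v t) + \<phi> (\<theta> * Q
      t)\<close> by \<open>\<phi> (v t)\<close> shows \<open>k \<theta>\<close> to be the limit of
      \<open>\<phi> (\<theta> * Q t) / \<phi> (v t)\<close>.\<close>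
    define k where "k \<theta> = g \<theta> powr (- \<alpha>) - 1" for \<theta>
    have k_pos: "k \<theta> > 0" if "\<theta> > 0" for \<theta>
      using powr_less_mono2_neg[of "- \<alpha>" "g \<theta>" 1] g_pos[OF that] g_less_1[OF that] \<alpha> by (simp add: k_def)
    have k_lim: "((\<lambda>t. \<phi> (\<theta> * Q t) / \<phi> (v t)) \<longlongrightarrow> k \<theta>) at_top" if \<theta>: "\<theta> > 0" for \<theta>
    proof -
      have "((\<lambda>t. \<phi> (U t \<theta>) / \<phi> (v t) - 1) \<longlongrightarrow> k \<theta>) at_top"
        unfolding k_def by (intro tendsto_intros phi_ratio filterlim_v lim \<theta> g_pos)
      moreover have "\<forall>\<^sub>F t in at_top. \<phi> (U t \<theta>) / \<phi> (v t) - 1 = \<phi> (\<theta> * Q t) / \<phi> (v t)"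
        using U[OF \<theta>] eventually_gt_at_top[of 0] by eventually_elim (simp add: phi_v add_divide_distrib)
      ultimately show ?thesis by (rule Lim_transform_eventually)
    qed
    have k_eq: "k \<theta> = \<theta> powr (- \<alpha>) * k 1" if \<theta>: "\<theta> > 0" for \<theta>
    proof (rule tendsto_unique[OF trivial_limit_at_top_linorder k_lim[OF \<theta>]])
      have "((\<lambda>t. (\<phi> (\<theta> * Q t) / \<phi> (Q t)) * (\<phi> (1 * Q t) / \<phi> (v t))) \<longlongrightarrow> \<theta> powr (- \<alpha>) * k 1) at_top"
        by (intro tendsto_mult phi_ratio k_lim Q Q_ratio \<theta>) simp
      moreover have "\<forall>\<^sub>F t in at_top. (\<phi> (\<theta> * Q t) / \<phi> (Q t)) * (\<phi> (1 * Q t) / \<phi> (v t)) = \<phi> (\<theta> * Q t) / \<phi> (v t)"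
        using Q_pos
      proof eventually_elim
        case (elim t)
        then show ?case using phi_pos[of "Q t"] by simp
      qed
      ultimately show "((\<lambda>t. \<phi> (\<theta> * Q t) / \<phi> (v t)) \<longlongrightarrow> \<theta> powr (- \<alpha>) * k 1) at_top"
        by (rule Lim_transform_eventually)
    qed
    \<comment> \<open>If \<open>Q t / v t\<close> tends to \<open>c\<close>, then
      \<open>\<phi> (Q t) / \<phi> (v t)\<close> tends to \<open>c powr (- \<alpha>)\<close>. That
      limit is \<open>k 1\<close>, which dictates \<open>c\<close>.\<close>
    define c where "c = k 1 powr (- 1 / \<alpha>)"
    have c: "c > 0" "c powr (- \<alpha>) = k 1" using k_pos[of 1] \<alpha> by (simp_all add: c_def powr_powr)
    have v_ev: "\<forall>\<^sub>F t in at_top. v t > 0" using eventually_gt_at_top[of 0] by eventually_elim (rule v_pos)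
    have v_ratio: "((\<lambda>t. a * v t / v t) \<longlongrightarrow> a) at_top" for a
      by (rule tendsto_eventually) (use v_ev in eventually_elim, simp)
    \<comment> \<open>Convergence of values of \<phi> is carried back to the arguments by trapping.
      For positive \<open>a\<close> the limit of \<open>\<phi> (a * v t) / \<phi> (v t)\<close> is
      \<open>a powr (- \<alpha>)\<close>, strictly above \<open>k 1\<close> if \<open>a < c\<close>
      and strictly below if \<open>a > c\<close>, and \<phi> is strictly decreasing.\<close>
    have "((\<lambda>t. Q t / v t) \<longlongrightarrow> c) at_top"
    proof (rule order_tendstoI)
      fix a assume a: "a < c"
      show "\<forall>\<^sub>F t in at_top. a < Q t / v t"
      proof (cases "a > 0")
        case True
        have "k 1 < a powr (- \<alpha>)" using powr_less_mono2_neg[of "- \<alpha>" a c] a True \<alpha> c by simp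
        then have "((\<lambda>t. \<phi> (a * v t) / \<phi> (v t) - \<phi> (1 * Q t) / \<phi> (v t)) \<longlongrightarrow> a powr (- \<alpha>) - k 1) at_top"
          "0 < a powr (- \<alpha>) - k 1"
          using True by (auto intro!: tendsto_diff phi_ratio k_lim[of 1, simplified] filterlim_v v_ratio)
        from order_tendstoD(1)[OF this]
        show ?thesis using v_ev Q_pos
        proof eventually_elim
          case (elim t)
          then have "\<phi> (Q t) < \<phi> (a * v t)"
            using phi_pos[of "v t"] by (simp add: diff_divide_distrib[symmetric] zero_less_divide_iff)
          then have "a * v t < Q t" using phi_less_iff[of "a * v t" "Q t"] elim True by simp
          then show ?case using elim by (simp add: less_divide_eq)
        qed
      next
        case False
        show ?thesis using v_ev Q_pos
        proof eventually_elim
          case (elim t)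
          then have "0 < Q t / v t" by simp
          then show ?case using False by linarith
        qed
      qed
    next
      fix a assume a: "c < a"
      have "a powr (- \<alpha>) < k 1" using powr_less_mono2_neg[of "- \<alpha>" c a] a \<alpha> c by simp
      then have "((\<lambda>t. \<phi> (1 * Q t) / \<phi> (v t) - \<phi> (a * v t) / \<phi> (v t)) \<longlongrightarrow> k 1 - a powr (- \<alpha>)) at_top"
        "0 < k 1 - a powr (- \<alpha>)"
        using a c by (auto intro!: tendsto_diff phi_ratio k_lim[of 1, simplified] filterlim_v v_ratio)
      from order_tendstoD(1)[OF this]
      show "\<forall>\<^sub>F t in at_top. Q t / v t < a" using v_ev Q_pos
      proof eventually_elim
        case (elim t)
        then have "\<phi> (a * v t) < \<phi> (Q t)"
          using phi_pos[of "v t"] by (simp add: diff_divide_distrib[symmetric] zero_less_divide_iff)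
        then have "Q t < a * v t" using phi_less_iff[of "Q t" "a * v t"] elim a c by simp
        then show ?case using elim by (simp add: divide_less_eq)
      qed
    qed
    moreover have "g \<theta> = (1 + c powr (- \<alpha>) * \<theta> powr (- \<alpha>)) powr (- 1 / \<alpha>)" if \<theta>: "\<theta> > 0" for \<theta>
    proof -
      have "1 + c powr (- \<alpha>) * \<theta> powr (- \<alpha>) = g \<theta> powr (- \<alpha>)"
        using k_eq[OF \<theta>] by (simp add: c mult.commute k_def)
      then show ?thesis using g_pos[OF \<theta>] \<alpha> by (simp add: powr_powr)
    qed
    ultimately show ?thesis using \<alpha> c(1) by blast
  qed
qed

end

section \<open>Absorption at zero and extinction\<close>

text \<open>The part of \<open>A\<close> where the two predicates may differ lies in a null set, so
  \<open>A\<close> is measurable in the completion even if not in \<open>M\<close>. The survival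
  event is of this kind.\<close>

lemma measure_completion_AE_cong:
  assumes eq: "AE \<omega> in M. A \<omega> \<longleftrightarrow> B \<omega>" and B: "{\<omega> \<in> space M. B \<omega>} \<in> sets M"
  shows "measure (completion M) {\<omega> \<in> space (completion M). A \<omega>} = measure M {\<omega> \<in> space M. B \<omega>}"
proof -
  obtain N where N: "N \<in> null_sets M" "{\<omega> \<in> space M. \<not> (A \<omega> \<longleftrightarrow> B \<omega>)} \<subseteq> N"
    using eq unfolding eventually_ae_filter by auto
  have a: "{\<omega> \<in> space M. A \<omega>} \<inter> N \<in> sets (completion M)"
    by (rule null_sets_completion[OF N(1)]) auto
  have b: "{\<omega> \<in> space M. B \<omega>} - N \<in> sets (completion M)" using N(1) B by auto
  have split: "{\<omega> \<in> space M. A \<omega>} = ({\<omega> \<in> space M. B \<omega>} - N) \<union> ({\<omega> \<in> space M. A \<omega>} \<inter> N)"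
    using N(2) by auto
  have A: "{\<omega> \<in> space M. A \<omega>} \<in> sets (completion M)"
    by (subst split) (rule sets.Un[OF b a])
  have "measure (completion M) {\<omega> \<in> space M. A \<omega>} = measure (completion M) {\<omega> \<in> space M. B \<omega>}"
    using A B AE_completion[OF eq] by (intro measure_eq_AE) auto
  then show ?thesis using B by simp
qed

context elastic_mechanism begin

text \<open>\<phi> straightens the flow: along a solution, \<open>\<phi> (u s \<theta>)\<close> has
  derivative \<open>(- 1 / \<psi>) * (- \<psi>) = 1\<close>.\<close>

lemma phi_flow:
  assumes u: "branching_flow \<psi> u" and \<theta>: "\<theta> > 0" and t: "t \<ge> 0"
  shows "\<phi> (u t \<theta>) = t + \<phi> \<theta>"
proof -
  have "\<exists>c. \<forall>s\<in>{0..}. \<phi> (u s \<theta>) - s = c"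
  proof (rule has_field_derivative_zero_constant)
    fix s :: real assume s: "s \<in> {0..}"
    have us: "u s \<theta> > 0" "((\<lambda>s. u s \<theta>) has_real_derivative - \<psi> (u s \<theta>)) (at s within {0..})"
      using u s \<theta> by (auto simp: branching_flow_def)
    have "((\<lambda>s. \<phi> (u s \<theta>) - s) has_real_derivative (- 1 / \<psi> (u s \<theta>)) * (- \<psi> (u s \<theta>)) - 1) (at s within {0..})"
      by (intro DERIV_diff DERIV_ident DERIV_chain2[OF deriv_phi us(2)] us(1))
    then show "((\<lambda>s. \<phi> (u s \<theta>) - s) has_real_derivative 0) (at s within {0..})"
      using pos[OF us(1)] by simp
  qed simp
  then obtain c where c: "\<And>s. s \<ge> 0 \<Longrightarrow> \<phi> (u s \<theta>) - s = c" by auto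
  have "u 0 \<theta> = \<theta>" using u \<theta> by (simp add: branching_flow_def)
  then show ?thesis using c[of 0] c[OF t] by simp
qed

end

locale elastic_cb_process = cb_process M P X \<psi> + elastic_mechanism \<psi> \<psi>' \<alpha>
  for M :: "'a measure" and P X \<psi> \<psi>' \<alpha> +
  fixes u :: "real \<Rightarrow> real \<Rightarrow> real"
  assumes flow: "branching_flow \<psi> u"
    and laplace_u: "x > 0 \<Longrightarrow> t \<ge> 0 \<Longrightarrow> \<theta> > 0 \<Longrightarrow>
      (\<integral>\<omega>. exp (- \<theta> * X t \<omega>) \<partial>P x) = exp (- x * u t \<theta>)"
begin

lemma u_pos: "\<theta> > 0 \<Longrightarrow> t \<ge> 0 \<Longrightarrow> u t \<theta> > 0"
  using flow by (auto simp: branching_flow_def)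

lemmas phi_u = phi_flow[OF flow]

lemma u_le: "\<theta> > 0 \<Longrightarrow> t \<ge> 0 \<Longrightarrow> u t \<theta> \<le> \<theta>"
  using phi_less_iff[of \<theta> "u t \<theta>"] phi_u[of \<theta> t] u_pos[of \<theta> t] by (simp add: not_less[symmetric])

lemma u_add: "\<theta> > 0 \<Longrightarrow> s \<ge> 0 \<Longrightarrow> t \<ge> 0 \<Longrightarrow> u s (u t \<theta>) = u (s + t) \<theta>"
  by (rule phi_inj) (simp_all add: phi_u u_pos)

lemma u_less_v: "\<theta> > 0 \<Longrightarrow> t > 0 \<Longrightarrow> u t \<theta> < v t"
  using phi_less_iff[of "u t \<theta>" "v t"] phi_u[of \<theta> t] u_pos[of \<theta> t] v_pos[of t] phi_v[of t] phi_pos[of \<theta>] by simp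

lemma u_tendsto_v:
  assumes t: "t > 0" shows "((\<lambda>\<theta>. u t \<theta>) \<longlongrightarrow> v t) at_top"
proof (rule order_tendstoI)
  fix a assume a: "a < v t"
  show "\<forall>\<^sub>F \<theta> in at_top. a < u t \<theta>"
  proof (cases "a > 0")
    case True
    then have "\<phi> a - t > 0" using phi_less_iff[of a "v t"] a v_pos[OF t] phi_v[OF t] by simp
    from order_tendstoD(2)[OF phi_at_top this] show ?thesis using eventually_gt_at_top[of 0]
    proof eventually_elim
      case (elim \<theta>)
      then show ?case using phi_less_iff[of a "u t \<theta>"] True u_pos[of \<theta> t] phi_u[of \<theta> t] t by simp
    qed
  next
    case False
    show ?thesis using eventually_gt_at_top[of 0]
    proof eventually_elim
      case (elim \<theta>)
      then show ?case using False u_pos[of \<theta> t] t by simp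
    qed
  qed
next
  fix a assume a: "v t < a"
  show "\<forall>\<^sub>F \<theta> in at_top. u t \<theta> < a"
    using eventually_gt_at_top[of 0]
  proof eventually_elim
    case (elim \<theta>)
    then show ?case using u_less_v[of \<theta> t] a t by simp
  qed
qed

lemma space_P: "x > 0 \<Longrightarrow> space (P x) = space M"
  using sets_eq_imp_space_eq[OF sets_P] .

lemma measurable_X_P: "x > 0 \<Longrightarrow> t \<ge> 0 \<Longrightarrow> X t \<in> borel_measurable (P x)"
  using measurable_X measurable_cong_sets[OF sets_P refl] by blast

lemma exp_X_bounds:
  assumes "\<theta> \<ge> 0" "t \<ge> 0" "\<omega> \<in> space M" shows "exp (- \<theta> * X t \<omega>) \<le> 1"
  using assms nonneg_X by simp

lemma integrable_exp_X:
  assumes "x > 0" "t \<ge> 0" "\<theta> \<ge> 0" shows "integrable (P x) (\<lambda>\<omega>. exp (- \<theta> * X t \<omega>))"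
proof -
  interpret prob_space "P x" by (rule prob_space_P[OF assms(1)])
  show ?thesis
    using measurable_X_P[OF assms(1,2)] exp_X_bounds[OF assms(3,2)]
    by (intro integrable_const_bound[of _ 1]) (auto simp: space_P[OF assms(1)] intro!: AE_I2)
qed

text \<open>As \<theta> tends to infinity, \<open>exp (- \<theta> * X t \<omega>)\<close> tends to
  the indicator of \<open>X t \<omega> = 0\<close>, while \<open>u t \<theta>\<close> tends to
  \<open>v t\<close>.\<close>

lemma zero_prob:
  assumes x: "x > 0" and t: "t > 0"
  shows "measure (P x) {\<omega> \<in> space M. X t \<omega> = 0} = exp (- x * v t)"
proof -
  interpret prob_space "P x" by (rule prob_space_P[OF x])
  note [measurable] = measurable_X_P[OF x less_imp_le[OF t]]
  have "((\<lambda>\<theta>. \<integral>\<omega>. exp (- \<theta> * X t \<omega>) \<partial>P x) \<longlongrightarrow> (\<integral>\<omega>. indicator {\<omega> \<in> space (P x). X t \<omega> = 0} \<omega> \<partial>P x)) at_top"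
  proof (rule integral_dominated_convergence_at_top[where w="\<lambda>_. 1"])
    show "\<forall>\<^sub>F \<theta> in at_top. AE \<omega> in P x. norm (exp (- \<theta> * X t \<omega>)) \<le> 1"
      using eventually_gt_at_top[of 0]
    proof eventually_elim
      case (elim \<theta>)
      show ?case using exp_X_bounds[of \<theta> t] elim t by (intro AE_I2) (simp add: space_P[OF x])
    qed
    show "AE \<omega> in P x. ((\<lambda>\<theta>. exp (- \<theta> * X t \<omega>)) \<longlongrightarrow> indicator {\<omega> \<in> space (P x). X t \<omega> = 0} \<omega>) at_top"
    proof (rule AE_I2)
      fix \<omega> assume \<omega>: "\<omega> \<in> space (P x)"
      then have "X t \<omega> \<ge> 0" using nonneg_X[of t \<omega>] t by (simp add: space_P[OF x])
      then consider "X t \<omega> = 0" | "X t \<omega> > 0" by linarith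
      then show "((\<lambda>\<theta>. exp (- \<theta> * X t \<omega>)) \<longlongrightarrow> indicator {\<omega> \<in> space (P x). X t \<omega> = 0} \<omega>) at_top"
      proof cases
        case 2
        then have "((\<lambda>\<theta>. exp (- \<theta> * X t \<omega>)) \<longlongrightarrow> 0) at_top" by real_asymp
        then show ?thesis using 2 by simp
      qed (use \<omega> in simp)
    qed
  qed auto
  moreover have "(\<integral>\<omega>. indicator {\<omega> \<in> space (P x). X t \<omega> = 0} \<omega> \<partial>P x) = measure (P x) {\<omega> \<in> space M. X t \<omega> = 0}"
    by (simp add: space_P[OF x]) (auto intro!: arg_cong[where f=prob])
  moreover have "\<forall>\<^sub>F \<theta> in at_top. (\<integral>\<omega>. exp (- \<theta> * X t \<omega>) \<partial>P x) = exp (- x * u t \<theta>)"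
    using eventually_gt_at_top[of 0] by eventually_elim (use x t laplace_u in simp)
  ultimately have "((\<lambda>\<theta>. exp (- x * u t \<theta>)) \<longlongrightarrow> measure (P x) {\<omega> \<in> space M. X t \<omega> = 0}) at_top"
    using Lim_transform_eventually by fastforce
  moreover have "((\<lambda>\<theta>. exp (- x * u t \<theta>)) \<longlongrightarrow> exp (- x * v t)) at_top"
    by (intro tendsto_intros u_tendsto_v t)
  ultimately show ?thesis by (rule tendsto_unique[OF trivial_limit_at_top_linorder])
qed

section \<open>The Markov property at deterministic times and the state zero\<close>

abbreviation "F s \<equiv> natural_filtration (space M) X (ennreal s)"

lemma generator_filtration: "{X s -` A \<inter> space M | s A. 0 \<le> s \<and> ennreal s \<le> q \<and> A \<in> sets borel} \<subseteq> Pow (space M)"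
  by auto

lemma sets_filtration: "sets (natural_filtration (space M) X q) =
    sigma_sets (space M) {X s -` A \<inter> space M | s A. 0 \<le> s \<and> ennreal s \<le> q \<and> A \<in> sets borel}"
  unfolding natural_filtration_def by (rule sets_measure_of[OF generator_filtration])

lemma sets_filtration_M: "B \<in> sets (F s) \<Longrightarrow> B \<in> sets M"
  unfolding sets_filtration
  by (rule subsetD[OF sets.sigma_sets_subset[of _ M]]) (auto intro: measurable_sets[OF measurable_X])

lemma space_F: "space (natural_filtration (space M) X q) = space M"
  unfolding natural_filtration_def by (rule space_measure_of[OF generator_filtration])

lemma measurable_X_F: "0 \<le> r \<Longrightarrow> r \<le> s \<Longrightarrow> X r \<in> borel_measurable (F s)"
proof (rule measurableI)
  fix A :: "real set" assume "0 \<le> r" "r \<le> s" "A \<in> sets borel"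
  then show "X r -` A \<inter> space (F s) \<in> sets (F s)"
    unfolding sets_filtration space_F by (intro sigma_sets.Basic) (auto intro: ennreal_leI)
qed simp

lemma markov_set:
  assumes SM: "strong_markov M P X K" and x: "x > 0" and s: "s \<ge> 0" and B: "B \<in> sets (F s)"
    and t: "t \<ge> 0" and A: "A \<in> sets (restrict_space borel {0..})"
  shows "emeasure (P x) {\<omega> \<in> B. X (s + t) \<omega> \<in> A} = (\<integral>\<^sup>+\<omega>. indicator B \<omega> * emeasure (K t (X s \<omega>)) A \<partial>P x)"
proof -
  interpret filtration "space M" "natural_filtration (space M) X"
    by (rule filtration_natural_filtration)
  have T: "stopping_time (natural_filtration (space M) X) (\<lambda>_. ennreal s)" by (rule stopping_time_const)
  have "B \<in> sets (filtration.pre_sigma (space M) (natural_filtration (space M) X) (\<lambda>_. ennreal s))"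
  proof (rule sets_pre_sigmaI[OF T])
    fix q show "{\<omega> \<in> B. ennreal s \<le> q} \<in> sets (natural_filtration (space M) X q)"
      using B sets_F_mono[of "ennreal s" q] by (cases "ennreal s \<le> q") auto
  qed
  then have "emeasure (P x) {\<omega> \<in> B. ennreal s < \<infinity> \<and> X (enn2real (ennreal s) + t) \<omega> \<in> A} =
      (\<integral>\<^sup>+\<omega>. indicator {\<omega> \<in> B. ennreal s < \<infinity>} \<omega> * emeasure (K t (X (enn2real (ennreal s)) \<omega>)) A \<partial>P x)"
    using SM x T t A unfolding strong_markov_def by blast
  then show ?thesis using s by simp
qed

lemma measurable_X_nonneg: "t \<ge> 0 \<Longrightarrow> X t \<in> M \<rightarrow>\<^sub>M restrict_space borel {0..}"
  by (intro measurable_restrict_space2 measurable_X) (auto simp: nonneg_X)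

text \<open>The Markov property at time 0 identifies the kernel, because the process starts at
  \<open>y\<close> almost surely. This reaches positive starting points only and says nothing about
  \<open>K t 0\<close>.\<close>

lemma kernel_eq:
  assumes SM: "strong_markov M P X K" and y: "y > 0" and t: "t \<ge> 0"
  shows "K t y = distr (P y) (restrict_space borel {0..}) (X t)"
proof (rule measure_eqI)
  interpret prob_space "P y" by (rule prob_space_P[OF y])
  have "K t \<in> restrict_space borel {0..} \<rightarrow>\<^sub>M prob_algebra (restrict_space borel {0..})"
    using SM t by (simp add: strong_markov_def)
  then have "K t y \<in> space (prob_algebra (restrict_space borel {0..}))"
    by (rule measurable_space) (use y in \<open>simp add: space_restrict_space\<close>)
  then show sets: "sets (K t y) = sets (distr (P y) (restrict_space borel {0..}) (X t))"
    by (simp add: space_prob_algebra)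
  fix A assume "A \<in> sets (K t y)"
  then have A: "A \<in> sets (restrict_space borel {0..})" using sets by simp
  have Xt: "X t \<in> P y \<rightarrow>\<^sub>M restrict_space borel {0..}"
    using measurable_X_nonneg[OF t] measurable_cong_sets[OF sets_P[OF y] refl] by blast
  have "emeasure (P y) {\<omega> \<in> space M. X (0 + t) \<omega> \<in> A} =
      (\<integral>\<^sup>+\<omega>. indicator (space M) \<omega> * emeasure (K t (X 0 \<omega>)) A \<partial>P y)"
    by (rule markov_set[OF SM y order_refl _ t A]) (metis sets.top space_F)
  also have "\<dots> = (\<integral>\<^sup>+\<omega>. emeasure (K t y) A \<partial>P y)"
  proof (rule nn_integral_cong_AE)
    show "AE \<omega> in P y. indicator (space M) \<omega> * emeasure (K t (X 0 \<omega>)) A = emeasure (K t y) A"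
      using start[OF y] AE_space by eventually_elim (simp add: space_P[OF y])
  qed
  also have "\<dots> = emeasure (K t y) A" by (simp add: emeasure_space_1)
  finally show "emeasure (K t y) A = emeasure (distr (P y) (restrict_space borel {0..}) (X t)) A"
    using Xt A by (simp add: emeasure_distr space_P[OF y] vimage_def Int_def conj_commute)
qed

text \<open>Confining \<open>B\<close> to positive states keeps the kernel at 0 out of the
  computation, so the Laplace transform of each kernel involved is expressed by
  \<open>u\<close>.\<close>

lemma markov_laplace:
  assumes x: "x > 0" and s: "s \<ge> 0" and t: "t \<ge> 0" and \<theta>: "\<theta> > 0"
    and B: "B \<in> sets (F s)" and pos_B: "\<And>\<omega>. \<omega> \<in> B \<Longrightarrow> X s \<omega> > 0"
  shows "(\<integral>\<omega>. indicator B \<omega> * exp (- \<theta> * X (s + t) \<omega>) \<partial>P x) = (\<integral>\<omega>. indicator B \<omega> * exp (- u t \<theta> * X s \<omega>) \<partial>P x)"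
proof -
  obtain K where SM: "strong_markov M P X K" using strong_markov by auto
  let ?S = "restrict_space borel {0..} :: real measure"
  let ?D = "density (P x) (indicator B)"
  have BM: "B \<in> sets M" by (rule sets_filtration_M[OF B])
  note sP = measurable_cong_sets[OF sets_P[OF x] refl]
  have [measurable]: "B \<in> sets (P x)" using BM sets_P[OF x] by simp
  have meas_P [measurable]: "r \<ge> 0 \<Longrightarrow> X r \<in> P x \<rightarrow>\<^sub>M ?S" for r
    using measurable_X_nonneg[of r] sP by blast
  have meas: "r \<ge> 0 \<Longrightarrow> X r \<in> ?D \<rightarrow>\<^sub>M ?S" for r by simp
  have K: "K t \<in> ?S \<rightarrow>\<^sub>M subprob_algebra ?S"
    using SM t by (intro measurable_prob_algebraD) (simp add: strong_markov_def)
  have KX: "(\<lambda>\<omega>. K t (X s \<omega>)) \<in> ?D \<rightarrow>\<^sub>M subprob_algebra ?S"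
    by (rule measurable_compose[OF meas[OF s] K])
  have ne: "space ?D \<noteq> {}" using prob_space.not_empty[OF prob_space_P[OF x]] by simp
  have st: "s + t \<ge> 0" using s t by simp
  \<comment> \<open>The Markov property speaks of sets. As an identity between the law of
    \<open>X (s + t)\<close> restricted to \<open>B\<close> and a mixture of kernels, it can be
    integrated against \<open>exp (- \<theta> * z)\<close>.\<close>
  have "distr ?D ?S (X (s + t)) = ?D \<bind> (\<lambda>\<omega>. K t (X s \<omega>))"
  proof (rule measure_eqI)
    show sets: "sets (distr ?D ?S (X (s + t))) = sets (?D \<bind> (\<lambda>\<omega>. K t (X s \<omega>)))"
      using sets_bind[OF sets_kernel[OF KX] ne] by simp
    fix A assume "A \<in> sets (distr ?D ?S (X (s + t)))"
    then have A: "A \<in> sets ?S" by simp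
    have m: "X (s + t) -` A \<inter> space M \<in> sets (P x)"
      using measurable_sets[OF meas_P[OF st] A] by (simp add: space_P[OF x])
    have "emeasure (distr ?D ?S (X (s + t))) A = emeasure ?D (X (s + t) -` A \<inter> space M)"
      by (subst emeasure_distr[OF meas[OF st] A]) (simp add: space_P[OF x])
    also have "\<dots> = (\<integral>\<^sup>+\<omega>. indicator B \<omega> * indicator (X (s + t) -` A \<inter> space M) \<omega> \<partial>P x)"
      by (rule emeasure_density) (auto simp: m)
    also have "\<dots> = (\<integral>\<^sup>+\<omega>. indicator (B \<inter> (X (s + t) -` A \<inter> space M)) \<omega> \<partial>P x)"
      by (intro nn_integral_cong) (auto split: split_indicator)
    also have "\<dots> = emeasure (P x) (B \<inter> (X (s + t) -` A \<inter> space M))" using m by simp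
    also have "B \<inter> (X (s + t) -` A \<inter> space M) = {\<omega> \<in> B. X (s + t) \<omega> \<in> A}"
      using sets.sets_into_space[OF BM] by auto
    also have "emeasure (P x) \<dots> = (\<integral>\<^sup>+\<omega>. indicator B \<omega> * emeasure (K t (X s \<omega>)) A \<partial>P x)"
      by (rule markov_set[OF SM x s B t A])
    also have "\<dots> = (\<integral>\<^sup>+\<omega>. emeasure (K t (X s \<omega>)) A \<partial>?D)"
    proof (rule nn_integral_density[symmetric])
      show "(\<lambda>\<omega>. emeasure (K t (X s \<omega>)) A) \<in> borel_measurable (P x)"
        using measurable_compose[OF measurable_compose[OF meas_P[OF s] K] measurable_emeasure_subprob_algebra[OF A]] .
    qed simp
    also have "\<dots> = emeasure (?D \<bind> (\<lambda>\<omega>. K t (X s \<omega>))) A" by (rule emeasure_bind[OF ne KX A, symmetric])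
    finally show "emeasure (distr ?D ?S (X (s + t))) A = emeasure (?D \<bind> (\<lambda>\<omega>. K t (X s \<omega>))) A" .
  qed
  then have eq: "(\<integral>\<^sup>+z. ennreal (exp (- \<theta> * z)) \<partial>distr ?D ?S (X (s + t))) =
      (\<integral>\<^sup>+z. ennreal (exp (- \<theta> * z)) \<partial>(?D \<bind> (\<lambda>\<omega>. K t (X s \<omega>))))" by simp
  have f: "(\<lambda>z. ennreal (exp (- \<theta> * z))) \<in> borel_measurable ?S" by (intro measurable_restrict_space1) simp
  have kernel: "(\<integral>\<^sup>+z. ennreal (exp (- \<theta> * z)) \<partial>K t y) = ennreal (exp (- y * u t \<theta>))" if y: "y > 0" for y
  proof -
    have Xt: "X t \<in> P y \<rightarrow>\<^sub>M ?S"
      using measurable_X_nonneg[OF t] measurable_cong_sets[OF sets_P[OF y] refl] by blast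
    have "(\<integral>\<^sup>+z. ennreal (exp (- \<theta> * z)) \<partial>K t y) = (\<integral>\<^sup>+\<omega>. ennreal (exp (- \<theta> * X t \<omega>)) \<partial>P y)"
      unfolding kernel_eq[OF SM y t] using Xt f by (simp add: nn_integral_distr)
    also have "\<dots> = ennreal (\<integral>\<omega>. exp (- \<theta> * X t \<omega>) \<partial>P y)"
      using integrable_exp_X[OF y t less_imp_le[OF \<theta>]] by (intro nn_integral_eq_integral) auto
    finally show ?thesis using laplace_u[OF y t \<theta>] by simp
  qed
  have exp_meas: "(\<lambda>\<omega>. exp (c * X r \<omega>)) \<in> borel_measurable (P x)" if "r \<ge> 0" for c r
    using measurable_X_P[OF x that] by simp
  have "(\<integral>\<^sup>+\<omega>. ennreal (indicator B \<omega> * exp (- \<theta> * X (s + t) \<omega>)) \<partial>P x) =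
      (\<integral>\<^sup>+\<omega>. indicator B \<omega> * ennreal (exp (- \<theta> * X (s + t) \<omega>)) \<partial>P x)"
    by (intro nn_integral_cong) (auto split: split_indicator)
  also have "\<dots> = (\<integral>\<^sup>+z. ennreal (exp (- \<theta> * z)) \<partial>distr ?D ?S (X (s + t)))"
    using exp_meas[OF st, of "- \<theta>"] f by (simp add: nn_integral_distr[OF meas[OF st]] nn_integral_density)
  also have "\<dots> = (\<integral>\<^sup>+\<omega>. \<integral>\<^sup>+z. ennreal (exp (- \<theta> * z)) \<partial>K t (X s \<omega>) \<partial>?D)"
    unfolding eq by (rule nn_integral_bind[OF f KX])
  also have "\<dots> = (\<integral>\<^sup>+\<omega>. indicator B \<omega> * (\<integral>\<^sup>+z. ennreal (exp (- \<theta> * z)) \<partial>K t (X s \<omega>)) \<partial>P x)"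
  proof (rule nn_integral_density)
    show "(\<lambda>\<omega>. \<integral>\<^sup>+z. ennreal (exp (- \<theta> * z)) \<partial>K t (X s \<omega>)) \<in> borel_measurable (P x)"
      using measurable_compose[OF measurable_compose[OF meas_P[OF s] K] nn_integral_measurable_subprob_algebra[OF f]] .
  qed simp
  also have "\<dots> = (\<integral>\<^sup>+\<omega>. ennreal (indicator B \<omega> * exp (- u t \<theta> * X s \<omega>)) \<partial>P x)"
  proof (rule nn_integral_cong)
    fix \<omega>
    show "indicator B \<omega> * (\<integral>\<^sup>+z. ennreal (exp (- \<theta> * z)) \<partial>K t (X s \<omega>)) =
        ennreal (indicator B \<omega> * exp (- u t \<theta> * X s \<omega>))"
      using kernel[OF pos_B[of \<omega>]] by (cases "\<omega> \<in> B") (simp_all add: mult.commute[of "u t \<theta>"])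
  qed
  finally have "(\<integral>\<^sup>+\<omega>. ennreal (indicator B \<omega> * exp (- \<theta> * X (s + t) \<omega>)) \<partial>P x) = \<dots>" .
  then show ?thesis
    using exp_meas[OF st, of "- \<theta>"] exp_meas[OF s, of "- u t \<theta>"]
    by (subst (1 2) integral_eq_nn_integral) auto
qed

lemma integrable_indicator_exp_X:
  assumes "x > 0" "t \<ge> 0" "\<theta> \<ge> 0" "B \<in> sets M"
  shows "integrable (P x) (\<lambda>\<omega>. indicator B \<omega> * exp (- \<theta> * X t \<omega>))"
  using integrable_mult_indicator[OF _ integrable_exp_X[OF assms(1-3)], of B] assms sets_P by simp

text \<open>The transition kernel is not known at \<open>0\<close>. The Markov property on \<open>X\<^sub>s > 0\<close> together with the
  semigroup property of \<open>u\<close> accounts for the whole Laplace transform of the process at time \<open>s + t\<close>,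
  which forces absorption at \<open>0\<close>.\<close>

lemma zero_absorbing:
  assumes x: "x > 0" and s: "s \<ge> 0" and t: "t \<ge> 0" and \<theta>: "\<theta> > 0"
  shows "(\<integral>\<omega>. indicator {\<omega> \<in> space M. X s \<omega> = 0} \<omega> * exp (- \<theta> * X (s + t) \<omega>) \<partial>P x) =
    measure (P x) {\<omega> \<in> space M. X s \<omega> = 0}"
proof -
  interpret prob_space "P x" by (rule prob_space_P[OF x])
  let ?Z = "{\<omega> \<in> space M. X s \<omega> = 0}" and ?C = "{\<omega> \<in> space M. X s \<omega> > 0}"
  have [measurable]: "X s \<in> borel_measurable M" by (rule measurable_X[OF s])
  have Z: "?Z \<in> sets M" and C: "?C \<in> sets M" by measurable
  have split: "(\<integral>\<omega>. exp (- c * X r \<omega>) \<partial>P x) = (\<integral>\<omega>. indicator ?Z \<omega> * exp (- c * X r \<omega>) \<partial>P x) +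
      (\<integral>\<omega>. indicator ?C \<omega> * exp (- c * X r \<omega>) \<partial>P x)" if "c > 0" "r \<ge> 0" for c r
  proof -
    have "(\<integral>\<omega>. exp (- c * X r \<omega>) \<partial>P x) =
        (\<integral>\<omega>. indicator ?Z \<omega> * exp (- c * X r \<omega>) + indicator ?C \<omega> * exp (- c * X r \<omega>) \<partial>P x)"
    proof (rule Bochner_Integration.integral_cong)
      fix \<omega> assume "\<omega> \<in> space (P x)"
      then show "exp (- c * X r \<omega>) = indicator ?Z \<omega> * exp (- c * X r \<omega>) + indicator ?C \<omega> * exp (- c * X r \<omega>)"
        using nonneg_X[OF s, of \<omega>] by (cases "X s \<omega> = 0") (auto simp: space_P[OF x])
    qed simp
    also have "\<dots> = (\<integral>\<omega>. indicator ?Z \<omega> * exp (- c * X r \<omega>) \<partial>P x) +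
      (\<integral>\<omega>. indicator ?C \<omega> * exp (- c * X r \<omega>) \<partial>P x)"
      using that x Z C by (intro Bochner_Integration.integral_add integrable_indicator_exp_X) auto
    finally show ?thesis .
  qed
  have C_F: "?C \<in> sets (F s)"
  proof -
    have [measurable]: "X s \<in> borel_measurable (F s)" by (rule measurable_X_F[OF s order_refl])
    have "{\<omega> \<in> space (F s). X s \<omega> > 0} \<in> sets (F s)" by measurable
    then show ?thesis by (simp add: space_F)
  qed
  have "(\<integral>\<omega>. exp (- \<theta> * X (s + t) \<omega>) \<partial>P x) = (\<integral>\<omega>. exp (- u t \<theta> * X s \<omega>) \<partial>P x)"
    using laplace_u[OF x, of "s + t" \<theta>] laplace_u[OF x s u_pos[OF \<theta> t]] u_add[OF \<theta> s t] s t \<theta> by simp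
  moreover have "(\<integral>\<omega>. indicator ?C \<omega> * exp (- \<theta> * X (s + t) \<omega>) \<partial>P x) = (\<integral>\<omega>. indicator ?C \<omega> * exp (- u t \<theta> * X s \<omega>) \<partial>P x)"
    by (rule markov_laplace[OF x s t \<theta> C_F]) simp
  ultimately have "(\<integral>\<omega>. indicator ?Z \<omega> * exp (- \<theta> * X (s + t) \<omega>) \<partial>P x) = (\<integral>\<omega>. indicator ?Z \<omega> * exp (- u t \<theta> * X s \<omega>) \<partial>P x)"
    using split[OF \<theta>, of "s + t"] split[OF u_pos[OF \<theta> t] s] s t by simp
  also have "\<dots> = (\<integral>\<omega>. indicator ?Z \<omega> \<partial>P x)"
    by (intro Bochner_Integration.integral_cong) (auto split: split_indicator)
  also have "\<dots> = measure (P x) ?Z" using Z sets_P[OF x] by simp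
  finally show ?thesis .
qed

text \<open>\<open>1 - exp (- X)\<close> behaves like a bounded supermartingale: on positive states
  because \<open>u t 1 \<le> 1\<close>, on the state 0 because it is absorbing.\<close>

lemma small_stays_small:
  assumes x: "x > 0" and s: "s \<ge> 0" and t: "t \<ge> 0" and B: "B \<in> sets (F s)"
    and e: "e > 0" and small: "\<And>\<omega>. \<omega> \<in> B \<Longrightarrow> X s \<omega> < e"
  shows "(\<integral>\<^sup>+\<omega>. ennreal (1 - exp (- X (s + t) \<omega>)) * indicator B \<omega> \<partial>P x) \<le> ennreal (1 - exp (- e)) * emeasure (P x) B"
proof -
  interpret prob_space "P x" by (rule prob_space_P[OF x])
  let ?Z = "{\<omega> \<in> space M. X s \<omega> = 0}" and ?C = "{\<omega> \<in> space M. X s \<omega> > 0}"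
  have BM: "B \<in> sets M" by (rule sets_filtration_M[OF B])
  have [measurable]: "X s \<in> borel_measurable M" by (rule measurable_X[OF s])
  have sets: "B \<inter> ?C \<in> sets M" "?Z \<in> sets M" "B \<inter> ?Z \<in> sets M" "?Z - B \<in> sets M" using BM by measurable
  have st: "s + t \<ge> 0" using s t by simp
  have F: "B \<inter> ?C \<in> sets (F s)"
  proof -
    have [measurable]: "X s \<in> borel_measurable (F s)" by (rule measurable_X_F[OF s order_refl])
    have "B \<inter> {\<omega> \<in> space (F s). X s \<omega> > 0} \<in> sets (F s)" using B by measurable
    then show ?thesis by (simp add: space_F)
  qed
  note int = integrable_indicator_exp_X[OF x st, of 1, simplified]
  have "exp (- e) * measure (P x) (B \<inter> ?C) = (\<integral>\<omega>. indicator (B \<inter> ?C) \<omega> * exp (- e) \<partial>P x)"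
    using sets sets_P[OF x] by simp
  also have "\<dots> \<le> (\<integral>\<omega>. indicator (B \<inter> ?C) \<omega> * exp (- u t 1 * X s \<omega>) \<partial>P x)"
  proof (rule integral_mono)
    show "integrable (P x) (\<lambda>\<omega>. indicator (B \<inter> ?C) \<omega> * exp (- e))"
      using sets sets_P[OF x] by (intro integrable_mult_left integrable_real_indicator) (auto simp: emeasure_eq_measure)
    show "integrable (P x) (\<lambda>\<omega>. indicator (B \<inter> ?C) \<omega> * exp (- u t 1 * X s \<omega>))"
      using sets u_pos[of 1 t] t by (intro integrable_indicator_exp_X x s) auto
    fix \<omega> assume \<omega>: "\<omega> \<in> space (P x)"
    have "u t 1 * X s \<omega> \<le> 1 * e" if "\<omega> \<in> B \<inter> ?C"
      using that small[of \<omega>] u_le[of 1 t] u_pos[of 1 t] t by (intro mult_mono) auto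
    then show "indicator (B \<inter> ?C) \<omega> * exp (- e) \<le> indicator (B \<inter> ?C) \<omega> * exp (- u t 1 * X s \<omega>)"
      by (auto split: split_indicator)
  qed
  also have "\<dots> = (\<integral>\<omega>. indicator (B \<inter> ?C) \<omega> * exp (- X (s + t) \<omega>) \<partial>P x)"
    using markov_laplace[OF x s t zero_less_one F] by simp
  finally have C_bound: "exp (- e) * measure (P x) (B \<inter> ?C) \<le> (\<integral>\<omega>. indicator (B \<inter> ?C) \<omega> * exp (- X (s + t) \<omega>) \<partial>P x)" .
  \<comment> \<open>Absorption is available for the whole of \<open>?Z\<close>. As the exponential
    is at most 1 on \<open>?Z - B\<close>, removing that part leaves at least the full measure of
    \<open>B \<inter> ?Z\<close>.\<close>
  have "(\<integral>\<omega>. indicator (?Z - B) \<omega> * exp (- X (s + t) \<omega>) \<partial>P x) \<le> (\<integral>\<omega>. indicator (?Z - B) \<omega> \<partial>P x)"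
  proof (rule integral_mono)
    show "integrable (P x) (indicator (?Z - B) :: 'a \<Rightarrow> real)"
      using sets sets_P[OF x] by (intro integrable_real_indicator) (auto simp: emeasure_eq_measure)
    fix \<omega> assume "\<omega> \<in> space (P x)"
    then show "indicator (?Z - B) \<omega> * exp (- X (s + t) \<omega>) \<le> indicator (?Z - B) \<omega>"
      using nonneg_X[OF st, of \<omega>] by (auto simp: space_P[OF x] split: split_indicator)
  qed (rule int[OF sets(4)])
  also have "\<dots> = measure (P x) (?Z - B)" using sets sets_P[OF x] by simp
  finally have Z_minus: "(\<integral>\<omega>. indicator (?Z - B) \<omega> * exp (- X (s + t) \<omega>) \<partial>P x) \<le> measure (P x) (?Z - B)" .
  have "measure (P x) ?Z = (\<integral>\<omega>. indicator ?Z \<omega> * exp (- X (s + t) \<omega>) \<partial>P x)"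
    using zero_absorbing[OF x s t zero_less_one] by simp
  also have "\<dots> = (\<integral>\<omega>. indicator (B \<inter> ?Z) \<omega> * exp (- X (s + t) \<omega>) + indicator (?Z - B) \<omega> * exp (- X (s + t) \<omega>) \<partial>P x)"
    by (intro Bochner_Integration.integral_cong) (auto split: split_indicator)
  also have "\<dots> = (\<integral>\<omega>. indicator (B \<inter> ?Z) \<omega> * exp (- X (s + t) \<omega>) \<partial>P x) +
      (\<integral>\<omega>. indicator (?Z - B) \<omega> * exp (- X (s + t) \<omega>) \<partial>P x)"
    by (intro Bochner_Integration.integral_add int sets)
  also have "measure (P x) ?Z = measure (P x) (B \<inter> ?Z) + measure (P x) (?Z - B)"
    using sets sets_P[OF x] finite_measure_Union[of "B \<inter> ?Z" "?Z - B"]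
    by (simp add: Int_Un_distrib2 Un_Diff_cancel2 Diff_disjoint flip: Un_assoc)
      (metis (no_types, lifting) Diff_disjoint Int_Diff_disjoint Int_Diff_Un inf_commute)
  finally have Z_bound: "measure (P x) (B \<inter> ?Z) \<le> (\<integral>\<omega>. indicator (B \<inter> ?Z) \<omega> * exp (- X (s + t) \<omega>) \<partial>P x)"
    using Z_minus by simp
  have meas_B: "measure (P x) B = measure (P x) (B \<inter> ?Z) + measure (P x) (B \<inter> ?C)"
  proof -
    have "B = (B \<inter> ?Z) \<union> (B \<inter> ?C)"
      using nonneg_X[OF s] sets.sets_into_space[OF BM] by force
    then have "measure (P x) B = measure (P x) ((B \<inter> ?Z) \<union> (B \<inter> ?C))" by simp
    also have "\<dots> = measure (P x) (B \<inter> ?Z) + measure (P x) (B \<inter> ?C)"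
      using sets sets_P[OF x] by (intro finite_measure_Union) auto
    finally show ?thesis .
  qed
  have "(\<integral>\<omega>. indicator B \<omega> * exp (- X (s + t) \<omega>) \<partial>P x) =
      (\<integral>\<omega>. indicator (B \<inter> ?Z) \<omega> * exp (- X (s + t) \<omega>) + indicator (B \<inter> ?C) \<omega> * exp (- X (s + t) \<omega>) \<partial>P x)"
  proof (rule Bochner_Integration.integral_cong)
    fix \<omega> assume "\<omega> \<in> space (P x)"
    then show "indicator B \<omega> * exp (- X (s + t) \<omega>) =
        indicator (B \<inter> ?Z) \<omega> * exp (- X (s + t) \<omega>) + indicator (B \<inter> ?C) \<omega> * exp (- X (s + t) \<omega>)"
      using nonneg_X[OF s, of \<omega>] by (cases "X s \<omega> = 0") (auto simp: space_P[OF x] split: split_indicator)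
  qed simp
  also have "\<dots> = (\<integral>\<omega>. indicator (B \<inter> ?Z) \<omega> * exp (- X (s + t) \<omega>) \<partial>P x) +
      (\<integral>\<omega>. indicator (B \<inter> ?C) \<omega> * exp (- X (s + t) \<omega>) \<partial>P x)"
    by (intro Bochner_Integration.integral_add int sets)
  also have "\<dots> \<ge> exp (- e) * measure (P x) (B \<inter> ?Z) + exp (- e) * measure (P x) (B \<inter> ?C)"
  proof (rule add_mono[OF _ C_bound])
    have "exp (- e) * measure (P x) (B \<inter> ?Z) \<le> 1 * measure (P x) (B \<inter> ?Z)"
      using e by (intro mult_right_mono) auto
    then show "exp (- e) * measure (P x) (B \<inter> ?Z) \<le> (\<integral>\<omega>. indicator (B \<inter> ?Z) \<omega> * exp (- X (s + t) \<omega>) \<partial>P x)"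
      using Z_bound by simp
  qed
  finally have main: "exp (- e) * measure (P x) B \<le> (\<integral>\<omega>. indicator B \<omega> * exp (- X (s + t) \<omega>) \<partial>P x)"
    by (simp add: meas_B distrib_left)
  have int_B: "integrable (P x) (\<lambda>\<omega>. indicator B \<omega> :: real)"
    using BM sets_P[OF x] by (intro integrable_real_indicator) (auto simp: emeasure_eq_measure)
  have "(\<integral>\<^sup>+\<omega>. ennreal (1 - exp (- X (s + t) \<omega>)) * indicator B \<omega> \<partial>P x) =
      (\<integral>\<^sup>+\<omega>. ennreal (indicator B \<omega> - indicator B \<omega> * exp (- X (s + t) \<omega>)) \<partial>P x)"
    by (intro nn_integral_cong) (auto split: split_indicator)
  also have "\<dots> = ennreal (\<integral>\<omega>. indicator B \<omega> - indicator B \<omega> * exp (- X (s + t) \<omega>) \<partial>P x)"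
  proof (rule nn_integral_eq_integral)
    show "AE \<omega> in P x. 0 \<le> indicator B \<omega> - indicator B \<omega> * exp (- X (s + t) \<omega>)"
      using nonneg_X[OF st] by (intro AE_I2) (auto simp: space_P[OF x] split: split_indicator)
  qed (intro Bochner_Integration.integrable_diff int_B int BM)
  also have "(\<integral>\<omega>. indicator B \<omega> - indicator B \<omega> * exp (- X (s + t) \<omega>) \<partial>P x) =
      measure (P x) B - (\<integral>\<omega>. indicator B \<omega> * exp (- X (s + t) \<omega>) \<partial>P x)"
    using BM sets_P[OF x] by (subst Bochner_Integration.integral_diff[OF int_B int[OF BM]]) simp
  also have "\<dots> \<le> (1 - exp (- e)) * measure (P x) B" using main by (simp add: left_diff_distrib)
  finally show ?thesis using e by (simp add: emeasure_eq_measure ennreal_mult ennreal_leI)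
qed

end

context elastic_cb_process begin

text \<open>As for a maximal inequality, the event is decomposed by the first grid time at which the
  path is below \<open>e\<close>, and the previous estimate is applied on each disjoint piece. The
  bound is independent of \<open>n\<close>, which permits refining the grid.\<close>

lemma dyadic_hit_bound:
  assumes x: "x > 0" and t: "t > 0" and e: "e > 0"
  shows "emeasure (density (P x) (\<lambda>\<omega>. ennreal (1 - exp (- X t \<omega>))))
    {\<omega> \<in> space M. \<exists>k<2 ^ n. X (t * real k / 2 ^ n) \<omega> < e} \<le> ennreal (1 - exp (- e))"
proof -
  interpret prob_space "P x" by (rule prob_space_P[OF x])
  let ?D = "density (P x) (\<lambda>\<omega>. ennreal (1 - exp (- X t \<omega>)))"
  define r where "r k = t * real k / 2 ^ n" for k :: nat
  define B where "B k = {\<omega> \<in> space M. X (r k) \<omega> < e \<and> (\<forall>j<k. X (r j) \<omega> \<ge> e)}" for k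
  have r: "0 \<le> r k" "j \<le> k \<Longrightarrow> r j \<le> r k" "k < 2 ^ n \<Longrightarrow> r k \<le> t" for j k
  proof -
    show "0 \<le> r k" "j \<le> k \<Longrightarrow> r j \<le> r k" using t by (simp_all add: r_def divide_right_mono)
    assume "k < 2 ^ n"
    then have "real k \<le> 2 ^ n" by (metis less_imp_le of_nat_le_iff of_nat_numeral of_nat_power)
    then show "r k \<le> t" using t by (simp add: r_def divide_le_eq)
  qed
  have B_F: "B k \<in> sets (F (r k))" for k
  proof -
    have lt: "{\<omega> \<in> space (F (r k)). X (r j) \<omega> < e} \<in> sets (F (r k))" if "j \<le> k" for j
    proof -
      have [measurable]: "X (r j) \<in> borel_measurable (F (r k))"
        by (rule measurable_X_F) (use r that in auto)
      show ?thesis by measurable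
    qed
    have "{\<omega> \<in> space (F (r k)). X (r k) \<omega> < e} -
        (\<Union>j\<in>{..<k}. {\<omega> \<in> space (F (r k)). X (r j) \<omega> < e}) \<in> sets (F (r k))"
      by (intro sets.Diff sets.finite_UN lt) auto
    also have "{\<omega> \<in> space (F (r k)). X (r k) \<omega> < e} -
        (\<Union>j\<in>{..<k}. {\<omega> \<in> space (F (r k)). X (r j) \<omega> < e}) = B k"
      by (auto simp: B_def space_F not_less)
    finally show ?thesis .
  qed
  then have B_M: "B k \<in> sets M" for k by (rule sets_filtration_M)
  have B_bound: "emeasure ?D (B k) \<le> ennreal (1 - exp (- e)) * emeasure (P x) (B k)" if k: "k < 2 ^ n" for k
  proof -
    have "emeasure ?D (B k) = (\<integral>\<^sup>+\<omega>. ennreal (1 - exp (- X t \<omega>)) * indicator (B k) \<omega> \<partial>P x)"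
      using B_M sets_P[OF x] measurable_X_P[OF x less_imp_le[OF t]] by (intro emeasure_density) auto
    also have "\<dots> \<le> ennreal (1 - exp (- e)) * emeasure (P x) (B k)"
      using small_stays_small[OF x r(1) _ B_F e, of "t - r k" k] r(3)[OF k] by (simp add: B_def)
    finally show ?thesis .
  qed
  have disj: "disjoint_family_on B {..<2 ^ n}"
    unfolding disjoint_family_on_def B_def by (auto simp: not_less[symmetric]) (metis linorder_neqE_nat)
  have "{\<omega> \<in> space M. \<exists>k<2 ^ n. X (t * real k / 2 ^ n) \<omega> < e} = (\<Union>k<2 ^ n. B k)"
  proof safe
    fix \<omega> k assume \<omega>: "\<omega> \<in> space M" "k < (2::nat) ^ n" "X (t * real k / 2 ^ n) \<omega> < e"
    define m where "m = (LEAST m. X (r m) \<omega> < e)"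
    have "X (r k) \<omega> < e" using \<omega> by (simp add: r_def)
    then have m: "X (r m) \<omega> < e" "m \<le> k"
      unfolding m_def by (rule LeastI, rule Least_le)
    have "\<not> X (r j) \<omega> < e" if "j < m" for j
      using that unfolding m_def by (rule not_less_Least)
    then have "\<omega> \<in> B m" using m \<omega> by (simp add: B_def not_less)
    then show "\<omega> \<in> (\<Union>k<2 ^ n. B k)" using m \<omega> by (intro UN_I[of m]) auto
  qed (auto simp: B_def r_def)
  also have "emeasure ?D \<dots> \<le> (\<Sum>k<2 ^ n. emeasure ?D (B k))"
    using B_M sets_P[OF x] by (intro emeasure_subadditive_finite) auto
  also have "\<dots> \<le> (\<Sum>k<2 ^ n. ennreal (1 - exp (- e)) * emeasure (P x) (B k))"
    by (intro sum_mono B_bound) simp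
  also have "\<dots> = ennreal (1 - exp (- e)) * emeasure (P x) (\<Union>k<2 ^ n. B k)"
    using B_M sets_P[OF x] disj by (subst sum_distrib_left[symmetric], subst sum_emeasure) auto
  also have "\<dots> \<le> ennreal (1 - exp (- e)) * 1" by (intro mult_left_mono emeasure_le_1) simp
  finally show ?thesis by simp
qed

lemma hits_zero_dyadic_small:
  assumes \<omega>: "\<omega> \<in> space M" and s: "0 \<le> s" "s < t" and zero: "X s \<omega> = 0" and e: "e > 0"
  shows "\<exists>n k. k < 2 ^ n \<and> X (t * real k / 2 ^ n) \<omega> < e"
proof -
  have "((\<lambda>r. X r \<omega>) \<longlongrightarrow> 0) (at_right s)"
    using cadlag_X[OF \<omega>] s zero unfolding cadlag_def by metis
  from order_tendstoD(2)[OF this e] obtain b where b: "b > s" "\<And>r. s < r \<Longrightarrow> r < b \<Longrightarrow> X r \<omega> < e"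
    by (auto simp: eventually_at_right_field)
  have t: "t > 0" using s by simp
  define d where "d = min b t - s"
  have d: "d > 0" using b s by (simp add: d_def)
  obtain n where "t / d < 2 ^ n" using real_arch_pow[of 2] by auto
  then have "t / 2 ^ n < d" using d by (simp add: field_simps)
  then have gap: "t / 2 ^ n < min b t - s" by (simp add: d_def)
  \<comment> \<open>The added 1 puts the grid point strictly to the right of \<open>s\<close>, where
    right-continuity applies, and by at most one mesh width \<open>t / 2 ^ n\<close>, which keeps it
    below both \<open>b\<close> and \<open>t\<close>.\<close>
  define k where "k = nat \<lfloor>s * 2 ^ n / t\<rfloor> + 1"
  have "0 \<le> s * 2 ^ n / t" using s t by simp
  then have k: "s * 2 ^ n / t < real k" "real k \<le> s * 2 ^ n / t + 1" unfolding k_def by linarith+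
  have lower: "s < t * real k / 2 ^ n" using k(1) t by (simp add: field_simps)
  have "t * real k \<le> t * (s * 2 ^ n / t + 1)" using k(2) t by (intro mult_left_mono) auto
  then have "t * real k / 2 ^ n \<le> (t * (s * 2 ^ n / t + 1)) / 2 ^ n" by (intro divide_right_mono) auto
  also have "\<dots> = s + t / 2 ^ n" using t by (simp add: distrib_left add_divide_distrib)
  finally have upper: "t * real k / 2 ^ n < min b t" using gap by linarith
  have "real k < 2 ^ n" using upper t by (simp add: divide_less_eq)
  then have "k < 2 ^ n" by (metis of_nat_less_iff of_nat_numeral of_nat_power)
  moreover have "X (t * real k / 2 ^ n) \<omega> < e" using b(2) lower upper by simp
  ultimately show ?thesis by blast
qed

text \<open>The first zero need not be a stopping time, so the Markov property is only used at dyadic times: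
  by right-continuity, a path that vanishes somewhere in \<open>[0, t)\<close> is arbitrarily small at some of them.\<close>

lemma zero_after_hitting:
  assumes x: "x > 0" and t: "t > 0"
  shows "AE \<omega> in P x. (\<exists>s. 0 \<le> s \<and> s < t \<and> X s \<omega> = 0) \<longrightarrow> X t \<omega> = 0"
proof -
  let ?D = "density (P x) (\<lambda>\<omega>. ennreal (1 - exp (- X t \<omega>)))"
  define G where "G e n = {\<omega> \<in> space M. \<exists>k<2 ^ n. X (t * real k / 2 ^ n) \<omega> < e}" for e :: real and n :: nat
  have meas [measurable]: "X (t * real k / 2 ^ n) \<in> borel_measurable M" for k n :: nat
    using t by (intro measurable_X) simp
  have "{\<omega> \<in> space M. \<exists>k\<in>{..<2 ^ n}. X (t * real k / 2 ^ n) \<omega> < e} \<in> sets M" for e n by measurable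
  then have G_M [measurable]: "G e n \<in> sets M" for e n by (simp add: G_def Bex_def)
  have bound: "emeasure ?D (\<Union>n. G e n) \<le> ennreal (1 - exp (- e))" if e: "e > 0" for e
  proof -
    have inc: "incseq (G e)"
    proof (rule incseq_SucI, safe)
      fix n \<omega> assume "\<omega> \<in> G e n"
      then obtain k where k: "\<omega> \<in> space M" "k < 2 ^ n" "X (t * real k / 2 ^ n) \<omega> < e" by (auto simp: G_def)
      moreover have "t * real (2 * k) / 2 ^ Suc n = t * real k / 2 ^ n" by simp
      moreover have "2 * k < 2 ^ Suc n" using k by simp
      ultimately show "\<omega> \<in> G e (Suc n)" unfolding G_def
        by (intro CollectI conjI exI[of _ "2 * k"]) simp_all
    qed
    have "emeasure ?D (\<Union>n. G e n) = (SUP n. emeasure ?D (G e n))"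
    proof (rule SUP_emeasure_incseq[symmetric, OF _ inc])
      show "range (G e) \<subseteq> sets ?D" using G_M by (simp add: image_subset_iff sets_P[OF x])
    qed
    also have "\<dots> \<le> ennreal (1 - exp (- e))"
    proof (rule SUP_least)
      show "emeasure ?D (G e n) \<le> ennreal (1 - exp (- e))" for n
        unfolding G_def by (rule dyadic_hit_bound[OF x t e])
    qed
    finally show ?thesis .
  qed
  \<comment> \<open>Paths that come arbitrarily close to 0 at grid times before \<open>t\<close>.
    The mass of \<open>N\<close> weighted by \<open>1 - exp (- X t)\<close> is at most
    \<open>1 - exp (- (1 / real (Suc m)))\<close> for every \<open>m\<close>, hence 0, so
    \<open>X t\<close> vanishes almost everywhere on \<open>N\<close>.\<close>
  define N where "N = (\<Inter>m. \<Union>n. G (1 / real (Suc m)) n)"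
  have N_M: "N \<in> sets (P x)" unfolding N_def sets_P[OF x] by measurable
  have "emeasure ?D N = 0"
  proof -
    have "emeasure ?D N \<le> ennreal (1 - exp (- (1 / real (Suc m))))" for m
    proof -
      have "emeasure ?D N \<le> emeasure ?D (\<Union>n. G (1 / real (Suc m)) n)"
        using G_M sets_P[OF x] by (intro emeasure_mono) (auto simp: N_def)
      also have "\<dots> \<le> ennreal (1 - exp (- (1 / real (Suc m))))" by (rule bound) simp
      finally show ?thesis .
    qed
    moreover have "(\<lambda>m. ennreal (1 - exp (- (1 / real (Suc m))))) \<longlonglongrightarrow> ennreal 0"
      by (intro tendsto_ennrealI) real_asymp
    ultimately have "emeasure ?D N \<le> ennreal 0" by (intro LIMSEQ_le_const) auto
    then show ?thesis by simp
  qed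
  then have "(\<integral>\<^sup>+\<omega>. ennreal (1 - exp (- X t \<omega>)) * indicator N \<omega> \<partial>P x) = 0"
    using N_M measurable_X_P[OF x less_imp_le[OF t]] by (simp add: emeasure_density)
  then have "AE \<omega> in P x. ennreal (1 - exp (- X t \<omega>)) * indicator N \<omega> = 0"
    using N_M measurable_X_P[OF x less_imp_le[OF t]] by (subst (asm) nn_integral_0_iff_AE) auto
  with AE_space show ?thesis
  proof eventually_elim
    case (elim \<omega>)
    then have \<omega>: "\<omega> \<in> space M" by (simp add: space_P[OF x])
    show ?case
    proof safe
      fix s assume s: "0 \<le> s" "s < t" "X s \<omega> = 0"
      have "\<omega> \<in> N"
        using hits_zero_dyadic_small[OF \<omega> s] \<omega> by (simp add: N_def G_def)
      then have "X t \<omega> \<le> 0" using elim by (simp add: ennreal_eq_0_iff)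
      then show "X t \<omega> = 0" using nonneg_X[of t \<omega>] \<omega> t by simp
    qed
  qed
qed

section \<open>The survival event and the conditional law\<close>

lemma survival_iff:
  assumes x: "x > 0" and t: "t > 0"
  shows "AE \<omega> in P x. extinction_time X \<omega> > ennreal t \<longleftrightarrow> X t \<omega> > 0"
  using zero_after_hitting[OF x t] AE_space
proof eventually_elim
  case (elim \<omega>)
  then have \<omega>: "\<omega> \<in> space M" by (simp add: space_P[OF x])
  show ?case
  proof
    assume *: "extinction_time X \<omega> > ennreal t"
    have "X t \<omega> \<noteq> 0"
    proof
      assume "X t \<omega> = 0"
      then have "extinction_time X \<omega> \<le> ennreal t"
        unfolding extinction_time_def using t by (intro Inf_lower) auto
      then show False using * by simp
    qed
    then show "X t \<omega> > 0" using nonneg_X[of t \<omega>] \<omega> t by simp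
  next
    assume Xt: "X t \<omega> > 0"
    \<comment> \<open>Absence of zeros up to \<open>t\<close> alone would only give a weak
      inequality for the infimum; right-continuity adds a zero-free interval after \<open>t\<close>
      and makes it strict.\<close>
    have "((\<lambda>r. X r \<omega>) \<longlongrightarrow> X t \<omega>) (at_right t)"
      using cadlag_X[OF \<omega>] t unfolding cadlag_def by simp
    from order_tendstoD(1)[OF this Xt] obtain b where b: "b > t" "\<And>r. t < r \<Longrightarrow> r < b \<Longrightarrow> X r \<omega> > 0"
      by (auto simp: eventually_at_right_field)
    have "ennreal b \<le> extinction_time X \<omega>"
      unfolding extinction_time_def
    proof (rule Inf_greatest, safe)
      fix r assume r: "0 \<le> r" "X r \<omega> = 0"
      then have "r \<noteq> t" "\<not> r < t" using Xt elim(1) by auto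
      then have "b \<le> r" using b(2)[of r] r by force
      then show "ennreal b \<le> ennreal r" by (rule ennreal_leI)
    qed
    moreover have "ennreal t < ennreal b" using t b(1) by (simp add: ennreal_less_iff)
    ultimately show "extinction_time X \<omega> > ennreal t" by (rule less_le_trans[rotated])
  qed
qed

lemma positive_prob:
  assumes x: "x > 0" and t: "t > 0"
  shows "measure (P x) {\<omega> \<in> space M. X t \<omega> > 0} = 1 - exp (- x * v t)"
proof -
  interpret prob_space "P x" by (rule prob_space_P[OF x])
  have [measurable]: "X t \<in> borel_measurable M" using t by (intro measurable_X) simp
  have Z: "{\<omega> \<in> space M. X t \<omega> = 0} \<in> events" unfolding sets_P[OF x] by measurable
  have "{\<omega> \<in> space M. X t \<omega> > 0} = space (P x) - {\<omega> \<in> space M. X t \<omega> = 0}"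
    using nonneg_X[of t] t by (force simp: space_P[OF x])
  then show ?thesis using prob_compl[OF Z] zero_prob[OF x t] by simp
qed

lemma survival_prob_eq:
  assumes "t > 0" shows "survival_prob P X t = 1 - exp (- v t)"
proof -
  have [measurable]: "X t \<in> borel_measurable M" using assms by (intro measurable_X) simp
  have "survival_prob P X t = measure (P 1) {\<omega> \<in> space (P 1). X t \<omega> > 0}"
    unfolding survival_prob_def
    by (rule measure_completion_AE_cong[OF survival_iff]) (use assms in \<open>simp_all add: space_P sets_P\<close>)
  then show ?thesis using positive_prob[of 1 t] assms by (simp add: space_P)
qed

text \<open>Conditioning on \<open>X t \<omega> > 0\<close> instead of on survival uses an event of
  \<open>P x\<close> itself, without completion, so this is a Borel law to which weak convergence
  theorems apply.\<close>

definition cond_law :: "real \<Rightarrow> real \<Rightarrow> real \<Rightarrow> real measure" where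
  "cond_law x t q = distr (uniform_measure (P x) {\<omega> \<in> space M. X t \<omega> > 0}) borel (\<lambda>\<omega>. q * X t \<omega>)"

lemma
  assumes x: "x > 0" and t: "t > 0"
  shows real_distribution_cond_law: "real_distribution (cond_law x t q)"
    and cdf_cond_law: "\<P>(\<omega> in completion (P x). q * X t \<omega> \<le> y \<bar> extinction_time X \<omega> > ennreal t) = cdf (cond_law x t q) y"
proof -
  interpret prob_space "P x" by (rule prob_space_P[OF x])
  let ?S = "{\<omega> \<in> space M. X t \<omega> > 0}"
  have XM [measurable]: "X t \<in> borel_measurable M" using t by (intro measurable_X) simp
  have XP [measurable]: "X t \<in> borel_measurable (P x)" using t by (intro measurable_X_P x) simp
  have S: "?S \<in> events" unfolding sets_P[OF x] by measurable
  have S_pos: "measure (P x) ?S > 0" using positive_prob[OF x t] x v_pos[OF t] by simp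
  interpret U: prob_space "uniform_measure (P x) ?S"
    using S_pos by (intro prob_space_uniform_measure) (auto simp: emeasure_eq_measure)
  show "real_distribution (cond_law x t q)" unfolding cond_law_def by simp
  have A: "{\<omega> \<in> space M. q * X t \<omega> \<le> y} \<in> events" unfolding sets_P[OF x] by measurable
  have "cdf (cond_law x t q) y = measure (uniform_measure (P x) ?S) {\<omega> \<in> space M. q * X t \<omega> \<le> y}"
    unfolding cdf_def cond_law_def by (subst measure_distr) (auto simp: space_P[OF x] intro!: arg_cong[where f=U.prob])
  also have "\<dots> = measure (P x) (?S \<inter> {\<omega> \<in> space M. q * X t \<omega> \<le> y}) / measure (P x) ?S"
    using S A S_pos by (subst measure_uniform_measure) (auto simp: emeasure_eq_measure)
  also have "measure (P x) (?S \<inter> {\<omega> \<in> space M. q * X t \<omega> \<le> y}) =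
      measure (P x) {\<omega> \<in> space (P x). q * X t \<omega> \<le> y \<and> X t \<omega> > 0}"
    by (rule arg_cong[where f=prob]) (auto simp: space_P[OF x])
  also have "\<dots> = measure (completion (P x)) {\<omega> \<in> space (completion (P x)). q * X t \<omega> \<le> y \<and> extinction_time X \<omega> > ennreal t}"
    by (rule measure_completion_AE_cong[symmetric]) (use survival_iff[OF x t] in \<open>auto elim: eventually_mono\<close>)
  also have "measure (P x) ?S = measure (completion (P x)) {\<omega> \<in> space (completion (P x)). extinction_time X \<omega> > ennreal t}"
    using measure_completion_AE_cong[OF survival_iff[OF x t]] S by (simp add: space_P[OF x])
  finally show "\<P>(\<omega> in completion (P x). q * X t \<omega> \<le> y \<bar> extinction_time X \<omega> > ennreal t) = cdf (cond_law x t q) y"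
    by (simp add: cond_prob_def)
qed

text \<open>\<open>max 0 y\<close> extends \<open>exp (- \<theta> * y)\<close> to a bounded
  continuous function on the whole line, as a test function for weak convergence must be, and
  changes nothing on the non-negative values that the law charges.\<close>

lemma laplace_cond_law:
  assumes x: "x > 0" and t: "t > 0" and q: "q > 0" and \<theta>: "\<theta> > 0"
  shows "(\<integral>y. exp (- \<theta> * max 0 y) \<partial>cond_law x t q) = 1 - (1 - exp (- x * u t (\<theta> * q))) / (1 - exp (- x * v t))"
proof -
  interpret prob_space "P x" by (rule prob_space_P[OF x])
  let ?S = "{\<omega> \<in> space M. X t \<omega> > 0}" and ?Z = "{\<omega> \<in> space M. X t \<omega> = 0}"
  have XM [measurable]: "X t \<in> borel_measurable M" using t by (intro measurable_X) simp
  have XP [measurable]: "X t \<in> borel_measurable (P x)" using t by (intro measurable_X_P x) simp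
  have S [measurable]: "?S \<in> events" and Z [measurable]: "?Z \<in> events" unfolding sets_P[OF x] by measurable
  have S_prob: "measure (P x) ?S = 1 - exp (- x * v t)" by (rule positive_prob[OF x t])
  have S_pos: "measure (P x) ?S > 0" using S_prob x v_pos[OF t] by simp
  have inv: "1 / ennreal (measure (P x) ?S) = ennreal (1 / measure (P x) ?S)"
    using divide_ennreal[of 1] S_pos by simp
  have "(\<integral>y. exp (- \<theta> * max 0 y) \<partial>cond_law x t q) = (\<integral>\<omega>. exp (- \<theta> * max 0 (q * X t \<omega>)) \<partial>uniform_measure (P x) ?S)"
    unfolding cond_law_def by (rule integral_distr) measurable
  also have "uniform_measure (P x) ?S = density (P x) (\<lambda>\<omega>. ennreal (indicator ?S \<omega> / measure (P x) ?S))"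
    unfolding uniform_measure_def using S_pos
    by (intro density_cong) (auto simp: emeasure_eq_measure inv split: split_indicator)
  also have "(\<integral>\<omega>. exp (- \<theta> * max 0 (q * X t \<omega>)) \<partial>\<dots>) =
      (\<integral>\<omega>. (indicator ?S \<omega> / measure (P x) ?S) *\<^sub>R exp (- \<theta> * max 0 (q * X t \<omega>)) \<partial>P x)"
    using S_pos by (intro integral_density) auto
  \<comment> \<open>Restricting the exponential to \<open>X t > 0\<close> amounts to subtracting the
    indicator of \<open>X t = 0\<close>, where the exponential is 1; both expectations are
    known.\<close>
  also have "\<dots> = (\<integral>\<omega>. (exp (- (\<theta> * q) * X t \<omega>) - indicator ?Z \<omega>) / measure (P x) ?S \<partial>P x)"
  proof (rule Bochner_Integration.integral_cong)
    fix \<omega> assume "\<omega> \<in> space (P x)"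
    then have "X t \<omega> \<ge> 0" "\<omega> \<in> space M" using nonneg_X[of t \<omega>] t by (simp_all add: space_P[OF x])
    then show "(indicator ?S \<omega> / measure (P x) ?S) *\<^sub>R exp (- \<theta> * max 0 (q * X t \<omega>)) =
        (exp (- (\<theta> * q) * X t \<omega>) - indicator ?Z \<omega>) / measure (P x) ?S"
      using q by (cases "X t \<omega> = 0") (simp_all add: mult.assoc)
  qed simp
  also have "\<dots> = (\<integral>\<omega>. exp (- (\<theta> * q) * X t \<omega>) - indicator ?Z \<omega> \<partial>P x) / measure (P x) ?S" by simp
  also have "(\<integral>\<omega>. exp (- (\<theta> * q) * X t \<omega>) - indicator ?Z \<omega> \<partial>P x) =
      (\<integral>\<omega>. exp (- (\<theta> * q) * X t \<omega>) \<partial>P x) - (\<integral>\<omega>. indicator ?Z \<omega> \<partial>P x)"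
    using \<theta> q t by (intro Bochner_Integration.integral_diff integrable_exp_X x integrable_real_indicator)
      (auto simp: emeasure_eq_measure)
  also have "(\<integral>\<omega>. indicator ?Z \<omega> \<partial>P x) = exp (- x * v t)" using zero_prob[OF x t] by simp
  also have "(\<integral>\<omega>. exp (- (\<theta> * q) * X t \<omega>) \<partial>P x) = exp (- x * u t (\<theta> * q))"
    using t \<theta> q by (intro laplace_u x) auto
  also have "(exp (- x * u t (\<theta> * q)) - exp (- x * v t)) / measure (P x) ?S =
      1 - (1 - exp (- x * u t (\<theta> * q))) / (1 - exp (- x * v t))"
  proof -
    have "(a - c) / (1 - c) = 1 - (1 - a) / (1 - c)" if "1 - c > 0" for a c :: real
      using that by (simp add: field_simps)
    then show ?thesis unfolding S_prob using S_pos[unfolded S_prob] by blast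
  qed
  finally show ?thesis .
qed

end

section \<open>Laplace transforms of the limit law\<close>

text \<open>The integrands are ordered pointwise, so equal integrals would force
  \<open>\<theta> * y = \<theta>' * y\<close>, hence \<open>y = 0\<close>, almost everywhere.
  Strictness yields both \<open>h \<theta> < 1\<close> and the strict monotonicity that excludes
  index 0.\<close>

lemma laplace_transform_less:
  assumes \<mu>: "real_distribution \<mu>" and nonneg: "AE y in \<mu>. 0 \<le> y" and nondegenerate: "\<mu> \<noteq> return borel 0"
    and \<theta>: "0 \<le> \<theta>" "\<theta> < \<theta>'"
  shows "(\<integral>y. exp (- \<theta>' * max 0 y) \<partial>\<mu>) < (\<integral>y. exp (- \<theta> * max 0 y) \<partial>\<mu>)"
proof -
  interpret real_distribution \<mu> by (rule \<mu>)
  have int: "integrable \<mu> (\<lambda>y. exp (- c * max 0 y))" if "c \<ge> 0" for c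
    using that by (intro integrable_const_bound[of _ 1]) auto
  let ?d = "\<lambda>y. exp (- \<theta> * max 0 y) - exp (- \<theta>' * max 0 y)"
  have le: "0 \<le> ?d y" for y
    using \<theta> mult_right_mono[of \<theta> \<theta>' "max 0 y"] by simp
  have int_d: "integrable \<mu> ?d" using \<theta> by (intro Bochner_Integration.integrable_diff int) auto
  have "(\<integral>y. ?d y \<partial>\<mu>) \<noteq> 0"
  proof
    assume "(\<integral>y. ?d y \<partial>\<mu>) = 0"
    then have "AE y in \<mu>. ?d y = 0"
      using integral_nonneg_eq_0_iff_AE[OF int_d] le by simp
    with nonneg have zero: "AE y in \<mu>. y = 0"
    proof eventually_elim
      case (elim y)
      then have "\<theta> * y = \<theta>' * y" by simp
      then show ?case using \<theta> by simp
    qed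
    have "\<mu> = return borel 0"
    proof (rule measure_eqI)
      fix A assume A: "A \<in> sets \<mu>"
      have "emeasure \<mu> A = (\<integral>\<^sup>+y. indicator A y \<partial>\<mu>)" using A by simp
      also have "\<dots> = (\<integral>\<^sup>+y. indicator A 0 \<partial>\<mu>)"
        by (rule nn_integral_cong_AE) (use zero in eventually_elim, simp)
      also have "\<dots> = indicator A 0" using emeasure_space_1 by simp
      also have "\<dots> = emeasure (return borel 0) A" using A by simp
      finally show "emeasure \<mu> A = emeasure (return borel 0) A" .
    qed simp
    then show False using nondegenerate by simp
  qed
  moreover have "0 \<le> (\<integral>y. ?d y \<partial>\<mu>)" using le by (intro Bochner_Integration.integral_nonneg) auto
  moreover have "(\<integral>y. ?d y \<partial>\<mu>) = (\<integral>y. exp (- \<theta> * max 0 y) \<partial>\<mu>) - (\<integral>y. exp (- \<theta>' * max 0 y) \<partial>\<mu>)"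
    using \<theta> by (intro Bochner_Integration.integral_diff int) auto
  ultimately show ?thesis by linarith
qed

lemma laplace_transform_pos:
  assumes "real_distribution \<mu>" "0 \<le> \<theta>"
  shows "(\<integral>y. exp (- \<theta> * max 0 y) \<partial>\<mu>) > 0"
proof -
  interpret real_distribution \<mu> by (rule assms)
  have int: "integrable \<mu> (\<lambda>y. exp (- \<theta> * max 0 y))"
    using assms by (intro integrable_const_bound[of _ 1]) auto
  have "(\<integral>y. exp (- \<theta> * max 0 y) \<partial>\<mu>) \<noteq> 0"
    using integral_nonneg_eq_0_iff_AE[OF int] by simp
  moreover have "0 \<le> (\<integral>y. exp (- \<theta> * max 0 y) \<partial>\<mu>)" by (intro Bochner_Integration.integral_nonneg) auto
  ultimately show ?thesis by linarith
qed

text \<open>This is how the starting point \<open>x\<close> drops out: both arguments tend to 0,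
  where \<open>1 - exp (- x * z)\<close> is asymptotic to \<open>x * z\<close>.\<close>

lemma ratio_of_one_minus_exp:
  fixes u v :: "'a \<Rightarrow> real"
  assumes x: "x > 0" and v: "filterlim v (at_right 0) F"
    and u: "\<forall>\<^sub>F t in F. 0 < u t \<and> u t \<le> v t"
    and lim: "((\<lambda>t. (1 - exp (- x * u t)) / (1 - exp (- x * v t))) \<longlongrightarrow> \<gamma>) F"
  shows "((\<lambda>t. u t / v t) \<longlongrightarrow> \<gamma>) F"
proof -
  define e where "e z = (1 - exp (- x * z)) / (x * z)" for z
  have v0: "(v \<longlongrightarrow> 0) F" using v by (simp add: filterlim_at)
  have "(u \<longlongrightarrow> 0) F"
    by (rule tendsto_sandwich[OF _ _ tendsto_const v0]) (use u in \<open>auto elim: eventually_mono\<close>)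
  then have u0: "filterlim u (at_right 0) F" using u by (auto simp: filterlim_at elim: eventually_mono)
  have e: "(e \<longlongrightarrow> 1) (at_right 0)" unfolding e_def using x by real_asymp
  have "((\<lambda>t. (1 - exp (- x * u t)) / (1 - exp (- x * v t)) * (e (v t) / e (u t))) \<longlongrightarrow> \<gamma> * (1 / 1)) F"
    by (intro tendsto_mult tendsto_divide lim filterlim_compose[OF e] u0 v) simp
  moreover have "\<forall>\<^sub>F t in F. (1 - exp (- x * u t)) / (1 - exp (- x * v t)) * (e (v t) / e (u t)) = u t / v t"
    using u
  proof eventually_elim
    case (elim t)
    then have "1 - exp (- x * u t) > 0" "1 - exp (- x * v t) > 0" using x by simp_all
    then show ?case unfolding e_def using elim x by simp
  qed
  ultimately have "((\<lambda>t. u t / v t) \<longlongrightarrow> \<gamma> * (1 / 1)) F" by (rule Lim_transform_eventually)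
  then show ?thesis by simp
qed

context elastic_mechanism begin

text \<open>The function is what the factorisation of \<psi> prescribes for \<open>L\<close>.
  Scaling \<open>y\<close> by \<open>k\<close> scales the argument of \<psi> by
  \<open>1 / k\<close>, and the limit \<open>(1 / k) powr (1 + \<alpha>)\<close> cancels against the
  power.\<close>

lemma slowly_varying_factor:
  "slowly_varying (\<lambda>y. \<psi> (1 / y) * y powr (1 + \<alpha>))"
  unfolding slowly_varying_def
proof (intro conjI allI impI)
  have "continuous_on {0<..} \<psi>"
    by (rule DERIV_continuous_on[of _ _ \<psi>']) (simp add: has_field_derivative_at_within deriv)
  then have "continuous_on {0<..} (\<lambda>y. \<psi> (1 / y) * y powr (1 + \<alpha>))"
    by (intro continuous_intros continuous_on_compose2[of "{0<..}" \<psi> _ "\<lambda>y. 1 / y"]) auto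
  then show "(\<lambda>y. \<psi> (1 / y) * y powr (1 + \<alpha>)) \<in> borel_measurable (restrict_space borel {0<..})"
    by (rule borel_measurable_continuous_on_restrict)
  show "\<psi> (1 / y) * y powr (1 + \<alpha>) > 0" if "y > 0" for y using that pos by simp
  fix k :: real assume k: "k > 0"
  have v: "filterlim (\<lambda>y::real. 1 / y) (at_right 0) at_top" by real_asymp
  have "\<forall>\<^sub>F y in at_top. 1 / k = (1 / (k * y)) / (1 / y)"
    using eventually_gt_at_top[of 0] by eventually_elim simp
  then have u: "((\<lambda>y. (1 / (k * y)) / (1 / y)) \<longlongrightarrow> 1 / k) at_top"
    by (rule Lim_transform_eventually[OF tendsto_const])
  have "((\<lambda>y. \<psi> (1 / (k * y)) / \<psi> (1 / y)) \<longlongrightarrow> (1 / k) powr (1 + \<alpha>)) at_top"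
    using k by (intro regular_variation_of_elasticity[OF deriv pos elasticity v u]) auto
  from tendsto_mult_right[OF this, of "k powr (1 + \<alpha>)"]
  have "((\<lambda>y. \<psi> (1 / (k * y)) / \<psi> (1 / y) * k powr (1 + \<alpha>)) \<longlongrightarrow> 1) at_top"
    using k by (simp add: powr_divide)
  moreover have "\<forall>\<^sub>F y in at_top. \<psi> (1 / (k * y)) / \<psi> (1 / y) * k powr (1 + \<alpha>) =
      \<psi> (1 / (k * y)) * (k * y) powr (1 + \<alpha>) / (\<psi> (1 / y) * y powr (1 + \<alpha>))"
    using eventually_gt_at_top[of 0] by eventually_elim (use k in \<open>simp add: powr_mult\<close>)
  ultimately show "((\<lambda>y. \<psi> (1 / (k * y)) * (k * y) powr (1 + \<alpha>) / (\<psi> (1 / y) * y powr (1 + \<alpha>))) \<longlongrightarrow> 1) at_top"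
    by (rule Lim_transform_eventually)
qed

end

theorem theorem3:
  fixes M :: "'a measure" and P :: "real \<Rightarrow> 'a measure" and X :: "real \<Rightarrow> 'a \<Rightarrow> real"
    and \<psi> :: "real \<Rightarrow> real" and \<Lambda> :: "real measure"
    and x :: real and Q :: "real \<Rightarrow> real" and \<mu> :: "real measure"
  assumes mechanism: "branching_mechanism \<psi> \<Lambda>"
    and process: "cb_process M P X \<psi>"
    and nontrivial: "\<exists>\<theta>\<ge>0. \<psi> \<theta> \<noteq> 0"
    and critical: "(deriv \<psi> \<longlongrightarrow> 0) (at_right 0)"
    and grey: "\<exists>\<theta>\<^sub>0>0. set_integrable lborel {\<theta>\<^sub>0..} (\<lambda>\<xi>. 1 / \<psi> \<xi>)"
    and rv: "regularly_varying_measure (density \<Lambda> (\<lambda>x. ennreal (x\<^sup>2)))"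
    and x_pos: "x > 0"
    and Q_pos: "\<And>t. t \<ge> 0 \<Longrightarrow> Q t > 0"
    and Q_lim: "(Q \<longlongrightarrow> 0) at_top"
    and H_distribution: "real_distribution \<mu>"
    and H_nonneg: "measure \<mu> {..<0} = 0"
    and H_nondegenerate: "\<nexists>y. \<mu> = return borel y"
    and weak_limit: "\<And>y. isCont (cdf \<mu>) y \<Longrightarrow>
      ((\<lambda>t. \<P>(\<omega> in completion (P x). Q t * X t \<omega> \<le> y \<bar> extinction_time X \<omega> > ennreal t))
        \<longlongrightarrow> cdf \<mu> y) at_top"
  shows "\<exists>\<alpha>. 0 < \<alpha> \<and> \<alpha> \<le> 1 \<and>
    (\<exists>L. slowly_varying L \<and> (\<forall>\<theta>>0. \<psi> \<theta> = \<theta> powr (1 + \<alpha>) * L (1 / \<theta>))) \<and>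
    (\<exists>c>0. ((\<lambda>t. Q t / survival_prob P X t) \<longlongrightarrow> c) at_top \<and>
      (\<forall>\<theta>>0. (LINT y:{0..}|\<mu>. exp (- \<theta> * y)) =
        1 - (1 + c powr (- \<alpha>) * \<theta> powr (- \<alpha>)) powr (- 1 / \<alpha>)))"
proof -
  obtain \<alpha> \<psi>' where \<alpha>: "0 \<le> \<alpha>" "\<alpha> \<le> 1" and \<psi>':
    "\<And>y. y > 0 \<Longrightarrow> (\<psi> has_real_derivative \<psi>' y) (at y)" "\<And>y. y > 0 \<Longrightarrow> 0 < \<psi> y"
    "\<And>y. y > 0 \<Longrightarrow> \<psi> y \<le> y * \<psi>' y" "(\<psi>' \<longlongrightarrow> 0) (at_right 0)"
    "((\<lambda>y. y * \<psi>' y / \<psi> y) \<longlongrightarrow> 1 + \<alpha>) (at_right 0)"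
    using critical_mechanism_elasticity[OF mechanism critical rv] by blast
  interpret cb_process M P X \<psi> by (rule process)
  obtain u where u: "branching_flow \<psi> u"
    "\<And>x t \<theta>. x > 0 \<Longrightarrow> t \<ge> 0 \<Longrightarrow> \<theta> > 0 \<Longrightarrow> (\<integral>\<omega>. exp (- \<theta> * X t \<omega>) \<partial>P x) = exp (- x * u t \<theta>)"
    using laplace by blast
  interpret elastic_cb_process M P X \<psi> \<psi>' \<alpha> u
    by unfold_locales (use \<alpha> \<psi>' u grey in auto)
  interpret H: real_distribution \<mu> by (rule H_distribution)
  have nonneg: "AE y in \<mu>. 0 \<le> y"
  proof (rule AE_I[of _ _ "{..<0}"])
    show "emeasure \<mu> {..<0} = 0" using H_nonneg by (simp add: H.emeasure_eq_measure)
  qed auto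
  have nondegenerate: "\<mu> \<noteq> return borel 0" using H_nondegenerate by blast
  define h where "h \<theta> = (\<integral>y. exp (- \<theta> * max 0 y) \<partial>\<mu>)" for \<theta>
  have h_eq: "(LINT y:{0..}|\<mu>. exp (- \<theta> * y)) = h \<theta>" for \<theta>
    unfolding h_def set_lebesgue_integral_def
    by (rule integral_cong_AE) (use nonneg in \<open>auto elim: eventually_mono\<close>)
  have h_less: "h \<theta>' < h \<theta>" if "0 \<le> \<theta>" "\<theta> < \<theta>'" for \<theta> \<theta>'
    unfolding h_def by (rule laplace_transform_less[OF H_distribution nonneg nondegenerate that])
  have h_pos: "h \<theta> > 0" if "0 \<le> \<theta>" for \<theta>
    unfolding h_def by (rule laplace_transform_pos[OF H_distribution that])
  have h_0: "h 0 = 1" unfolding h_def using H.prob_space by simp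
  have Q_pos': "\<forall>\<^sub>F t in at_top. Q t > 0"
    using eventually_ge_at_top[of 0] by eventually_elim (rule Q_pos)
  have laplace_lim: "((\<lambda>t. (1 - exp (- x * u t (\<theta> * Q t))) / (1 - exp (- x * v t))) \<longlongrightarrow> 1 - h \<theta>) at_top"
    if \<theta>: "\<theta> > 0" for \<theta>
  proof (rule tendsto_at_topI_sequentially)
    fix T :: "nat \<Rightarrow> real" assume T: "filterlim T at_top sequentially"
    \<comment> \<open>Weak convergence is formulated for sequences of laws, and
      \<open>cond_law\<close> is a probability for \<open>t > 0\<close>. The maximum with 1 makes
      every term admissible and eventually agrees with \<open>T\<close>.\<close>
    define S where "S n = max 1 (T n)" for n
    have S_pos: "S n > 0" for n by (simp add: S_def)
    have S_eq: "\<forall>\<^sub>F n in sequentially. S n = T n"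
      using T[unfolded filterlim_at_top, rule_format, of 1] by eventually_elim (simp add: S_def)
    have S: "filterlim S at_top sequentially"
      by (rule filterlim_at_top_mono[OF T]) (simp add: S_def)
    have "weak_conv_m (\<lambda>n. cond_law x (S n) (Q (S n))) \<mu>"
      unfolding weak_conv_m_def weak_conv_def
    proof (intro allI impI)
      fix y assume "isCont (cdf \<mu>) y"
      from filterlim_compose[OF weak_limit[OF this] S]
      show "(\<lambda>n. cdf (cond_law x (S n) (Q (S n))) y) \<longlonglongrightarrow> cdf \<mu> y"
        by (simp add: cdf_cond_law[OF x_pos S_pos])
    qed
    then have "(\<lambda>n. \<integral>y. exp (- \<theta> * max 0 y) \<partial>cond_law x (S n) (Q (S n))) \<longlonglongrightarrow> h \<theta>"
      unfolding h_def
    proof (rule weak_conv_imp_integral_bdd_continuous_conv[rotated 2, where B=1])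
      show "isCont (\<lambda>y. exp (- \<theta> * max 0 y)) y" for y by (intro continuous_intros)
      show "norm (exp (- \<theta> * max 0 y)) \<le> 1" for y using \<theta> by simp
    qed (auto intro: real_distribution_cond_law x_pos S_pos H_distribution)
    then have "(\<lambda>n. 1 - (1 - exp (- x * u (S n) (\<theta> * Q (S n)))) / (1 - exp (- x * v (S n)))) \<longlonglongrightarrow> h \<theta>"
      using S_pos Q_pos[OF less_imp_le[OF S_pos]] by (simp only: laplace_cond_law[OF x_pos S_pos _ \<theta>])
    then have "(\<lambda>n. 1 - (1 - (1 - exp (- x * u (S n) (\<theta> * Q (S n)))) / (1 - exp (- x * v (S n))))) \<longlonglongrightarrow> 1 - h \<theta>"
      by (intro tendsto_intros)
    moreover have "\<forall>\<^sub>F n in sequentially. 1 - (1 - (1 - exp (- x * u (S n) (\<theta> * Q (S n)))) / (1 - exp (- x * v (S n)))) =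
        (1 - exp (- x * u (T n) (\<theta> * Q (T n)))) / (1 - exp (- x * v (T n)))"
      using S_eq by eventually_elim simp
    ultimately show "(\<lambda>n. (1 - exp (- x * u (T n) (\<theta> * Q (T n)))) / (1 - exp (- x * v (T n)))) \<longlonglongrightarrow> 1 - h \<theta>"
      by (rule Lim_transform_eventually)
  qed
  have main: "\<alpha> > 0 \<and> (\<exists>c>0. ((\<lambda>t. Q t / v t) \<longlongrightarrow> c) at_top \<and>
    (\<forall>\<theta>>0. 1 - h \<theta> = (1 + c powr (- \<alpha>) * \<theta> powr (- \<alpha>)) powr (- 1 / \<alpha>)))"
  \<comment> \<open>Here \<open>g\<close> is \<open>1 - h\<close>. Scaling \<open>X t\<close> by
    \<open>Q t\<close> moves the initial value of the flow to \<open>\<theta> * Q t\<close>, whence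
    the choice of \<open>U\<close>.\<close>
  proof (rule limit_identification[where U="\<lambda>t \<theta>. u t (\<theta> * Q t)", OF Q_pos' Q_lim])
    fix \<theta> :: real assume \<theta>: "\<theta> > 0"
    show "0 < 1 - h \<theta>" using h_less[of 0 \<theta>] h_0 \<theta> by simp
    show "1 - h \<theta> < 1" using h_pos[of \<theta>] \<theta> by simp
    show "\<forall>\<^sub>F t in at_top. u t (\<theta> * Q t) > 0 \<and> \<phi> (u t (\<theta> * Q t)) = t + \<phi> (\<theta> * Q t)"
      using Q_pos' eventually_ge_at_top[of 0] by eventually_elim (simp add: \<theta> u_pos phi_u)
    show "((\<lambda>t. u t (\<theta> * Q t) / v t) \<longlongrightarrow> 1 - h \<theta>) at_top"
    proof (rule ratio_of_one_minus_exp[OF x_pos filterlim_v _ laplace_lim[OF \<theta>]])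
      show "\<forall>\<^sub>F t in at_top. 0 < u t (\<theta> * Q t) \<and> u t (\<theta> * Q t) \<le> v t"
        using Q_pos' eventually_gt_at_top[of 0]
        by eventually_elim (simp add: \<theta> u_pos u_less_v less_imp_le)
    qed
  next
    fix \<theta> \<theta>' :: real assume "0 < \<theta>" "\<theta> < \<theta>'"
    then show "1 - h \<theta> < 1 - h \<theta>'" using h_less[of \<theta> \<theta>'] by simp
  qed
  then obtain c where c: "c > 0" "((\<lambda>t. Q t / v t) \<longlongrightarrow> c) at_top"
    "\<And>\<theta>. \<theta> > 0 \<Longrightarrow> 1 - h \<theta> = (1 + c powr (- \<alpha>) * \<theta> powr (- \<alpha>)) powr (- 1 / \<alpha>)" by blast
  \<comment> \<open>For \<open>t > 0\<close> the survival probability is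
    \<open>1 - exp (- v t)\<close> with \<open>v t\<close> tending to 0, so it may replace
    \<open>v t\<close> in the limit.\<close>
  have "((\<lambda>z::real. z / (1 - exp (- z))) \<longlongrightarrow> 1) (at_right 0)" by real_asymp
  from tendsto_mult[OF c(2) filterlim_compose[OF this filterlim_v]]
  have "((\<lambda>t. Q t / v t * (v t / (1 - exp (- v t)))) \<longlongrightarrow> c) at_top" by simp
  moreover have "\<forall>\<^sub>F t in at_top. Q t / v t * (v t / (1 - exp (- v t))) = Q t / survival_prob P X t"
    using eventually_gt_at_top[of 0]
  proof eventually_elim
    case (elim t)
    then show ?case using v_pos[of t] by (simp add: survival_prob_eq)
  qed
  ultimately have survival: "((\<lambda>t. Q t / survival_prob P X t) \<longlongrightarrow> c) at_top"
    by (rule Lim_transform_eventually)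
  have "\<psi> \<theta> = \<theta> powr (1 + \<alpha>) * (\<psi> (1 / (1 / \<theta>)) * (1 / \<theta>) powr (1 + \<alpha>))" if "\<theta> > 0" for \<theta>
    using that by (simp add: powr_divide)
  moreover have "(LINT y:{0..}|\<mu>. exp (- \<theta> * y)) =
      1 - (1 + c powr (- \<alpha>) * \<theta> powr (- \<alpha>)) powr (- 1 / \<alpha>)" if "\<theta> > 0" for \<theta>
    using c(3)[OF that] by (simp only: h_eq)
  ultimately show ?thesis
    using main \<alpha>(2) slowly_varying_factor survival c(1) by blast
qed

end
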